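(* Let $1\le k_0\le k$, let $\delta>0$ and let $G_0\in\mathcal{G}_{k_0}(\Gamma)$ be a given mixing measure. Suppose that the family $\{f(\cdot\mid\gamma):\gamma\in\Gamma\}$ satisfies Assumptions $(A)$, $(B)$ and $C(2k)$. Let $\widehat G_n$ be the maximum likelihood estimator over $\mathcal{G}_{\le k}(\Gamma)$ based on $n$ i.i.d. observations. Then there exist $\varepsilon>0$ and a constant $C>0$ not depending on $n$ such that for all $n\ge 2$ $$\sup_{\substack{G\in\mathcal{G}_{\le k}(\Gamma)\\ W_1(G,G_0)<\varepsilon}}\mathbb{E}_G\big[\mathsf{VPOT}_{G_0,\delta}(\widehat G_n,G)\big]\le C\Big(\frac{\log n}{n}\Big)^{1/2}.$$ Moreover, globally, there exists a constant $C'>0$ not depending on $n$ such that for all $n\ge2$ $$\sup_{G\in\mathcal{G}_{\le k}(\Gamma)}\mathbb{E}_G\big[\mathsf{VPOT}_{G,\delta}(\widehat G_n,G)\big]\le C'\Big(\frac{\log n}{n}\Big)^{1/2}.$$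
   Context: Setting. $d,\bar d,k\ge1$ are integers, $\Gamma\subset\mathbb{R}^d$ is compact with non-empty interior, and $\{f(\cdot\mid\gamma):\gamma\in\Gamma\}$ is a family of probability densities with respect to Lebesgue measure on $\mathbb{R}^{\bar d}$. A finite mixing measure is $G=\sum_{i=1}^{\ell}\pi_i\delta_{\gamma_i}$ with $\pi_i\ge0$, $\gamma_i\in\Gamma$; $m(G)$ is its total mass and $\mathcal{S}(G)$ its (finite) support. $\mathcal{G}_{k}(\Gamma)$, resp. $\mathcal{G}_{\le k}(\Gamma)$, is the set of probability mixing measures on $\Gamma$ with exactly $k$, resp. at least 1 and at most $k$, support points. $p_G(x)=\sum_i\pi_i f(x\mid\gamma_i)$. $\mathbb{E}_G$ is expectation when $X_1,\dots,X_n$ are i.i.d. with density $p_G$. The maximum likelihood estimator $\widehat G_n$ is an element of $\operatorname{arg\,max}_{G'\in\mathcal{G}_{\le k}(\Gamma)}\frac1n\sum_{i=1}^n\log p_{G'}(X_i)$. $G|_A$ denotes the restriction of the measure $G$ to a Borel set $A$; $\mu\preceq\nu$ means $\mu(B)\le\nu(B)$ for every Borel $B$. Wasserstein and POT. For two finite discrete measures $G=\sum_i\pi_i\delta_{\gamma_i}$, $G'=\sum_j\pi'_j\delta_{\gamma'_j}$ of equal total mass and an integer $r\ge1$, $W_r(G,G')=(\inf\sum_{i,j}q_{ij}\|\gamma_i-\gamma_j'\|_2^r)^{1/r}$, the infimum over nonnegative couplings $(q_{ij})$ with marginals $(\pi_i)$ and $(\pi'_j)$. For finite discrete measures of possibly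 different masses, $$\mathsf{POT}_r(G_1,G_2)=\Big(\inf_{\substack{\mu_1\preceq G_1,\ \mu_2\preceq G_2\\ m(\mu_1)=m(\mu_2)=\min\{m(G_1),m(G_2)\}}}W_r^r(\mu_1,\mu_2)+|m(G_1)-m(G_2)|\Big)^{1/r}.$$ VPOT. For a reference $G_0\in\mathcal{G}_{k_0}(\Gamma)$ with atoms $\gamma_{01},\dots,\gamma_{0k_0}$, the Voronoi cell is $\mathcal{V}^i_{G_0}=\{\gamma\in\Gamma:\|\gamma-\gamma_{0i}\|_2\le\|\gamma-\gamma_{0j}\|_2\ \forall j\ne i\}$, and for $j\in\{1,\dots,2k\}$ its extension is $\mathcal{V}^{i,j}_{G_0,\delta}=\{\gamma\in\Gamma:\inf_{\vartheta\in\mathcal{V}^i_{G_0}}\|\vartheta-\gamma\|_2<\frac{j\delta}{2k}\}$. For $G,G'\in\mathcal{G}_{\le k}(\Gamma)$, $$\mathsf{VPOT}_{G_0,\delta}(G,G')=\sum_{i=1}^{k_0}\min_{1\le j\le2k}\Big[\mathsf{POT}_1\big(G|_{\mathcal{V}^{i,j}_{G_0,\delta}},G'|_{\mathcal{V}^{i,j}_{G_0,\delta}}\big)\Big]^{r_{i,j}},\quad r_{i,j}=\max\{|\mathcal{S}(G)\cap\mathcal{V}^{i,j}_{G_0,\delta}|+|\mathcal{S}(G')\cap\mathcal{V}^{i,j}_{G_0,\delta}|-1,\,1\}.$$ $\mathsf{VPOT}_{G,\delta}$ is the same construction with the measure $G$ (and its $|\mathcal{S}(G)|$ atoms) as the reference.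 Assumption $(A)$: there is $L>0$ with $\sup_{x}|f(x\mid\gamma)-f(x\mid\gamma')|\le L\|\gamma-\gamma'\|_2$ for all $\gamma,\gamma'\in\Gamma$. Assumption $(B)$: there are $c,\zeta>0$ with $f(x\mid\gamma)\le c\min(1,\|x\|^{-(\bar d+\zeta)})$ for all $x\in\mathbb{R}^{\bar d}$, $\gamma\in\Gamma$. Assumption $C(p)$: let $F(x\mid\gamma)=\int_{(-\infty,x)}f(t\mid\gamma)\,dt$ be the (multivariate) cumulative distribution function. (1) $D^{\boldsymbol\alpha}_\gamma F(\cdot\mid\gamma)$ exists for every multi-index $\boldsymbol\alpha$ with $0\le|\boldsymbol\alpha|\le p$. (2) ($p$-strong identifiability) For any finite set of distinct points $\gamma_1,\dots,\gamma_\ell\in\Gamma$, if $\big\|\sum_{|\boldsymbol\alpha|\le p}\sum_{j=1}^\ell c_{\boldsymbol\alpha,j}D^{\boldsymbol\alpha}_\gamma F(\cdot\mid\gamma_j)\big\|_\infty=0$ then all $c_{\boldsymbol\alpha,j}=0$. (3) There is $\omega:\mathbb{R}^d\to\mathbb{R}$ with $\lim_{h\to0}\omega(h)=0$ such that for every $|\boldsymbol\alpha|=p$ and all $\gamma,\gamma'\in\Gamma$, $\sup_{x\in\mathbb{R}^{\bar d}}|D^{\boldsymbol\alpha}_\gamma F(x\mid\gamma)-D^{\boldsymbol\alpha}_\gamma F(x\mid\gamma')|\le\omega(\gamma-\gamma')$. *)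

theory Defs
  imports "HOL-Probability.Probability"
begin

definition atoms :: "'a::topological_space measure \<Rightarrow> 'a set" where
  "atoms G = {\<gamma>. measure G {\<gamma>} > 0}"

definition mass :: "'a measure \<Rightarrow> real" where
  "mass G = measure G (space G)"

definition finite_discrete :: "'a::topological_space measure \<Rightarrow> bool" where
  "finite_discrete G \<longleftrightarrow> sets G = sets borel \<and> finite_measure G \<and>
     finite (atoms G) \<and> emeasure G (- atoms G) = 0"

definition mixing_eq :: "nat \<Rightarrow> 'a::topological_space set \<Rightarrow> 'a measure set" where
  "mixing_eq k \<Gamma> = {G. finite_discrete G \<and> prob_space G \<and> atoms G \<subseteq> \<Gamma> \<and> card (atoms G) = k}"

definition mixing_le :: "nat \<Rightarrow> 'a::topological_space set \<Rightarrow> 'a measure set" where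
  "mixing_le k \<Gamma> = {G. finite_discrete G \<and> prob_space G \<and> atoms G \<subseteq> \<Gamma> \<and>
     1 \<le> card (atoms G) \<and> card (atoms G) \<le> k}"

definition restrict_measure :: "'a measure \<Rightarrow> 'a set \<Rightarrow> 'a measure" where
  "restrict_measure G A = density G (indicator A)"

definition dominated :: "'a::topological_space measure \<Rightarrow> 'a measure \<Rightarrow> bool" where
  "dominated \<mu> \<nu> \<longleftrightarrow> (\<forall>B\<in>sets borel. emeasure \<mu> B \<le> emeasure \<nu> B)"

text \<open>Only the values of a coupling on the atoms of the two measures matter.\<close>

definition couplings ::
    "'a::topological_space measure \<Rightarrow> 'a measure \<Rightarrow> ('a \<Rightarrow> 'a \<Rightarrow> real) set" where
  "couplings G G' = {q. (\<forall>x y. 0 \<le> q x y) \<and>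
     (\<forall>x\<in>atoms G. (\<Sum>y\<in>atoms G'. q x y) = measure G {x}) \<and>
     (\<forall>y\<in>atoms G'. (\<Sum>x\<in>atoms G. q x y) = measure G' {y})}"

definition wasserstein :: "nat \<Rightarrow> 'a::metric_space measure \<Rightarrow> 'a measure \<Rightarrow> real" where
  "wasserstein r G G' =
     root r (INF q\<in>couplings G G'. \<Sum>x\<in>atoms G. \<Sum>y\<in>atoms G'. q x y * dist x y ^ r)"

definition sub_pairs ::
    "'a::topological_space measure \<Rightarrow> 'a measure \<Rightarrow> ('a measure \<times> 'a measure) set" where
  "sub_pairs G1 G2 = {(\<mu>1, \<mu>2). finite_discrete \<mu>1 \<and> finite_discrete \<mu>2 \<and>
     dominated \<mu>1 G1 \<and> dominated \<mu>2 G2 \<and>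
     mass \<mu>1 = min (mass G1) (mass G2) \<and> mass \<mu>2 = min (mass G1) (mass G2)}"

definition POT :: "nat \<Rightarrow> 'a::metric_space measure \<Rightarrow> 'a measure \<Rightarrow> real" where
  "POT r G1 G2 =
     root r ((INF (\<mu>1, \<mu>2)\<in>sub_pairs G1 G2. wasserstein r \<mu>1 \<mu>2 ^ r) + \<bar>mass G1 - mass G2\<bar>)"

definition voronoi_cell :: "'a::metric_space set \<Rightarrow> 'a measure \<Rightarrow> 'a \<Rightarrow> 'a set" where
  "voronoi_cell \<Gamma> G0 \<gamma>0 = {\<gamma>\<in>\<Gamma>. \<forall>\<gamma>0'\<in>atoms G0 - {\<gamma>0}. dist \<gamma> \<gamma>0 \<le> dist \<gamma> \<gamma>0'}"

definition voronoi_ext ::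
    "'a::metric_space set \<Rightarrow> nat \<Rightarrow> 'a measure \<Rightarrow> real \<Rightarrow> 'a \<Rightarrow> nat \<Rightarrow> 'a set" where
  "voronoi_ext \<Gamma> k G0 \<delta> \<gamma>0 j =
     {\<gamma>\<in>\<Gamma>. infdist \<gamma> (voronoi_cell \<Gamma> G0 \<gamma>0) < real j * \<delta> / (2 * real k)}"

text \<open>The Voronoi cells are indexed by the atoms of the reference measure \<open>G0\<close> themselves.
  Truncated subtraction in the exponent is harmless because of the maximum with 1.\<close>

definition VPOT ::
    "'a::metric_space set \<Rightarrow> nat \<Rightarrow> 'a measure \<Rightarrow> real \<Rightarrow> 'a measure \<Rightarrow> 'a measure \<Rightarrow> real" where
  "VPOT \<Gamma> k G0 \<delta> G G' =
     (\<Sum>\<gamma>0\<in>atoms G0. MIN j\<in>{1..2 * k}.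
        (let V = voronoi_ext \<Gamma> k G0 \<delta> \<gamma>0 j in
           POT 1 (restrict_measure G V) (restrict_measure G' V)
             ^ max (card (atoms G \<inter> V) + card (atoms G' \<inter> V) - 1) 1))"

text \<open>A family is a function \<open>f\<close> with \<open>f x \<gamma>\<close> the density at the data point \<open>x\<close> for the
  parameter \<open>\<gamma>\<close>; its values for \<open>\<gamma>\<close> outside \<open>\<Gamma>\<close> are irrelevant.\<close>

definition density_family :: "(real^'b \<Rightarrow> real^'d \<Rightarrow> real) \<Rightarrow> (real^'d) set \<Rightarrow> bool" where
  "density_family f \<Gamma> \<longleftrightarrow> (\<forall>\<gamma>\<in>\<Gamma>. (\<lambda>x. f x \<gamma>) \<in> borel_measurable borel \<and> (\<forall>x. 0 \<le> f x \<gamma>) \<and>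
     (\<integral>\<^sup>+x. ennreal (f x \<gamma>) \<partial>lborel) = 1)"

definition mix_density :: "('x \<Rightarrow> 'a::topological_space \<Rightarrow> real) \<Rightarrow> 'a measure \<Rightarrow> 'x \<Rightarrow> real" where
  "mix_density f G x = (\<Sum>\<gamma>\<in>atoms G. measure G {\<gamma>} * f x \<gamma>)"

definition sup_norm :: "('x \<Rightarrow> real) \<Rightarrow> ereal" where
  "sup_norm g = (SUP x. ereal \<bar>g x\<bar>)"

definition assumption_A :: "(real^'b \<Rightarrow> real^'d \<Rightarrow> real) \<Rightarrow> (real^'d) set \<Rightarrow> bool" where
  "assumption_A f \<Gamma> \<longleftrightarrow> (\<exists>L>0. \<forall>\<gamma>\<in>\<Gamma>. \<forall>\<gamma>'\<in>\<Gamma>.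
     sup_norm (\<lambda>x. f x \<gamma> - f x \<gamma>') \<le> ereal (L * norm (\<gamma> - \<gamma>')))"

text \<open>The case distinction is needed because \<open>0 powr a = 0\<close> also for negative \<open>a\<close>, whereas
  \<open>0\<close> raised to a negative power has to be read as infinity here.\<close>

definition assumption_B :: "(real^'b \<Rightarrow> real^'d \<Rightarrow> real) \<Rightarrow> (real^'d) set \<Rightarrow> bool" where
  "assumption_B f \<Gamma> \<longleftrightarrow> (\<exists>c>0. \<exists>\<zeta>>0. \<forall>x. \<forall>\<gamma>\<in>\<Gamma>.
     f x \<gamma> \<le> c * (if x = 0 then 1 else min 1 (norm x powr (- (real CARD('b) + \<zeta>)))))"

definition mcdf :: "(real^'b \<Rightarrow> real^'d \<Rightarrow> real) \<Rightarrow> real^'b \<Rightarrow> real^'d \<Rightarrow> real" where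
  "mcdf f x \<gamma> = (LINT t:{t. \<forall>i. t $ i < x $ i}|lborel. f t \<gamma>)"

definition order_of :: "('d::finite \<Rightarrow> nat) \<Rightarrow> nat" where
  "order_of \<alpha> = (\<Sum>i\<in>UNIV. \<alpha> i)"

text \<open>\<open>D \<alpha>\<close> is the partial derivative of multi-index \<open>\<alpha>\<close>, on the open set \<open>U\<close>, of the
  function \<open>D (\<lambda>_. 0)\<close>, which is \<open>p\<close> times continuously differentiable there. (Continuity in
  orders below \<open>p\<close> follows from continuity of the derivatives of order \<open>p\<close>.)\<close>

definition partial_derivs :: "nat \<Rightarrow> (real^'d) set \<Rightarrow> (('d \<Rightarrow> nat) \<Rightarrow> real^'d \<Rightarrow> real) \<Rightarrow> bool" where
  "partial_derivs p U D \<longleftrightarrow>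
     (\<forall>\<alpha> i. \<forall>\<gamma>\<in>U. order_of \<alpha> < p \<longrightarrow>
        ((\<lambda>t. D \<alpha> (\<gamma> + t *\<^sub>R axis i 1)) has_real_derivative D (\<alpha>(i := Suc (\<alpha> i))) \<gamma>) (at 0)) \<and>
     (\<forall>\<alpha>. order_of \<alpha> = p \<longrightarrow> continuous_on U (D \<alpha>))"

text \<open>As \<open>\<Gamma>\<close> is compact, derivatives at its boundary points need a convention: for every \<open>x\<close>,
  the distribution function is the restriction to \<open>\<Gamma>\<close> of a function that is \<open>p\<close> times
  continuously differentiable on an open neighbourhood \<open>U\<close> of \<open>\<Gamma>\<close>. In the interior of \<open>\<Gamma>\<close> the
  functions \<open>D x \<alpha>\<close> are the ordinary partial derivatives of the distribution function.
  No regularity in \<open>x\<close> and no bound outside \<open>\<Gamma>\<close> is imposed.\<close>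

definition assumption_C :: "nat \<Rightarrow> (real^'b \<Rightarrow> real^'d \<Rightarrow> real) \<Rightarrow> (real^'d) set \<Rightarrow> bool" where
  "assumption_C p f \<Gamma> \<longleftrightarrow> (\<exists>U D.
     open U \<and> \<Gamma> \<subseteq> U \<and>
     (\<forall>x. (\<forall>\<gamma>\<in>\<Gamma>. D x (\<lambda>_. 0) \<gamma> = mcdf f x \<gamma>) \<and> partial_derivs p U (D x)) \<and>
     (\<forall>S c. finite S \<and> S \<subseteq> \<Gamma> \<and>
        sup_norm (\<lambda>x. \<Sum>\<alpha>\<in>{\<alpha>. order_of \<alpha> \<le> p}. \<Sum>\<gamma>\<in>S. c \<alpha> \<gamma> * D x \<alpha> \<gamma>) = 0 \<longrightarrow>
        (\<forall>\<alpha> \<gamma>. order_of \<alpha> \<le> p \<and> \<gamma> \<in> S \<longrightarrow> c \<alpha> \<gamma> = 0)) \<and>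
     (\<exists>\<omega>. (\<omega> \<longlongrightarrow> 0) (at 0) \<and>
        (\<forall>\<alpha>. order_of \<alpha> = p \<longrightarrow> (\<forall>\<gamma>\<in>\<Gamma>. \<forall>\<gamma>'\<in>\<Gamma>.
           sup_norm (\<lambda>x. D x \<alpha> \<gamma> - D x \<alpha> \<gamma>') \<le> ereal (\<omega> (\<gamma> - \<gamma>'))))))"

text \<open>The logarithm takes the value \<open>-\<infinity>\<close> at 0; the library's \<open>ln\<close> is 0 there.\<close>

definition elog :: "real \<Rightarrow> ereal" where
  "elog y = (if y > 0 then ereal (ln y) else -\<infinity>)"

definition log_likelihood ::
    "('x \<Rightarrow> 'a::topological_space \<Rightarrow> real) \<Rightarrow> nat \<Rightarrow> (nat \<Rightarrow> 'x) \<Rightarrow> 'a measure \<Rightarrow> ereal" where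
  "log_likelihood f n X G = ereal (1 / real n) * (\<Sum>i<n. elog (mix_density f G (X i)))"

text \<open>An estimator is a measurable map from samples \<open>X 0, \<dots>, X (n - 1)\<close> to mixing measures,
  the latter with the \<open>\<sigma>\<close>-algebra generated by the evaluations at Borel sets.\<close>

definition is_MLE ::
    "(real^'b \<Rightarrow> real^'d \<Rightarrow> real) \<Rightarrow> (real^'d) set \<Rightarrow> nat \<Rightarrow> nat \<Rightarrow>
     ((nat \<Rightarrow> real^'b) \<Rightarrow> (real^'d) measure) \<Rightarrow> bool" where
  "is_MLE f \<Gamma> k n Ghat \<longleftrightarrow>
     Ghat \<in> measurable (PiM {..<n} (\<lambda>_. borel)) (prob_algebra borel) \<and>
     (\<forall>X\<in>space (PiM {..<n} (\<lambda>_. borel)).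
        is_arg_max (log_likelihood f n X) (\<lambda>G. G \<in> mixing_le k \<Gamma>) (Ghat X))"

definition sample_measure ::
    "(real^'b \<Rightarrow> real^'d \<Rightarrow> real) \<Rightarrow> (real^'d) measure \<Rightarrow> nat \<Rightarrow> (nat \<Rightarrow> real^'b) measure" where
  "sample_measure f G n = PiM {..<n} (\<lambda>_. density lborel (\<lambda>x. ennreal (mix_density f G x)))"

definition expect ::
    "(real^'b \<Rightarrow> real^'d \<Rightarrow> real) \<Rightarrow> (real^'d) measure \<Rightarrow> nat \<Rightarrow> ((nat \<Rightarrow> real^'b) \<Rightarrow> real) \<Rightarrow> ennreal" where
  "expect f G n T = (\<integral>\<^sup>+X. ennreal (T X) \<partial>sample_measure f G n)"

end

theory Submission
  imports Defs
begin

text \<open>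
  Both bounds come from two inequalities that are linked by the Kolmogorov distance
  \<open>KS(G, G') = sup\<^sub>x |F\<^sub>G(x) - F\<^sub>G\<^sub>'(x)|\<close> of the mixture distribution functions
  (\<open>kolmogorov_dist\<close>).

  The deterministic one, \<open>VPOT_le_kolmogorov\<close>, says that \<open>VPOT\<close> with any reference measure \<open>H\<close> with at most
  \<open>k\<close> atoms is at most a constant times \<open>KS\<close>, uniformly in all three measures; the references \<open>H = G0\<close> and \<open>H = G\<close>
  give the two parts of the theorem. Let \<open>\<nu> = G - G'\<close>. By compactness the atoms of \<open>G\<close> and \<open>G'\<close>, at
  most \<open>2k\<close> in number, may be assumed to lie in small balls, called clusters, around a fixed finite
  set. A Taylor expansion of \<open>F\<close> at the centre of a cluster is too crude, because the atoms of a
  cluster may approach one another at very different rates. Instead, if \<open>\<gamma>\<^sub>0, \<dots>, \<gamma>\<^sub>N\<^sub>-\<^sub>1\<close> are the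
  atoms of a cluster with signed weights \<open>w\<^sub>i\<close>, then the Newton form of interpolation, in its version
  for several variables (Kergin interpolation), expresses \<open>\<Sum>\<^sub>i w\<^sub>i \<phi>(\<gamma>\<^sub>i)\<close> exactly through averages
  of \<open>P\<^sub>m(\<partial>)\<phi>\<close>, \<open>m < N\<close>, over small simplices, where \<open>P\<^sub>m\<close> is the homogeneous polynomial
  \<open>P\<^sub>m(z) = \<Sum>\<^sub>i w\<^sub>i \<Prod>\<^sub>l\<^sub><\<^sub>m (\<gamma>\<^sub>i - \<gamma>\<^sub>l) \<bullet> z\<close>. As only values of \<open>P\<^sub>m(\<partial>)\<phi>\<close> enter, replacing the points of the
  simplices by the centre costs an error that is small relative to the coefficients of the \<open>P\<^sub>m\<close>
  themselves, at whatever scale they live. Strong identifiability then bounds all these coefficients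
  by a multiple of \<open>KS\<close> (\<open>newton_moments_le_cdf_distance\<close>).

  It remains to bound partial transport by the numbers \<open>P\<^sub>m(v)\<close>. A direction \<open>v\<close> is chosen in which
  the distances of all atoms survive projection up to a constant (\<open>transversal_direction\<close>). Then
  \<open>P\<^sub>m(v)\<close> are the Newton coefficients of the projected measure on the line, and interpolation of a
  step function that jumps in a gap of length \<open>g\<close> shows that the \<open>\<nu>\<close>-mass on one side of the gap is
  \<open>O(KS \<sqdot> \<Sum>\<^sub>m\<^sub><\<^sub>N (2/g)\<^sup>m)\<close> (\<open>mass_below_gap_le_newton_moments\<close>). Moving mass along the sorted atoms costs
  the sum over all gaps of length times mass that crosses (\<open>partial_coupling_along_path\<close>). The
  crossing mass is also at most 1, so that in a cell with \<open>n\<close> atoms each summand is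
  \<open>O(KS powr (1/(n-1)))\<close> (\<open>gap_flow_bound\<close>), which explains the exponents in \<open>VPOT\<close>. For this a cell must
  not cut through a cluster: each cluster spoils at most one of the \<open>2k\<close> levels over which \<open>VPOT\<close>
  minimizes, and if there are \<open>2k\<close> clusters then each of them is a single atom.

  The probabilistic inequality, \<open>MLE_kolmogorov_tail\<close>, is a union bound. The Lipschitz condition and the
  decay of the densities give polynomially many (in \<open>n\<close>) brackets of width \<open>1/n\<^sup>2\<close>. If a bracket contains
  a mixture whose Kolmogorov distance to the truth exceeds \<open>s\<close>, the Hellinger affinity of its upper end
  with the truth is at most \<open>exp (1/n - s\<^sup>2/8)\<close>, so that the square root of the likelihood ratio of
  the sample has expectation at most \<open>exp (1 - n s\<^sup>2/8)\<close>; but if the estimator falls into the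
  bracket then this square root is at least 1. The choice \<open>s\<^sup>2 \<sim> log n / n\<close> gives the rate.
\<close>

section \<open>Finite tests for linear independence\<close>

text \<open>Gaussian elimination: the dual functionals of linearly independent functions can be taken as
  finite combinations of point evaluations. This replaces the supremum over all data points by a
  maximum over finitely many, for which continuity is uniform.\<close>
lemma finite_point_dual:
  fixes u :: "'i \<Rightarrow> 'x \<Rightarrow> real"
  assumes "finite I"
    and "\<And>c i. (\<And>x. (\<Sum>i\<in>I. c i * u i x) = 0) \<Longrightarrow> i \<in> I \<Longrightarrow> c i = 0"
  shows "\<exists>X l. finite X \<and> (\<forall>i\<in>I. \<forall>j\<in>I. (\<Sum>x\<in>X. l i x * u j x) = (if i = j then 1 else 0))"
  using assms
proof (induction I rule: finite_induct)
  case empty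
  then show ?case by auto
next
  case (insert i0 I)
  have indI: "c i = 0" if "\<And>x. (\<Sum>i\<in>I. c i * u i x) = 0" "i \<in> I" for c i
  proof -
    have "(\<Sum>j\<in>insert i0 I. (c(i0 := 0)) j * u j x) = 0" for x
    proof -
      have "(\<Sum>j\<in>I. (c(i0 := 0)) j * u j x) = (\<Sum>j\<in>I. c j * u j x)"
        using insert.hyps by (intro sum.cong) auto
      then show ?thesis using insert.hyps that by simp
    qed
    then have "(c(i0 := 0)) i = 0"
      using insert.prems that(2) by blast
    then show ?thesis using that(2) insert.hyps by (auto split: if_splits)
  qed
  have "\<exists>X l. finite X \<and> (\<forall>i\<in>I. \<forall>j\<in>I. (\<Sum>x\<in>X. l i x * u j x) = (if i = j then 1 else 0))"
    by (rule insert.IH) (rule indI)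
  then obtain X l where X: "finite X"
    and dual: "\<forall>i\<in>I. \<forall>j\<in>I. (\<Sum>x\<in>X. l i x * u j x) = (if i = j then 1 else 0)"
    by (elim exE conjE) (rule that)
  have l: "(\<Sum>x\<in>X. l i x * u j x) = (if i = j then 1 else 0)" if "i \<in> I" "j \<in> I" for i j
    using dual that by blast
  define a where "a j = (\<Sum>x\<in>X. l j x * u i0 x)" for j
  \<comment> \<open>The part of the new function on which all functionals found so far vanish.\<close>
  define v where "v x = u i0 x - (\<Sum>j\<in>I. a j * u j x)" for x
  obtain x0 where x0: "v x0 \<noteq> 0"
  proof (rule ccontr)
    assume "\<not> thesis"
    with that have v0: "v x = 0" for x by blast
    define c where "c = (\<lambda>i. - a i)(i0 := 1)"
    have "(\<Sum>j\<in>insert i0 I. c j * u j x) = 0" for x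
    proof -
      have "(\<Sum>j\<in>I. c j * u j x) = (\<Sum>j\<in>I. - (a j * u j x))"
        using insert.hyps by (intro sum.cong) (auto simp: c_def)
      then show ?thesis using insert.hyps v0[of x]
        by (simp add: c_def v_def sum_negf)
    qed
    then have "c i0 = 0" using insert.prems by blast
    then show False by (simp add: c_def)
  qed
  define X' where "X' = insert x0 X"
  define le where "le j x = (if x \<in> X then l j x else 0)" for j x
  have X': "finite X'" using X by (simp add: X'_def)
  have le: "(\<Sum>x\<in>X'. le j x * g x) = (\<Sum>x\<in>X. l j x * g x)" for j g
    unfolding X'_def le_def
    by (rule sum.mono_neutral_cong_right) (use X in auto)
  have ev: "(\<Sum>x\<in>X'. (if x = x0 then 1 else 0) * g x) = g x0" for g :: "'x \<Rightarrow> real"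
    using X' by (simp add: X'_def if_distrib[of "\<lambda>z. z * _"] cong: if_cong)
  define l0 where "l0 x = ((if x = x0 then 1 else 0) - (\<Sum>j\<in>I. u j x0 * le j x)) / v x0" for x
  have l0: "(\<Sum>x\<in>X'. l0 x * g x) = (g x0 - (\<Sum>j\<in>I. u j x0 * (\<Sum>x\<in>X. l j x * g x))) / v x0" for g
  proof -
    have "(\<Sum>x\<in>X'. l0 x * g x) =
      ((\<Sum>x\<in>X'. (if x = x0 then 1 else 0) * g x) - (\<Sum>x\<in>X'. \<Sum>j\<in>I. u j x0 * (le j x * g x))) / v x0"
      unfolding l0_def sum_subtractf[symmetric] sum_divide_distrib
      by (intro sum.cong) (auto simp: algebra_simps sum_distrib_left sum_distrib_right diff_divide_distrib)
    also have "(\<Sum>x\<in>X'. \<Sum>j\<in>I. u j x0 * (le j x * g x)) = (\<Sum>j\<in>I. u j x0 * (\<Sum>x\<in>X'. le j x * g x))"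
      by (subst sum.swap) (simp add: sum_distrib_left)
    finally show ?thesis using ev le by simp
  qed
  have l0I: "(\<Sum>x\<in>X'. l0 x * u j x) = 0" if "j \<in> I" for j
  proof -
    have "(\<Sum>i\<in>I. u i x0 * (\<Sum>x\<in>X. l i x * u j x)) = (\<Sum>i\<in>I. if i = j then u i x0 else 0)"
      using that by (intro sum.cong) (auto simp: l)
    then show ?thesis using that insert.hyps unfolding l0 by simp
  qed
  have l00: "(\<Sum>x\<in>X'. l0 x * u i0 x) = 1"
  proof -
    have "u i0 x0 - (\<Sum>j\<in>I. u j x0 * (\<Sum>x\<in>X. l j x * u i0 x)) = v x0"
      by (simp add: v_def a_def mult.commute)
    then show ?thesis using x0 unfolding l0 by simp
  qed
  define l' where "l' i = (if i = i0 then l0 else (\<lambda>x. le i x - a i * l0 x))" for i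
  have l': "(\<Sum>x\<in>X'. l' i x * g x) = (\<Sum>x\<in>X. l i x * g x) - a i * (\<Sum>x\<in>X'. l0 x * g x)"
    if "i \<noteq> i0" for i g
    using that le[of i g] unfolding l'_def
    by (simp add: left_diff_distrib sum_subtractf sum_distrib_left mult.assoc)
  have "(\<Sum>x\<in>X'. l' i x * u j x) = (if i = j then 1 else 0)"
    if "i \<in> insert i0 I" "j \<in> insert i0 I" for i j
  proof (cases "i = i0")
    case True
    then show ?thesis using that l0I l00 insert.hyps by (auto simp: l'_def)
  next
    case False
    then show ?thesis using that l0I l00 insert.hyps by (auto simp: l' l a_def)
  qed
  then show ?case using X' by blast
qed

lemma finite_point_lower_bound:
  fixes u :: "'i \<Rightarrow> 'x \<Rightarrow> real"
  assumes "finite I"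
    and "\<And>c i. (\<And>x. (\<Sum>i\<in>I. c i * u i x) = 0) \<Longrightarrow> i \<in> I \<Longrightarrow> c i = 0"
  shows "\<exists>X K. finite X \<and> K > 0 \<and>
    (\<forall>c. (\<Sum>i\<in>I. \<bar>c i\<bar>) \<le> K * (\<Sum>x\<in>X. \<bar>\<Sum>i\<in>I. c i * u i x\<bar>))"
proof -
  have "\<exists>X l. finite X \<and> (\<forall>i\<in>I. \<forall>j\<in>I. (\<Sum>x\<in>X. l i x * u j x) = (if i = j then 1 else 0))"
    by (rule finite_point_dual) (use assms in auto)
  then obtain X l where X: "finite X"
    and dual: "\<forall>i\<in>I. \<forall>j\<in>I. (\<Sum>x\<in>X. l i x * u j x) = (if i = j then 1 else 0)"
    by (elim exE conjE) (rule that)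
  have l: "(\<Sum>x\<in>X. l i x * u j x) = (if i = j then 1 else 0)" if "i \<in> I" "j \<in> I" for i j
    using dual that by blast
  define K where "K = 1 + (\<Sum>i\<in>I. \<Sum>x\<in>X. \<bar>l i x\<bar>)"
  have "(\<Sum>i\<in>I. \<bar>c i\<bar>) \<le> K * (\<Sum>x\<in>X. \<bar>\<Sum>i\<in>I. c i * u i x\<bar>)" for c
  proof -
    let ?g = "\<lambda>x. \<Sum>i\<in>I. c i * u i x"
    have "\<bar>c i\<bar> \<le> (\<Sum>x\<in>X. \<bar>l i x\<bar>) * (\<Sum>x\<in>X. \<bar>?g x\<bar>)" if "i \<in> I" for i
    proof -
      have "(\<Sum>x\<in>X. l i x * ?g x) = (\<Sum>j\<in>I. c j * (\<Sum>x\<in>X. l i x * u j x))"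
        unfolding sum_distrib_left by (subst sum.swap) (simp add: mult_ac)
      also have "\<dots> = (\<Sum>j\<in>I. if i = j then c j else 0)"
        using that by (intro sum.cong) (auto simp: l)
      also have "\<dots> = c i" using that assms(1) by simp
      finally have "\<bar>c i\<bar> = \<bar>\<Sum>x\<in>X. l i x * ?g x\<bar>" by simp
      also have "\<dots> \<le> (\<Sum>x\<in>X. \<bar>l i x * ?g x\<bar>)" by (rule sum_abs)
      also have "\<dots> \<le> (\<Sum>x\<in>X. \<bar>l i x\<bar> * (\<Sum>x\<in>X. \<bar>?g x\<bar>))"
        unfolding abs_mult
        by (intro sum_mono mult_left_mono member_le_sum) (use X in auto)
      finally show ?thesis by (simp add: sum_distrib_right)
    qed
    then have "(\<Sum>i\<in>I. \<bar>c i\<bar>) \<le> (\<Sum>i\<in>I. (\<Sum>x\<in>X. \<bar>l i x\<bar>) * (\<Sum>x\<in>X. \<bar>?g x\<bar>))"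
      by (rule sum_mono)
    also have "\<dots> = (\<Sum>i\<in>I. \<Sum>x\<in>X. \<bar>l i x\<bar>) * (\<Sum>x\<in>X. \<bar>?g x\<bar>)"
      by (simp add: sum_distrib_right)
    also have "\<dots> \<le> K * (\<Sum>x\<in>X. \<bar>?g x\<bar>)"
      by (intro mult_right_mono sum_nonneg) (auto simp: K_def)
    finally show ?thesis .
  qed
  moreover have "K > 0" unfolding K_def by (intro add_pos_nonneg sum_nonneg) auto
  ultimately show ?thesis using X by blast
qed

section \<open>Products of linear forms and iterated directional derivatives\<close>

text \<open>The coefficient of the monomial \<open>z\<^sup>\<beta>\<close> in the product of the linear forms \<open>z \<mapsto> u \<bullet> z\<close>, with \<open>u\<close>
  running through the list. By the symmetry of higher derivatives it is also the coefficient of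
  \<open>D\<^sup>\<beta>\<close> in the iterated directional derivative along the list.\<close>
primrec linear_forms_coeff :: "(real^'d) list \<Rightarrow> ('d \<Rightarrow> nat) \<Rightarrow> real" where
  "linear_forms_coeff [] \<beta> = (if \<beta> = (\<lambda>_. 0) then 1 else 0)"
| "linear_forms_coeff (u # us) \<beta> =
     (\<Sum>m\<in>UNIV. if \<beta> m = 0 then 0 else u $ m * linear_forms_coeff us (\<beta>(m := \<beta> m - 1)))"

lemma order_of_upd: "order_of (\<beta>(m := n)) + \<beta> m = order_of \<beta> + n"
proof -
  have "order_of (\<beta>(m := n)) = n + (\<Sum>i\<in>UNIV - {m}. \<beta> i)"
    unfolding order_of_def by (subst sum.remove[of _ m]) auto
  moreover have "order_of \<beta> = \<beta> m + (\<Sum>i\<in>UNIV - {m}. \<beta> i)"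
    unfolding order_of_def by (subst sum.remove[of _ m]) auto
  ultimately show ?thesis by simp
qed

lemma order_of_Suc [simp]: "order_of (\<beta>(m := Suc (\<beta> m))) = Suc (order_of \<beta>)"
  using order_of_upd[of \<beta> m "Suc (\<beta> m)"] by simp

lemma order_of_zero_iff: "order_of \<beta> = 0 \<longleftrightarrow> \<beta> = (\<lambda>_. 0)"
  by (auto simp: order_of_def)

lemma finite_order_le: "finite {\<beta>::'d::finite \<Rightarrow> nat. order_of \<beta> \<le> p}"
proof -
  have "\<beta> i \<le> order_of \<beta>" for \<beta> :: "'d \<Rightarrow> nat" and i
    unfolding order_of_def by (rule member_le_sum) auto
  then have "{\<beta>::'d \<Rightarrow> nat. order_of \<beta> \<le> p} \<subseteq> (UNIV \<rightarrow>\<^sub>E {..p})"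
    by (auto simp: PiE_UNIV_domain) (meson le_trans)
  then show ?thesis by (rule finite_subset) (intro finite_PiE, auto)
qed

lemma finite_order_eq: "finite {\<beta>::'d::finite \<Rightarrow> nat. order_of \<beta> = p}"
  by (rule finite_subset[OF _ finite_order_le[of p]]) auto

text \<open>The common source of the product rule for polynomials and of the chain rule for directional
  derivatives: the function \<open>X\<close> will be instantiated with monomials and with partial derivatives.\<close>
lemma sum_linear_forms_coeff_Cons:
  fixes X :: "('d::finite \<Rightarrow> nat) \<Rightarrow> real"
  shows "(\<Sum>\<beta> | order_of \<beta> = Suc j. linear_forms_coeff (u # us) \<beta> * X \<beta>) =
    (\<Sum>m\<in>UNIV. u $ m * (\<Sum>\<alpha> | order_of \<alpha> = j. linear_forms_coeff us \<alpha> * X (\<alpha>(m := Suc (\<alpha> m)))))"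
proof -
  have "(\<Sum>\<beta> | order_of \<beta> = Suc j. linear_forms_coeff (u # us) \<beta> * X \<beta>) =
    (\<Sum>m\<in>UNIV. \<Sum>\<beta> | order_of \<beta> = Suc j.
       (if \<beta> m = 0 then 0 else u $ m * linear_forms_coeff us (\<beta>(m := \<beta> m - 1)) * X \<beta>))"
    by (subst sum.swap) (auto simp: sum_distrib_right intro!: sum.cong)
  also have "\<dots> = (\<Sum>m\<in>UNIV. \<Sum>\<beta> | order_of \<beta> = Suc j \<and> \<beta> m \<noteq> 0.
       u $ m * linear_forms_coeff us (\<beta>(m := \<beta> m - 1)) * X \<beta>)"
    by (intro sum.cong refl sum.mono_neutral_cong_right) (auto simp: finite_order_eq)
  also have "\<dots> = (\<Sum>m\<in>UNIV. \<Sum>\<alpha> | order_of \<alpha> = j.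
       u $ m * linear_forms_coeff us \<alpha> * X (\<alpha>(m := Suc (\<alpha> m))))"
  proof (rule sum.cong[OF refl])
    fix m :: 'd
    show "(\<Sum>\<beta> | order_of \<beta> = Suc j \<and> \<beta> m \<noteq> 0.
       u $ m * linear_forms_coeff us (\<beta>(m := \<beta> m - 1)) * X \<beta>) =
       (\<Sum>\<alpha> | order_of \<alpha> = j. u $ m * linear_forms_coeff us \<alpha> * X (\<alpha>(m := Suc (\<alpha> m))))"
    proof (rule sum.reindex_bij_witness[where i = "\<lambda>\<alpha>. \<alpha>(m := Suc (\<alpha> m))" and j = "\<lambda>\<beta>. \<beta>(m := \<beta> m - 1)"])
      fix \<beta> :: "'d \<Rightarrow> nat" assume "\<beta> \<in> {\<beta>. order_of \<beta> = Suc j \<and> \<beta> m \<noteq> 0}"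
      then show "\<beta>(m := \<beta> m - 1) \<in> {\<alpha>. order_of \<alpha> = j}"
        using order_of_upd[of \<beta> m "\<beta> m - 1"] by auto
    qed auto
  qed
  finally show ?thesis by (simp add: sum_distrib_left mult.assoc)
qed

definition monomial :: "real^'d \<Rightarrow> ('d \<Rightarrow> nat) \<Rightarrow> real" where
  "monomial z \<beta> = (\<Prod>m\<in>UNIV. z $ m ^ \<beta> m)"

lemma monomial_Suc: "monomial z (\<beta>(m := Suc (\<beta> m))) = z $ m * monomial z \<beta>"
proof -
  have "monomial z (\<beta>(m := Suc (\<beta> m))) = z $ m ^ Suc (\<beta> m) * (\<Prod>i\<in>UNIV - {m}. z $ i ^ \<beta> i)"
    unfolding monomial_def by (subst prod.remove[of _ m]) auto
  moreover have "monomial z \<beta> = z $ m ^ \<beta> m * (\<Prod>i\<in>UNIV - {m}. z $ i ^ \<beta> i)"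
    unfolding monomial_def by (subst prod.remove[of _ m]) auto
  ultimately show ?thesis by simp
qed

lemma abs_monomial_le_1: "norm z \<le> 1 \<Longrightarrow> \<bar>monomial z \<beta>\<bar> \<le> 1"
  unfolding monomial_def abs_prod
  by (intro prod_le_1) (auto simp: power_abs intro!: power_le_one order.trans[OF component_le_norm_cart])

lemma sum_linear_forms_coeff_monomial:
  "(\<Sum>\<beta> | order_of \<beta> = length us. linear_forms_coeff us \<beta> * monomial z \<beta>) =
   prod_list (map (\<lambda>u. u \<bullet> z) us)"
proof (induction us)
  case Nil
  have "{\<beta>::'a \<Rightarrow> nat. order_of \<beta> = 0} = {\<lambda>_. 0}" by (auto simp: order_of_zero_iff)
  then show ?case by (simp add: monomial_def)
next
  case (Cons u us)
  have "(\<Sum>\<beta> | order_of \<beta> = length (u # us). linear_forms_coeff (u # us) \<beta> * monomial z \<beta>)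
    = (\<Sum>m\<in>UNIV. u $ m * (z $ m * (\<Sum>\<alpha> | order_of \<alpha> = length us. linear_forms_coeff us \<alpha> * monomial z \<alpha>)))"
    unfolding length_Cons sum_linear_forms_coeff_Cons monomial_Suc
    by (simp add: sum_distrib_left mult_ac)
  also have "\<dots> = (u \<bullet> z) * prod_list (map (\<lambda>u. u \<bullet> z) us)"
    unfolding Cons inner_vec_def by (simp add: sum_distrib_right mult_ac)
  finally show ?case by simp
qed

lemma linear_forms_coeff_zero: "0 \<in> set us \<Longrightarrow> linear_forms_coeff us \<beta> = 0"
  by (induction us arbitrary: \<beta>) (auto intro!: sum.neutral)

text \<open>The coordinates are changed one after the other, and the mean value theorem is applied to each
  change.\<close>
lemma has_derivative_of_continuous_partials:
  fixes g :: "real^'d \<Rightarrow> real" and g' :: "'d \<Rightarrow> real^'d \<Rightarrow> real"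
  assumes "open U" and "y \<in> U"
    and der: "\<And>y i. y \<in> U \<Longrightarrow> ((\<lambda>t. g (y + t *\<^sub>R axis i 1)) has_real_derivative g' i y) (at 0)"
    and cont: "\<And>i. continuous_on U (g' i)"
  shows "(g has_derivative (\<lambda>h. \<Sum>i\<in>UNIV. h $ i * g' i y)) (at y)"
  unfolding has_derivative_at_alt
proof (intro conjI allI impI)
  show "bounded_linear (\<lambda>h::real^'d. \<Sum>i\<in>UNIV. h $ i * g' i y)"
    by (intro bounded_linear_sum bounded_linear_mult_const bounded_linear_vec_nth)
  fix e :: real assume "e > 0"
  define e1 where "e1 = e / real CARD('d)"
  have e1: "e1 > 0" using \<open>e > 0\<close> by (simp add: e1_def)
  have "\<exists>r>0. ball y r \<subseteq> U \<and> (\<forall>z\<in>ball y r. \<bar>g' i z - g' i y\<bar> \<le> e1)" for i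
  proof -
    have "isCont (g' i) y" using cont assms(1,2) continuous_on_eq_continuous_at by blast
    then obtain r where r: "r > 0" "\<And>z. dist z y < r \<Longrightarrow> dist (g' i z) (g' i y) < e1"
      using e1 unfolding continuous_at_eps_delta by (metis dist_norm)
    obtain r' where "r' > 0" "ball y r' \<subseteq> U" using assms(1,2) openE by blast
    then have "min r r' > 0 \<and> ball y (min r r') \<subseteq> U \<and> (\<forall>z\<in>ball y (min r r'). \<bar>g' i z - g' i y\<bar> \<le> e1)"
      using r by (auto simp: dist_commute dist_real_def less_imp_le)
    then show ?thesis by blast
  qed
  then obtain R where R: "\<And>i. R i > 0" "\<And>i. ball y (R i) \<subseteq> U"
      "\<And>i z. z \<in> ball y (R i) \<Longrightarrow> \<bar>g' i z - g' i y\<bar> \<le> e1"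
    by metis
  define r where "r = Min (range R)"
  have r0: "r > 0" unfolding r_def using R(1) by auto
  have rR: "r \<le> R i" for i unfolding r_def by auto
  show "\<exists>d>0. \<forall>z. norm (z - y) < d \<longrightarrow>
      norm (g z - g y - (\<Sum>i\<in>UNIV. (z - y) $ i * g' i y)) \<le> e * norm (z - y)"
  proof (intro exI[of _ r] conjI r0 allI impI)
    fix z assume z: "norm (z - y) < r"
    define h where "h = z - y"
    define hA where "hA A = (\<Sum>i\<in>A. h $ i *\<^sub>R axis i (1::real))" for A
    have hA_nth: "hA A $ j = (if j \<in> A then h $ j else 0)" for A :: "'d set" and j
      by (simp add: hA_def axis_def if_distrib cong: if_cong)
    have hU: "hA UNIV = h" by (simp add: vec_eq_iff hA_nth)
    have key: "\<bar>g (y + hA A) - g y - (\<Sum>i\<in>A. h $ i * g' i y)\<bar> \<le> e1 * (\<Sum>i\<in>A. \<bar>h $ i\<bar>)"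
      for A :: "'d set"
      using finite[of A]
    proof (induction A rule: finite_induct)
      case empty
      then show ?case by (simp add: hA_def)
    next
      case (insert i A)
      define T where "T = {min 0 (h $ i)..max 0 (h $ i)}"
      define \<phi> where "\<phi> t = g (y + hA A + t *\<^sub>R axis i 1) - t * g' i y" for t
      have ball: "y + hA A + t *\<^sub>R axis i 1 \<in> ball y r" if "t \<in> T" for t
      proof -
        have "\<bar>(hA A + t *\<^sub>R axis i 1) $ j\<bar> \<le> \<bar>h $ j\<bar>" for j
          using that insert.hyps by (auto simp: hA_nth axis_def T_def min_def max_def split: if_splits)
        then have "norm (hA A + t *\<^sub>R axis i 1) \<le> norm h"
          by (intro norm_le_componentwise_cart) simp
        moreover have "dist y (y + hA A + t *\<^sub>R axis i 1) = norm (hA A + t *\<^sub>R axis i 1)"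
          by (metis add.assoc add_diff_cancel_left' dist_commute dist_norm)
        ultimately show ?thesis using z by (simp add: h_def)
      qed
      have der\<phi>: "(\<phi> has_field_derivative (g' i (y + hA A + t *\<^sub>R axis i 1) - g' i y)) (at t within T)"
        if "t \<in> T" for t
      proof -
        have "y + hA A + t *\<^sub>R axis i 1 \<in> U" using ball[OF that] R(2)[of i] rR[of i] by auto
        from der[OF this, of i] have "((\<lambda>s. g (y + hA A + t *\<^sub>R axis i 1 + s *\<^sub>R axis i 1))
            has_real_derivative g' i (y + hA A + t *\<^sub>R axis i 1)) (at (t - t))" by simp
        then have "((\<lambda>s. g (y + hA A + t *\<^sub>R axis i 1 + (s - t) *\<^sub>R axis i 1))
            has_real_derivative g' i (y + hA A + t *\<^sub>R axis i 1) * 1) (at t)"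
          by (intro DERIV_chain2[where g = "\<lambda>s. s - t" and f = "\<lambda>s. g (y + hA A + t *\<^sub>R axis i 1 + s *\<^sub>R axis i 1)"])
             (auto intro!: derivative_eq_intros)
        then have "((\<lambda>s. g (y + hA A + s *\<^sub>R axis i 1))
            has_real_derivative g' i (y + hA A + t *\<^sub>R axis i 1)) (at t)"
          by (simp add: algebra_simps)
        then have "(\<phi> has_field_derivative (g' i (y + hA A + t *\<^sub>R axis i 1) - g' i y)) (at t)"
          unfolding \<phi>_def by (auto intro!: derivative_eq_intros)
        then show ?thesis by (rule has_field_derivative_at_within)
      qed
      have "norm (\<phi> (h $ i) - \<phi> 0) \<le> e1 * norm (h $ i - 0)"
      proof (rule field_differentiable_bound[of T, OF _ der\<phi>])
        show "convex T" by (simp add: T_def)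
        show "norm (g' i (y + hA A + t *\<^sub>R axis i 1) - g' i y) \<le> e1" if "t \<in> T" for t
          using R(3)[of _ i] ball[OF that] rR[of i] by auto
      qed (auto simp: T_def)
      moreover have "hA (insert i A) = hA A + h $ i *\<^sub>R axis i 1"
        using insert.hyps by (simp add: hA_def add.commute)
      ultimately have "\<bar>g (y + hA (insert i A)) - h $ i * g' i y - g (y + hA A)\<bar> \<le> e1 * \<bar>h $ i\<bar>"
        by (simp add: \<phi>_def add.assoc)
      then show ?case using insert by (simp add: distrib_left)
    qed
    have "e1 * (\<Sum>i\<in>UNIV. \<bar>h $ i\<bar>) \<le> e1 * (\<Sum>i\<in>(UNIV::'d set). norm h)"
      using e1 by (intro mult_left_mono sum_mono component_le_norm_cart) auto
    also have "\<dots> = e * norm h" by (simp add: e1_def)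
    finally show "norm (g z - g y - (\<Sum>i\<in>UNIV. (z - y) $ i * g' i y)) \<le> e * norm (z - y)"
      using key[of UNIV] by (simp add: hU) (simp add: h_def)
  qed
qed

lemma partial_derivs_continuous:
  assumes "partial_derivs p U D" "open U" "order_of \<alpha> \<le> p"
  shows "continuous_on U (D \<alpha>)"
  using assms(3)
proof (induction "p - order_of \<alpha>" arbitrary: \<alpha>)
  case 0
  then show ?case using assms(1) by (simp add: partial_derivs_def)
next
  case (Suc n)
  then have *: "order_of \<alpha> < p" by simp
  have "continuous_on U (D (\<alpha>(i := Suc (\<alpha> i))))" for i
    by (rule Suc.hyps(1)) (use * Suc.hyps(2) in auto)
  then have "(D \<alpha> has_derivative (\<lambda>h. \<Sum>i\<in>UNIV. h $ i * D (\<alpha>(i := Suc (\<alpha> i))) y)) (at y)" if "y \<in> U" for y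
    using assms(1) * that unfolding partial_derivs_def
    by (intro has_derivative_of_continuous_partials[OF assms(2)]) blast+
  then show ?case
    by (intro has_derivative_continuous_on) (auto intro: has_derivative_at_withinI)
qed

lemma partial_derivs_has_derivative:
  assumes "partial_derivs p U D" "open U" "order_of \<alpha> < p" "y \<in> U"
  shows "(D \<alpha> has_derivative (\<lambda>h. \<Sum>i\<in>UNIV. h $ i * D (\<alpha>(i := Suc (\<alpha> i))) y)) (at y)"
proof (rule has_derivative_of_continuous_partials[OF assms(2,4)])
  show "((\<lambda>t. D \<alpha> (y + t *\<^sub>R axis i 1)) has_real_derivative D (\<alpha>(i := Suc (\<alpha> i))) y) (at 0)"
    if "y \<in> U" for y i
    using assms(1,3) that unfolding partial_derivs_def by blast
  show "continuous_on U (D (\<alpha>(i := Suc (\<alpha> i))))" for i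
    by (rule partial_derivs_continuous[OF assms(1,2)]) (use assms(3) in simp)
qed

definition directional :: "(('d \<Rightarrow> nat) \<Rightarrow> real^'d \<Rightarrow> real) \<Rightarrow> (real^'d) list \<Rightarrow> real^'d \<Rightarrow> real" where
  "directional D us y = (\<Sum>\<beta> | order_of \<beta> = length us. linear_forms_coeff us \<beta> * D \<beta> y)"

lemma directional_has_derivative:
  assumes "partial_derivs p U D" "open U" "length us < p" "a + t *\<^sub>R u \<in> U"
  shows "((\<lambda>t. directional D us (a + t *\<^sub>R u)) has_real_derivative
    directional D (u # us) (a + t *\<^sub>R u)) (at t within T)"
proof -
  let ?y = "a + t *\<^sub>R u"
  have "((\<lambda>t. D \<beta> (a + t *\<^sub>R u)) has_real_derivative
      (\<Sum>i\<in>UNIV. u $ i * D (\<beta>(i := Suc (\<beta> i))) ?y)) (at t within T)" if "order_of \<beta> = length us" for \<beta>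
  proof -
    have "((\<lambda>t. a + t *\<^sub>R u) has_derivative (\<lambda>s. s *\<^sub>R u)) (at t within T)"
      by (auto intro!: derivative_eq_intros)
    from has_derivative_compose[OF this partial_derivs_has_derivative[OF assms(1,2) _ assms(4)], of \<beta>]
    moreover have "(\<lambda>s. \<Sum>i\<in>UNIV. (s *\<^sub>R u) $ i * D (\<beta>(i := Suc (\<beta> i))) ?y)
        = (*) (\<Sum>i\<in>UNIV. u $ i * D (\<beta>(i := Suc (\<beta> i))) ?y)"
      by (simp add: fun_eq_iff sum_distrib_left mult_ac)
    ultimately show ?thesis using that assms(3) by (simp add: has_field_derivative_def)
  qed
  then have "((\<lambda>t. directional D us (a + t *\<^sub>R u)) has_real_derivative
      (\<Sum>\<beta> | order_of \<beta> = length us. linear_forms_coeff us \<beta> * (\<Sum>i\<in>UNIV. u $ i * D (\<beta>(i := Suc (\<beta> i))) ?y)))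
      (at t within T)"
    unfolding directional_def by (intro DERIV_sum DERIV_cmult) auto
  moreover have "(\<Sum>\<beta> | order_of \<beta> = length us. linear_forms_coeff us \<beta> * (\<Sum>i\<in>UNIV. u $ i * D (\<beta>(i := Suc (\<beta> i))) ?y))
      = directional D (u # us) ?y"
    unfolding directional_def length_Cons sum_linear_forms_coeff_Cons sum_distrib_left
    by (subst sum.swap) (simp add: mult_ac)
  ultimately show ?thesis by simp
qed

section \<open>Newton expansion along a configuration of points\<close>

primrec differences :: "(nat \<Rightarrow> 'a::ab_group_add) \<Rightarrow> nat \<Rightarrow> nat \<Rightarrow> 'a list" where
  "differences \<gamma> i 0 = []"
| "differences \<gamma> i (Suc j) = (\<gamma> i - \<gamma> j) # differences \<gamma> i j"

lemma length_differences [simp]: "length (differences \<gamma> i j) = j"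
  by (induction j) auto

lemma differences_inner: "prod_list (map (\<lambda>u. u \<bullet> z) (differences \<gamma> i m)) = (\<Prod>l<m. (\<gamma> i - \<gamma> l) \<bullet> z)"
  by (induction m) (simp_all add: mult.commute)

lemma zero_mem_differences: "i < m \<Longrightarrow> 0 \<in> set (differences \<gamma> i m)"
  by (induction m) (auto simp: less_Suc_eq)

text \<open>The coefficient of \<open>z\<^sup>\<beta>\<close> in \<open>P\<^sub>m(z) = \<Sum>\<^sub>i w\<^sub>i \<Prod>\<^sub>l\<^sub><\<^sub>m (\<gamma>\<^sub>i - \<gamma>\<^sub>l) \<bullet> z\<close>, for \<open>|\<beta>| = m\<close>.\<close>
definition newton_coeff :: "nat \<Rightarrow> (nat \<Rightarrow> real^'d) \<Rightarrow> (nat \<Rightarrow> real) \<Rightarrow> nat \<Rightarrow> ('d \<Rightarrow> nat) \<Rightarrow> real" where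
  "newton_coeff N \<gamma> w m \<beta> = (\<Sum>i<N. w i * linear_forms_coeff (differences \<gamma> i m) \<beta>)"

lemma sum_newton_coeff:
  "(\<Sum>\<beta> | order_of \<beta> = m. newton_coeff N \<gamma> w m \<beta> * X \<beta>) =
   (\<Sum>i<N. w i * (\<Sum>\<beta> | order_of \<beta> = m. linear_forms_coeff (differences \<gamma> i m) \<beta> * X \<beta>))"
  unfolding newton_coeff_def sum_distrib_left sum_distrib_right
  by (subst sum.swap) (simp add: mult_ac)

lemma newton_coeff_bound:
  assumes "norm z \<le> 1"
  shows "\<bar>\<Sum>i<N. w i * (\<Prod>l<m. (\<gamma> i - \<gamma> l) \<bullet> z)\<bar> \<le> (\<Sum>\<beta> | order_of \<beta> = m. \<bar>newton_coeff N \<gamma> w m \<beta>\<bar>)"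
proof -
  have "(\<Sum>i<N. w i * (\<Prod>l<m. (\<gamma> i - \<gamma> l) \<bullet> z)) = (\<Sum>\<beta> | order_of \<beta> = m. newton_coeff N \<gamma> w m \<beta> * monomial z \<beta>)"
    unfolding sum_newton_coeff differences_inner[symmetric]
      sum_linear_forms_coeff_monomial[symmetric] by simp
  also have "\<bar>\<dots>\<bar> \<le> (\<Sum>\<beta> | order_of \<beta> = m. \<bar>newton_coeff N \<gamma> w m \<beta> * monomial z \<beta>\<bar>)"
    by (rule sum_abs)
  also have "\<dots> \<le> (\<Sum>\<beta> | order_of \<beta> = m. \<bar>newton_coeff N \<gamma> w m \<beta>\<bar>)"
    using abs_monomial_le_1[OF assms] by (intro sum_mono) (auto simp: abs_mult mult_left_le)
  finally show ?thesis .
qed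

text \<open>A form of the Hermite--Genocchi formula without iterated integrals. Write
  \<open>S\<^sub>j(y, t) = \<Sum>\<^sub>i w\<^sub>i (D\<^sub>\<gamma>\<^sub>i\<^sub>-\<^sub>\<gamma>\<^sub>0 \<cdots> D\<^sub>\<gamma>\<^sub>i\<^sub>-\<^sub>\<gamma>\<^sub>j\<^sub>-\<^sub>1 \<phi>)(y + t (\<gamma>\<^sub>i - \<gamma>\<^sub>j))\<close>. Then
  \<open>\<partial>\<^sub>t S\<^sub>j(y, t) = S\<^sub>j\<^sub>+\<^sub>1(y + t (\<gamma>\<^sub>j\<^sub>+\<^sub>1 - \<gamma>\<^sub>j), t)\<close>, because the points at which the next derivative is
  evaluated are the same; and \<open>S\<^sub>N = 0\<close>, as one of the directions vanishes for every \<open>i < N\<close>.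
  Integrating from \<open>j = N\<close> downwards, by means of the mean value theorem, compares \<open>S\<^sub>j\<close> with a
  polynomial in \<open>t\<close>. The numbers \<open>a m\<close> are the values of \<open>P\<^sub>m(\<partial>)\<phi>\<close> at the centre, and \<open>e m\<close> bounds
  their oscillation.\<close>
lemma newton_expansion_step:
  fixes \<gamma> :: "nat \<Rightarrow> real^'d"
  assumes D: "partial_derivs p U D" "open U" and B: "convex B" "B \<subseteq> U"
    and "N \<le> p" and \<gamma>: "\<And>i. \<gamma> i \<in> B"
    and e: "\<And>m y. m < N \<Longrightarrow> y \<in> B \<Longrightarrow> \<bar>(\<Sum>i<N. w i * directional D (differences \<gamma> i m) y) - a m\<bar> \<le> e m"
    and "j + n = N" and "y \<in> B" and "0 \<le> t" "t \<le> 1" and "\<And>i. y + t *\<^sub>R (\<gamma> i - \<gamma> j) \<in> B"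
  shows "\<bar>(\<Sum>i<N. w i * directional D (differences \<gamma> i j) (y + t *\<^sub>R (\<gamma> i - \<gamma> j)))
      - (\<Sum>r<n. t ^ r / fact r * a (j + r))\<bar> \<le> (\<Sum>r<n. e (j + r))"
  using assms(8-)
proof (induction n arbitrary: j y t)
  case 0
  have "directional D (differences \<gamma> i j) x = 0" if "i < N" for i x
    using 0 zero_mem_differences[of i j \<gamma>] that
    by (simp add: directional_def linear_forms_coeff_zero)
  then show ?case by simp
next
  case (Suc n)
  define S where "S s = (\<Sum>i<N. w i * directional D (differences \<gamma> i j) (y + s *\<^sub>R (\<gamma> i - \<gamma> j)))" for s
  define S' where "S' s = (\<Sum>i<N. w i * directional D (differences \<gamma> i (Suc j)) (y + s *\<^sub>R (\<gamma> i - \<gamma> j)))" for s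
  define Q where "Q s = (\<Sum>r<Suc n. s ^ r / fact r * a (j + r))" for s
  define Q' where "Q' s = (\<Sum>r<n. s ^ r / fact r * a (Suc j + r))" for s
  define E where "E = (\<Sum>r<n. e (Suc j + r))"
  have inB: "y + s *\<^sub>R (\<gamma> i - \<gamma> j) \<in> B" if "s \<in> {0..t}" for s i
  proof (cases "t = 0")
    case True then show ?thesis using that Suc.prems by auto
  next
    case False
    with that have t: "t > 0" by auto
    have "y + s *\<^sub>R (\<gamma> i - \<gamma> j) = (1 - s / t) *\<^sub>R y + (s / t) *\<^sub>R (y + t *\<^sub>R (\<gamma> i - \<gamma> j))"
      using t by (simp add: algebra_simps scaleR_add_left[symmetric])
    also have "\<dots> \<in> B"
      by (rule convexD[OF B(1)]) (use that t Suc.prems in auto)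
    finally show ?thesis .
  qed
  have dS: "(S has_real_derivative S' s) (at s within {0..t})" if "s \<in> {0..t}" for s
    unfolding S_def S'_def differences.simps
    using inB[OF that] B Suc.prems \<open>N \<le> p\<close>
    by (intro DERIV_sum DERIV_cmult directional_has_derivative[OF D]) auto
  have dQ: "(Q has_real_derivative Q' s) (at s within {0..t})" for s
  proof -
    have "((\<lambda>s. a j + (\<Sum>r<n. s ^ Suc r / fact (Suc r) * a (Suc j + r))) has_real_derivative
      0 + (\<Sum>r<n. s ^ r / fact r * a (Suc j + r))) (at s within {0..t})"
    proof (intro DERIV_add DERIV_const DERIV_sum)
      fix r
      have "((\<lambda>s. s ^ Suc r / fact (Suc r) * a (Suc j + r)) has_real_derivative
         (real (Suc r) * s ^ r) / fact (Suc r) * a (Suc j + r)) (at s within {0..t})"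
        using DERIV_pow[of "Suc r" s "{0..t}"] by (intro DERIV_cmult_right DERIV_cdivide) simp
      also have "(real (Suc r) * s ^ r) / fact (Suc r) = s ^ r / fact r"
        by (simp add: field_simps del: of_nat_Suc)
      finally show "((\<lambda>s. s ^ Suc r / fact (Suc r) * a (Suc j + r)) has_real_derivative
         s ^ r / fact r * a (Suc j + r)) (at s within {0..t})" .
    qed
    moreover have "Q = (\<lambda>s. a j + (\<Sum>r<n. s ^ Suc r / fact (Suc r) * a (Suc j + r)))"
      unfolding Q_def by (subst sum.lessThan_Suc_shift) simp
    ultimately show ?thesis by (simp add: Q'_def)
  qed
  have "\<bar>S' s - Q' s\<bar> \<le> E" if "s \<in> {0..t}" for s
  proof -
    have shift: "y + s *\<^sub>R (\<gamma> (Suc j) - \<gamma> j) + s *\<^sub>R (\<gamma> i - \<gamma> (Suc j)) = y + s *\<^sub>R (\<gamma> i - \<gamma> j)" for i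
      by (simp add: algebra_simps)
    \<comment> \<open>The case \<open>Suc j = N\<close> is included, because \<open>\<gamma> N\<close> is assumed to lie in \<open>B\<close> as well.\<close>
    from Suc.IH[of "Suc j" "y + s *\<^sub>R (\<gamma> (Suc j) - \<gamma> j)" s, unfolded shift]
    show ?thesis using inB[OF that] that Suc.prems unfolding S'_def Q'_def E_def by simp
  qed
  then have "norm ((S t - Q t) - (S 0 - Q 0)) \<le> E * norm (t - 0)"
    using Suc.prems
    by (intro field_differentiable_bound[of "{0..t}" "\<lambda>s. S s - Q s" "\<lambda>s. S' s - Q' s"] DERIV_diff dS dQ) auto
  also have "\<dots> \<le> E"
  proof -
    have "0 \<le> e (Suc j + r)" if "r < n" for r
      using e[of "Suc j + r" y] that Suc.prems by auto
    then have "0 \<le> E" unfolding E_def by (intro sum_nonneg) auto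
    then show ?thesis using Suc.prems by (simp add: mult_left_le)
  qed
  finally have "\<bar>(S t - Q t) - (S 0 - Q 0)\<bar> \<le> E" by simp
  moreover have "\<bar>S 0 - Q 0\<bar> \<le> e j"
  proof -
    have "Q 0 = a j" unfolding Q_def by (subst sum.lessThan_Suc_shift) simp
    then show ?thesis using e[of j y] Suc.prems by (simp add: S_def)
  qed
  moreover have "(\<Sum>r<Suc n. e (j + r)) = e j + E"
    unfolding E_def by (subst sum.lessThan_Suc_shift) simp
  ultimately show ?case unfolding S_def[symmetric] Q_def[symmetric] by linarith
qed

text \<open>The error is proportional to the coefficients of the polynomials \<open>P\<^sub>m\<close>, not to the weights \<open>w\<close>:
  cancellation between nearby points is retained.\<close>
lemma newton_expansion:
  fixes \<gamma> :: "nat \<Rightarrow> real^'d"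
  assumes D: "partial_derivs p U D" "open U" and B: "convex B" "B \<subseteq> U"
    and "N \<le> p" and \<gamma>: "\<And>i. \<gamma> i \<in> B"
    and \<eta>: "\<And>\<beta> y. order_of \<beta> < p \<Longrightarrow> y \<in> B \<Longrightarrow> \<bar>D \<beta> y - D \<beta> \<gamma>0\<bar> \<le> \<eta>"
  shows "\<bar>(\<Sum>i<N. w i * D (\<lambda>_. 0) (\<gamma> i))
      - (\<Sum>m<N. \<Sum>\<beta> | order_of \<beta> = m. newton_coeff N \<gamma> w m \<beta> / fact m * D \<beta> \<gamma>0)\<bar>
    \<le> \<eta> * (\<Sum>m<N. \<Sum>\<beta> | order_of \<beta> = m. \<bar>newton_coeff N \<gamma> w m \<beta>\<bar>)"
proof -
  define a where "a m = (\<Sum>\<beta> | order_of \<beta> = m. newton_coeff N \<gamma> w m \<beta> * D \<beta> \<gamma>0)" for m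
  have dir: "(\<Sum>i<N. w i * directional D (differences \<gamma> i m) y) =
      (\<Sum>\<beta> | order_of \<beta> = m. newton_coeff N \<gamma> w m \<beta> * D \<beta> y)" for m y
    unfolding sum_newton_coeff directional_def by simp
  have e: "\<bar>(\<Sum>i<N. w i * directional D (differences \<gamma> i m) y) - a m\<bar>
      \<le> \<eta> * (\<Sum>\<beta> | order_of \<beta> = m. \<bar>newton_coeff N \<gamma> w m \<beta>\<bar>)" if "m < N" "y \<in> B" for m y
  proof -
    have "\<bar>(\<Sum>i<N. w i * directional D (differences \<gamma> i m) y) - a m\<bar>
       = \<bar>\<Sum>\<beta> | order_of \<beta> = m. newton_coeff N \<gamma> w m \<beta> * (D \<beta> y - D \<beta> \<gamma>0)\<bar>"
      unfolding dir a_def by (simp add: sum_subtractf right_diff_distrib)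
    also have "\<dots> \<le> (\<Sum>\<beta> | order_of \<beta> = m. \<bar>newton_coeff N \<gamma> w m \<beta> * (D \<beta> y - D \<beta> \<gamma>0)\<bar>)"
      by (rule sum_abs)
    also have "\<dots> \<le> (\<Sum>\<beta> | order_of \<beta> = m. \<eta> * \<bar>newton_coeff N \<gamma> w m \<beta>\<bar>)"
    proof (rule sum_mono)
      fix \<beta> :: "'d \<Rightarrow> nat" assume "\<beta> \<in> {\<beta>. order_of \<beta> = m}"
      then have "\<bar>D \<beta> y - D \<beta> \<gamma>0\<bar> \<le> \<eta>" using \<eta>[of \<beta> y] that \<open>N \<le> p\<close> by auto
      from mult_left_mono[OF this abs_ge_zero, of "newton_coeff N \<gamma> w m \<beta>"]
      show "\<bar>newton_coeff N \<gamma> w m \<beta> * (D \<beta> y - D \<beta> \<gamma>0)\<bar> \<le> \<eta> * \<bar>newton_coeff N \<gamma> w m \<beta>\<bar>"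
        by (simp add: abs_mult mult.commute)
    qed
    finally show ?thesis by (simp add: sum_distrib_left)
  qed
  have zero: "{\<beta>::'d \<Rightarrow> nat. order_of \<beta> = 0} = {\<lambda>_. 0}" by (auto simp: order_of_zero_iff)
  have "directional D (differences \<gamma> i 0) x = D (\<lambda>_. 0) x" for i x
    by (simp add: directional_def zero)
  moreover have "\<bar>(\<Sum>i<N. w i * directional D (differences \<gamma> i 0) (\<gamma> 0 + 1 *\<^sub>R (\<gamma> i - \<gamma> 0)))
      - (\<Sum>r<N. 1 ^ r / fact r * a (0 + r))\<bar>
     \<le> (\<Sum>r<N. \<eta> * (\<Sum>\<beta> | order_of \<beta> = 0 + r. \<bar>newton_coeff N \<gamma> w (0 + r) \<beta>\<bar>))"
    by (rule newton_expansion_step[OF D B \<open>N \<le> p\<close> \<gamma> e]) (use \<gamma> in auto)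
  ultimately show ?thesis
    by (simp add: a_def sum_distrib_left)
qed

section \<open>Newton moments are controlled by the distance of distribution functions\<close>

lemma sum_by_order:
  fixes g :: "nat \<Rightarrow> ('d::finite \<Rightarrow> nat) \<Rightarrow> real"
  assumes "N \<le> Suc p"
  shows "(\<Sum>\<beta> | order_of \<beta> \<le> p. if order_of \<beta> < N then g (order_of \<beta>) \<beta> else 0)
    = (\<Sum>m<N. \<Sum>\<beta> | order_of \<beta> = m. g m \<beta>)"
proof -
  have "(\<Sum>\<beta> | order_of \<beta> \<le> p. if order_of \<beta> < N then g (order_of \<beta>) \<beta> else 0)
    = (\<Sum>\<beta> | order_of \<beta> < N. g (order_of \<beta>) \<beta>)"
    by (intro sum.mono_neutral_cong_right) (use assms in \<open>auto simp: finite_order_le\<close>)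
  also have "\<dots> = (\<Sum>m<N. \<Sum>\<beta> | \<beta> \<in> {\<beta>. order_of \<beta> < N} \<and> order_of \<beta> = m. g (order_of \<beta>) \<beta>)"
    by (intro sum.group[symmetric] finite_subset[OF _ finite_order_le[of N]]) auto
  also have "\<dots> = (\<Sum>m<N. \<Sum>\<beta> | order_of \<beta> = m. g m \<beta>)"
    by (intro sum.cong) auto
  finally show ?thesis .
qed

lemma assumption_C_E:
  fixes f :: "real^'b \<Rightarrow> real^'d \<Rightarrow> real"
  assumes "assumption_C p f \<Gamma>" "finite S" "S \<subseteq> \<Gamma>"
  obtains U D where "open U" "\<Gamma> \<subseteq> U" "\<And>x \<gamma>. \<gamma> \<in> \<Gamma> \<Longrightarrow> D x (\<lambda>_. 0) \<gamma> = mcdf f x \<gamma>"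
    "\<And>x. partial_derivs p U (D x)"
    "\<forall>c. (\<forall>x. (\<Sum>(s, \<alpha>) \<in> S \<times> {\<alpha>. order_of \<alpha> \<le> p}. c (s, \<alpha>) * D x \<alpha> s) = 0) \<longrightarrow>
        (\<forall>s\<in>S. \<forall>\<alpha>. order_of \<alpha> \<le> p \<longrightarrow> c (s, \<alpha>) = 0)"
proof -
  obtain U D where U: "open U" "\<Gamma> \<subseteq> U"
    and D: "\<forall>x. (\<forall>\<gamma>\<in>\<Gamma>. D x (\<lambda>_. 0) \<gamma> = mcdf f x \<gamma>) \<and> partial_derivs p U (D x)"
    and ident: "\<forall>S c. finite S \<and> S \<subseteq> \<Gamma> \<and>
        sup_norm (\<lambda>x. \<Sum>\<alpha>\<in>{\<alpha>. order_of \<alpha> \<le> p}. \<Sum>\<gamma>\<in>S. c \<alpha> \<gamma> * D x \<alpha> \<gamma>) = 0 \<longrightarrow>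
        (\<forall>\<alpha> \<gamma>. order_of \<alpha> \<le> p \<and> \<gamma> \<in> S \<longrightarrow> c \<alpha> \<gamma> = 0)"
    using assms(1) unfolding assumption_C_def by (elim exE conjE) (rule that)
  have "\<forall>c. (\<forall>x. (\<Sum>(s, \<alpha>) \<in> S \<times> {\<alpha>. order_of \<alpha> \<le> p}. c (s, \<alpha>) * D x \<alpha> s) = 0) \<longrightarrow>
        (\<forall>s\<in>S. \<forall>\<alpha>. order_of \<alpha> \<le> p \<longrightarrow> c (s, \<alpha>) = 0)"
  proof (intro allI impI ballI)
    fix c :: "(real^'d) \<times> ('d \<Rightarrow> nat) \<Rightarrow> real" and s and \<alpha> :: "'d \<Rightarrow> nat"
    assume z: "\<forall>x. (\<Sum>(s, \<alpha>) \<in> S \<times> {\<alpha>. order_of \<alpha> \<le> p}. c (s, \<alpha>) * D x \<alpha> s) = 0"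
      and s: "s \<in> S" "order_of \<alpha> \<le> p"
    have "(\<Sum>\<alpha>\<in>{\<alpha>. order_of \<alpha> \<le> p}. \<Sum>\<gamma>\<in>S. c (\<gamma>, \<alpha>) * D x \<alpha> \<gamma>) = 0" for x
      using z by (subst sum.swap) (simp add: sum.cartesian_product)
    then have "sup_norm (\<lambda>x. \<Sum>\<alpha>\<in>{\<alpha>. order_of \<alpha> \<le> p}. \<Sum>\<gamma>\<in>S. c (\<gamma>, \<alpha>) * D x \<alpha> \<gamma>) = 0"
      by (simp add: sup_norm_def zero_ereal_def[symmetric])
    then show "c (s, \<alpha>) = 0"
      using ident[THEN spec, of S, THEN spec, of "\<lambda>\<alpha> \<gamma>. c (\<gamma>, \<alpha>)"] assms s by simp
  qed
  from that[OF U _ _ this] D show ?thesis by simp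
qed

lemma uniform_modulus_near_finite_set:
  fixes g :: "'x \<Rightarrow> 'i \<Rightarrow> 'a::metric_space \<Rightarrow> real"
  assumes "finite S" "S \<subseteq> U" "open U" "finite X" "finite J" "\<eta> > 0"
    and "\<And>x i. x \<in> X \<Longrightarrow> i \<in> J \<Longrightarrow> continuous_on U (g x i)"
  shows "\<exists>\<epsilon>>0. \<forall>s\<in>S. ball s \<epsilon> \<subseteq> U \<and> (\<forall>s'\<in>S. s \<noteq> s' \<longrightarrow> ball s \<epsilon> \<inter> ball s' \<epsilon> = {}) \<and>
    (\<forall>y\<in>ball s \<epsilon>. \<forall>x\<in>X. \<forall>i\<in>J. \<bar>g x i y - g x i s\<bar> \<le> \<eta>)"
proof -
  have "\<exists>r>0. ball s r \<subseteq> U \<and> (\<forall>s'\<in>S. s \<noteq> s' \<longrightarrow> 2 * r \<le> dist s s') \<and>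
    (\<forall>y\<in>ball s r. \<forall>x\<in>X. \<forall>i\<in>J. \<bar>g x i y - g x i s\<bar> \<le> \<eta>)" if s: "s \<in> S" for s
  proof -
    have "\<forall>\<^sub>F y in nhds s. \<bar>g x i y - g x i s\<bar> \<le> \<eta>" if "x \<in> X" "i \<in> J" for x i
    proof -
      have "isCont (g x i) s"
        using assms(2,3,7) that s continuous_on_eq_continuous_at by blast
      then have "((g x i) \<longlongrightarrow> g x i s) (nhds s)"
        by (simp add: continuous_at tendsto_at_iff_tendsto_nhds)
      then have "\<forall>\<^sub>F y in nhds s. dist (g x i y) (g x i s) < \<eta>"
        using assms(6) by (rule tendstoD)
      then show ?thesis by eventually_elim (simp add: dist_real_def)
    qed
    then have "\<forall>\<^sub>F y in nhds s. \<forall>x\<in>X. \<forall>i\<in>J. \<bar>g x i y - g x i s\<bar> \<le> \<eta>"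
      using assms(4,5) by (auto intro!: eventually_ball_finite)
    then have "\<forall>\<^sub>F y in nhds s. y \<in> U \<and> (\<forall>x\<in>X. \<forall>i\<in>J. \<bar>g x i y - g x i s\<bar> \<le> \<eta>)"
      using assms(2,3) s by (intro eventually_conj eventually_nhds_in_open) auto
    then obtain r where r: "r > 0" "\<And>y. dist y s < r \<Longrightarrow> y \<in> U \<and> (\<forall>x\<in>X. \<forall>i\<in>J. \<bar>g x i y - g x i s\<bar> \<le> \<eta>)"
      unfolding eventually_nhds_metric by blast
    obtain d where d: "d > 0" "\<And>x. x \<in> S \<Longrightarrow> x \<noteq> s \<Longrightarrow> d \<le> dist s x"
      using finite_set_avoid[OF assms(1)] by metis
    have "min r (d / 2) > 0 \<and> ball s (min r (d / 2)) \<subseteq> U \<and> (\<forall>s'\<in>S. s \<noteq> s' \<longrightarrow> 2 * min r (d / 2) \<le> dist s s') \<and>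
      (\<forall>y\<in>ball s (min r (d / 2)). \<forall>x\<in>X. \<forall>i\<in>J. \<bar>g x i y - g x i s\<bar> \<le> \<eta>)"
    proof (intro conjI ballI impI)
      show "2 * min r (d / 2) \<le> dist s s'" if "s' \<in> S" "s \<noteq> s'" for s'
        using d(2)[OF that(1)] that(2) by (simp add: min_def)
    qed (use r d(1) in \<open>auto simp: dist_commute\<close>)
    then show ?thesis by blast
  qed
  then obtain r where r: "\<And>s. s \<in> S \<Longrightarrow> r s > 0 \<and> ball s (r s) \<subseteq> U \<and> (\<forall>s'\<in>S. s \<noteq> s' \<longrightarrow> 2 * r s \<le> dist s s') \<and>
    (\<forall>y\<in>ball s (r s). \<forall>x\<in>X. \<forall>i\<in>J. \<bar>g x i y - g x i s\<bar> \<le> \<eta>)" by metis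
  define \<epsilon> where "\<epsilon> = Min (insert 1 (r ` S))"
  have \<epsilon>: "\<epsilon> > 0" "\<And>s. s \<in> S \<Longrightarrow> \<epsilon> \<le> r s" using r assms(1) by (auto simp: \<epsilon>_def)
  have "ball s \<epsilon> \<inter> ball s' \<epsilon> = {}" if "s \<in> S" "s' \<in> S" "s \<noteq> s'" for s s'
  proof (rule disjoint_ballI)
    show "\<epsilon> + \<epsilon> \<le> dist s s'" using r[OF that(1)] \<epsilon>(2)[OF that(1)] that by fastforce
  qed
  moreover have "ball s \<epsilon> \<subseteq> ball s (r s)" if "s \<in> S" for s
    using \<epsilon>(2)[OF that] by (rule subset_ball)
  ultimately have "ball s \<epsilon> \<subseteq> U" "\<And>s'. s' \<in> S \<Longrightarrow> s \<noteq> s' \<Longrightarrow> ball s \<epsilon> \<inter> ball s' \<epsilon> = {}"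
    "\<And>y x i. y \<in> ball s \<epsilon> \<Longrightarrow> x \<in> X \<Longrightarrow> i \<in> J \<Longrightarrow> \<bar>g x i y - g x i s\<bar> \<le> \<eta>" if "s \<in> S" for s
    using r[OF that] that by blast+
  then show ?thesis using \<epsilon>(1) by (intro exI[of _ \<epsilon>] conjI ballI impI)
qed

text \<open>Strong identifiability gives a finite set \<open>X\<close> of data points on which the derivatives of the
  distribution function at the centres are linearly independent with a quantitative bound. The
  radius \<open>\<epsilon>\<close> is such that these derivatives vary little on the balls for the data points in \<open>X\<close>, so
  that the error of \<open>newton_expansion\<close> is absorbed. The segments between the atoms may leave \<open>\<Gamma>\<close>;
  they stay in the balls, where the derivatives are continuous.\<close>
lemma newton_moments_le_cdf_distance:
  fixes f :: "real^'b \<Rightarrow> real^'d \<Rightarrow> real"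
  assumes "assumption_C p f \<Gamma>" "finite S" "S \<subseteq> \<Gamma>"
  shows "\<exists>\<epsilon>>0. \<exists>K>0. (\<forall>s\<in>S. \<forall>s'\<in>S. s \<noteq> s' \<longrightarrow> ball s \<epsilon> \<inter> ball s' \<epsilon> = {}) \<and>
    (\<forall>N \<gamma> w B. (\<forall>s\<in>S. N s \<le> p \<and> (\<forall>i<N s. \<gamma> s i \<in> ball s \<epsilon> \<inter> \<Gamma>)) \<longrightarrow>
       (\<forall>x. \<bar>\<Sum>s\<in>S. \<Sum>i<N s. w s i * mcdf f x (\<gamma> s i)\<bar> \<le> B) \<longrightarrow>
       (\<forall>s\<in>S. \<forall>m<N s. \<forall>z. norm z \<le> 1 \<longrightarrow>
          \<bar>\<Sum>i<N s. w s i * (\<Prod>l<m. (\<gamma> s i - \<gamma> s l) \<bullet> z)\<bar> \<le> K * B))"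
proof -
  obtain U D where U: "open U" "\<Gamma> \<subseteq> U" and D0: "\<And>x \<gamma>. \<gamma> \<in> \<Gamma> \<Longrightarrow> D x (\<lambda>_. 0) \<gamma> = mcdf f x \<gamma>"
    and D: "\<And>x. partial_derivs p U (D x)"
    and ident: "\<forall>c. (\<forall>x. (\<Sum>(s, \<alpha>) \<in> S \<times> {\<alpha>. order_of \<alpha> \<le> p}. c (s, \<alpha>) * D x \<alpha> s) = 0) \<longrightarrow>
        (\<forall>s\<in>S. \<forall>\<alpha>. order_of \<alpha> \<le> p \<longrightarrow> c (s, \<alpha>) = 0)"
    by (rule assumption_C_E[OF assms]) (rule that)
  define I where "I = S \<times> {\<alpha>::'d \<Rightarrow> nat. order_of \<alpha> \<le> p}"
  define u where "u = (\<lambda>(s, \<alpha>) x. D x \<alpha> s)"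
  have I: "finite I" using assms(2) by (simp add: I_def finite_order_le)
  have "\<exists>X K. finite X \<and> K > 0 \<and> (\<forall>c. (\<Sum>i\<in>I. \<bar>c i\<bar>) \<le> K * (\<Sum>x\<in>X. \<bar>\<Sum>i\<in>I. c i * u i x\<bar>))"
  proof (rule finite_point_lower_bound[OF I])
    fix c and i :: "(real^'d) \<times> ('d \<Rightarrow> nat)" assume z: "\<And>x. (\<Sum>i\<in>I. c i * u i x) = 0" and "i \<in> I"
    then obtain s \<alpha> where i: "i = (s, \<alpha>)" "s \<in> S" "order_of \<alpha> \<le> p" by (auto simp: I_def)
    have "\<forall>x. (\<Sum>(s, \<alpha>) \<in> S \<times> {\<alpha>. order_of \<alpha> \<le> p}. c (s, \<alpha>) * D x \<alpha> s) = 0"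
      using z by (simp add: u_def I_def case_prod_beta)
    then show "c i = 0" using ident i by blast
  qed
  then obtain X K0 where X: "finite X" and K0: "K0 > 0"
    and lower: "\<And>c. (\<Sum>i\<in>I. \<bar>c i\<bar>) \<le> K0 * (\<Sum>x\<in>X. \<bar>\<Sum>i\<in>I. c i * u i x\<bar>)" by blast
  define cX where "cX = real (card X) + 1"
  have cX: "cX > 0" by (simp add: cX_def)
  define K where "K = 2 * K0 * cX * fact p"
  have K: "K > 0" using K0 cX by (simp add: K_def)
  \<comment> \<open>With this oscillation the error term contributes at most half of the sum \<open>T\<close> of all
    normalized coefficients, which is what is to be bounded.\<close>
  define \<eta> where "\<eta> = 1 / K"
  have \<eta>: "\<eta> > 0" using K by (simp add: \<eta>_def)
  obtain \<epsilon> where \<epsilon>: "\<epsilon> > 0" and ball: "\<And>s. s \<in> S \<Longrightarrow> ball s \<epsilon> \<subseteq> U"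
    and disj: "\<And>s s'. s \<in> S \<Longrightarrow> s' \<in> S \<Longrightarrow> s \<noteq> s' \<Longrightarrow> ball s \<epsilon> \<inter> ball s' \<epsilon> = {}"
    and close: "\<And>s y x \<beta>. s \<in> S \<Longrightarrow> y \<in> ball s \<epsilon> \<Longrightarrow> x \<in> X \<Longrightarrow> order_of \<beta> \<le> p \<Longrightarrow> \<bar>D x \<beta> y - D x \<beta> s\<bar> \<le> \<eta>"
  proof -
    have "\<exists>\<epsilon>>0. \<forall>s\<in>S. ball s \<epsilon> \<subseteq> U \<and> (\<forall>s'\<in>S. s \<noteq> s' \<longrightarrow> ball s \<epsilon> \<inter> ball s' \<epsilon> = {}) \<and>
      (\<forall>y\<in>ball s \<epsilon>. \<forall>x\<in>X. \<forall>\<beta>\<in>{\<beta>. order_of \<beta> \<le> p}. \<bar>D x \<beta> y - D x \<beta> s\<bar> \<le> \<eta>)"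
    proof (rule uniform_modulus_near_finite_set)
      show "continuous_on U (D x \<beta>)" if "\<beta> \<in> {\<beta>. order_of \<beta> \<le> p}" for x \<beta>
        using that by (intro partial_derivs_continuous[OF D U(1)]) simp
    qed (use assms(2,3) U X \<eta> finite_order_le in auto)
    then obtain \<epsilon> where \<epsilon>: "\<epsilon> > 0" and near: "\<forall>s\<in>S. ball s \<epsilon> \<subseteq> U \<and> (\<forall>s'\<in>S. s \<noteq> s' \<longrightarrow> ball s \<epsilon> \<inter> ball s' \<epsilon> = {}) \<and>
      (\<forall>y\<in>ball s \<epsilon>. \<forall>x\<in>X. \<forall>\<beta>\<in>{\<beta>. order_of \<beta> \<le> p}. \<bar>D x \<beta> y - D x \<beta> s\<bar> \<le> \<eta>)"
      by (elim exE conjE) (rule that)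
    show thesis
    proof (rule that[OF \<epsilon>])
      fix s assume s: "s \<in> S"
      note near_s = bspec[OF near s]
      show "ball s \<epsilon> \<subseteq> U" using near_s by (rule conjunct1)
      show "ball s \<epsilon> \<inter> ball s' \<epsilon> = {}" if "s' \<in> S" "s \<noteq> s'" for s'
        using near_s[THEN conjunct2, THEN conjunct1] that by (elim ballE impE) auto
      show "\<bar>D x \<beta> y - D x \<beta> s\<bar> \<le> \<eta>" if "y \<in> ball s \<epsilon>" "x \<in> X" "order_of \<beta> \<le> p" for y x \<beta>
        using near_s[THEN conjunct2, THEN conjunct2, rule_format, OF that(1,2)] that(3) by simp
    qed
  qed
  have "\<bar>\<Sum>i<N s. w s i * (\<Prod>l<m. (\<gamma> s i - \<gamma> s l) \<bullet> z)\<bar> \<le> K * B"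
    if N: "\<And>s. s \<in> S \<Longrightarrow> N s \<le> p" and \<gamma>: "\<And>s i. s \<in> S \<Longrightarrow> i < N s \<Longrightarrow> \<gamma> s i \<in> ball s \<epsilon> \<inter> \<Gamma>"
      and B: "\<And>x. \<bar>\<Sum>s\<in>S. \<Sum>i<N s. w s i * mcdf f x (\<gamma> s i)\<bar> \<le> B"
      and s: "s \<in> S" and m: "m < N s" and z: "norm z \<le> 1" for N \<gamma> w B s m z
  proof -
    \<comment> \<open>Padding with the centre: \<open>newton_expansion\<close> wants all \<open>\<gamma>' s i\<close> to lie in the ball.\<close>
    define \<gamma>' where "\<gamma>' s i = (if i < N s then \<gamma> s i else s)" for s i
    define nc where "nc s = newton_coeff (N s) (\<gamma>' s) (w s)" for s
    define c where "c = (\<lambda>(s, \<beta>). if order_of \<beta> < N s then nc s (order_of \<beta>) \<beta> / fact (order_of \<beta>) else 0)"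
    define T where "T = (\<Sum>i\<in>I. \<bar>c i\<bar>)"
    define A where "A = (\<Sum>s\<in>S. \<Sum>m<N s. \<Sum>\<beta> | order_of \<beta> = m. \<bar>nc s m \<beta>\<bar>)"
    have T_eq: "T = (\<Sum>s\<in>S. \<Sum>m<N s. \<Sum>\<beta> | order_of \<beta> = m. \<bar>nc s m \<beta>\<bar> / fact m)"
    proof -
      have "T = (\<Sum>s\<in>S. \<Sum>\<beta> | order_of \<beta> \<le> p. \<bar>c (s, \<beta>)\<bar>)"
        unfolding T_def I_def by (simp add: sum.cartesian_product)
      also have "\<dots> = (\<Sum>s\<in>S. \<Sum>m<N s. \<Sum>\<beta> | order_of \<beta> = m. \<bar>nc s m \<beta>\<bar> / fact m)"
      proof (rule sum.cong[OF refl])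
        fix s assume "s \<in> S"
        then have "N s \<le> Suc p" using N[of s] by simp
        from sum_by_order[OF this, of "\<lambda>m \<beta>. \<bar>nc s m \<beta>\<bar> / fact m"]
        show "(\<Sum>\<beta> | order_of \<beta> \<le> p. \<bar>c (s, \<beta>)\<bar>) = (\<Sum>m<N s. \<Sum>\<beta> | order_of \<beta> = m. \<bar>nc s m \<beta>\<bar> / fact m)"
          by (simp add: c_def if_distrib[of abs] cong: if_cong)
      qed
      finally show ?thesis .
    qed
    have AT: "A \<le> fact p * T"
    proof -
      have "\<bar>nc s m \<beta>\<bar> \<le> fact p * (\<bar>nc s m \<beta>\<bar> / fact m)" if "s \<in> S" "m < N s" for s m \<beta>
      proof -
        have "fact m \<le> (fact p :: real)" using N[OF that(1)] that(2) by (intro fact_mono) auto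
        from mult_right_mono[OF this, of "\<bar>nc s m \<beta>\<bar>"] show ?thesis by (simp add: field_simps)
      qed
      then show ?thesis unfolding A_def T_eq sum_distrib_left by (intro sum_mono) auto
    qed
    have T0: "T \<ge> 0" unfolding T_def by (intro sum_nonneg) auto
    have pt: "\<bar>\<Sum>i\<in>I. c i * u i x\<bar> \<le> B + \<eta> * A" if x: "x \<in> X" for x
    proof -
      define \<Lambda> where "\<Lambda> s = (\<Sum>i<N s. w s i * D x (\<lambda>_. 0) (\<gamma>' s i))" for s
      define L where "L s = (\<Sum>m<N s. \<Sum>\<beta> | order_of \<beta> = m. nc s m \<beta> / fact m * D x \<beta> s)" for s
      have "(\<Sum>i\<in>I. c i * u i x) = (\<Sum>s\<in>S. \<Sum>\<beta> | order_of \<beta> \<le> p. c (s, \<beta>) * D x \<beta> s)"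
        unfolding I_def u_def by (simp add: sum.cartesian_product case_prod_beta)
      also have "\<dots> = (\<Sum>s\<in>S. L s)"
      proof (rule sum.cong[OF refl])
        fix s assume "s \<in> S"
        then have "N s \<le> Suc p" using N[of s] by simp
        from sum_by_order[OF this, of "\<lambda>m \<beta>. nc s m \<beta> / fact m * D x \<beta> s"]
        show "(\<Sum>\<beta> | order_of \<beta> \<le> p. c (s, \<beta>) * D x \<beta> s) = L s"
          by (simp add: c_def L_def if_distrib[of "\<lambda>z. z * _"] cong: if_cong)
      qed
      finally have eq: "(\<Sum>i\<in>I. c i * u i x) = (\<Sum>s\<in>S. \<Lambda> s) - (\<Sum>s\<in>S. \<Lambda> s - L s)"
        by (simp add: sum_subtractf)
      have "\<bar>\<Sum>s\<in>S. \<Lambda> s - L s\<bar> \<le> (\<Sum>s\<in>S. \<bar>\<Lambda> s - L s\<bar>)" by (rule sum_abs)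
      also have "\<dots> \<le> (\<Sum>s\<in>S. \<eta> * (\<Sum>m<N s. \<Sum>\<beta> | order_of \<beta> = m. \<bar>nc s m \<beta>\<bar>))"
      proof (rule sum_mono)
        fix s assume s: "s \<in> S"
        show "\<bar>\<Lambda> s - L s\<bar> \<le> \<eta> * (\<Sum>m<N s. \<Sum>\<beta> | order_of \<beta> = m. \<bar>nc s m \<beta>\<bar>)"
          unfolding \<Lambda>_def L_def nc_def
        proof (rule newton_expansion[OF D U(1) convex_ball ball[OF s] N[OF s]])
          show "\<gamma>' s i \<in> ball s \<epsilon>" for i using \<gamma>[OF s, of i] \<epsilon> by (simp add: \<gamma>'_def)
          show "\<bar>D x \<beta> y - D x \<beta> s\<bar> \<le> \<eta>" if "order_of \<beta> < p" "y \<in> ball s \<epsilon>" for \<beta> y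
            using close[OF s that(2) x, of \<beta>] that(1) by simp
        qed
      qed
      also have "\<dots> = \<eta> * A" by (simp add: A_def sum_distrib_left)
      finally have "\<bar>\<Sum>s\<in>S. \<Lambda> s - L s\<bar> \<le> \<eta> * A" .
      moreover have "(\<Sum>s\<in>S. \<Lambda> s) = (\<Sum>s\<in>S. \<Sum>i<N s. w s i * mcdf f x (\<gamma> s i))"
        unfolding \<Lambda>_def \<gamma>'_def using \<gamma> by (intro sum.cong) (auto simp: D0)
      ultimately show ?thesis using B[of x] unfolding eq by linarith
    qed
    have B0: "B \<ge> 0" using B[of 0] by linarith
    have A0: "A \<ge> 0" unfolding A_def by (intro sum_nonneg) auto
    have "T \<le> K0 * (\<Sum>x\<in>X. \<bar>\<Sum>i\<in>I. c i * u i x\<bar>)" unfolding T_def by (rule lower)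
    also have "\<dots> \<le> K0 * (\<Sum>x\<in>X. B + \<eta> * A)"
      using K0 pt by (intro mult_left_mono sum_mono) auto
    also have "\<dots> = K0 * real (card X) * (B + \<eta> * A)" by simp
    also have "\<dots> \<le> K0 * cX * (B + \<eta> * (fact p * T))"
      using K0 AT \<eta> B0 A0 by (intro mult_mono add_mono mult_left_mono) (auto simp: cX_def)
    also have "\<dots> = K0 * cX * B + T / 2"
      using K0 cX by (simp add: \<eta>_def K_def field_simps)
    finally have "T \<le> 2 * (K0 * cX * B)" by simp
    then have "fact p * T \<le> K * B" by (simp add: K_def field_simps)
    have "\<bar>\<Sum>i<N s. w s i * (\<Prod>l<m. (\<gamma> s i - \<gamma> s l) \<bullet> z)\<bar> =
        \<bar>\<Sum>i<N s. w s i * (\<Prod>l<m. (\<gamma>' s i - \<gamma>' s l) \<bullet> z)\<bar>"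
      using m by (intro arg_cong[of _ _ abs] sum.cong prod.cong arg_cong2[of _ _ _ _ "(*)"])
        (auto simp: \<gamma>'_def)
    also have "\<dots> \<le> (\<Sum>\<beta> | order_of \<beta> = m. \<bar>nc s m \<beta>\<bar>)"
      unfolding nc_def by (rule newton_coeff_bound[OF z])
    also have "\<dots> \<le> (\<Sum>m<N s. \<Sum>\<beta> | order_of \<beta> = m. \<bar>nc s m \<beta>\<bar>)"
      using m by (intro member_le_sum sum_nonneg) auto
    also have "\<dots> \<le> A"
      unfolding A_def by (rule member_le_sum[OF s]) (use assms(2) in \<open>auto intro!: sum_nonneg\<close>)
    finally show ?thesis using AT \<open>fact p * T \<le> K * B\<close> by linarith
  qed
  then show ?thesis
    by (intro exI[of _ \<epsilon>] conjI exI[of _ K] \<epsilon> K ballI allI impI disj) simp_all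
qed

section \<open>Step functions on the line and transversal directions\<close>

text \<open>\<open>divided_difference y s i k\<close> is the divided difference of the values \<open>s\<close> at the nodes
  \<open>y i, \<dots>, y (i + k)\<close>.\<close>
fun divided_difference :: "(nat \<Rightarrow> real) \<Rightarrow> (nat \<Rightarrow> real) \<Rightarrow> nat \<Rightarrow> nat \<Rightarrow> real" where
  "divided_difference y s i 0 = s i"
| "divided_difference y s i (Suc k) =
     (divided_difference y s (Suc i) k - divided_difference y s i k) / (y (i + Suc k) - y i)"

lemma newton_interpolation:
  assumes "\<And>i j. i < j \<Longrightarrow> j < N \<Longrightarrow> y i < y j" and "i + n < N"
  shows "s (i + n) = (\<Sum>k\<le>n. divided_difference y s i k * (\<Prod>l<k. y (i + n) - y (i + l)))"
  using assms(2)
proof (induction n arbitrary: i)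
  case 0
  then show ?case by simp
next
  case (Suc n)
  let ?d = "divided_difference y s"
  define z where "z = y (Suc i + n)"
  define P where "P k = (\<Prod>l<k. z - y (Suc i + l))" for k
  have "(\<Prod>l<Suc k. z - y (i + l)) = (z - y i) * P k" for k
    unfolding P_def by (subst prod.lessThan_Suc_shift) simp
  then have "(\<Sum>k\<le>Suc n. ?d i k * (\<Prod>l<k. z - y (i + l))) = ?d i 0 + (\<Sum>k\<le>n. ?d i (Suc k) * ((z - y i) * P k))"
    by (subst sum.atMost_Suc_shift) simp
  also have "\<dots> = ?d i 0 + (\<Sum>k\<le>n. ?d i (Suc k) * P (Suc k)) + (\<Sum>k\<le>n. (?d (Suc i) k - ?d i k) * P k)"
  proof -
    have "?d i (Suc k) * ((z - y i) * P k) = ?d i (Suc k) * P (Suc k) + (?d (Suc i) k - ?d i k) * P k"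
      if "k \<le> n" for k
    proof -
      have "y (i + Suc k) - y i \<noteq> 0" using assms(1)[of i "i + Suc k"] Suc.prems that by simp
      then have "?d (Suc i) k - ?d i k = ?d i (Suc k) * (y (i + Suc k) - y i)" by simp
      moreover have "P (Suc k) = P k * (z - y (i + Suc k))" by (simp add: P_def)
      ultimately show ?thesis by (simp only: ) (simp add: algebra_simps del: divided_difference.simps)
    qed
    then show ?thesis by (simp add: sum.distrib del: divided_difference.simps)
  qed
  also have "?d i 0 + (\<Sum>k\<le>n. ?d i (Suc k) * P (Suc k)) = (\<Sum>k\<le>Suc n. ?d i k * P k)"
    by (subst sum.atMost_Suc_shift) (simp add: P_def)
  also have "\<dots> = (\<Sum>k\<le>n. ?d i k * P k)" by (simp add: P_def z_def)
  also have "\<dots> + (\<Sum>k\<le>n. (?d (Suc i) k - ?d i k) * P k) = (\<Sum>k\<le>n. ?d (Suc i) k * P k)"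
    by (simp add: sum.distrib[symmetric] algebra_simps)
  also have "\<dots> = s (Suc i + n)"
    using Suc.IH[of "Suc i"] Suc.prems by (simp add: P_def z_def)
  finally show ?case by (simp add: z_def)
qed

text \<open>A divided difference of the step function vanishes unless its nodes lie on both sides of the
  gap; then the first and the last node are at least \<open>g\<close> apart, and each order costs a factor
  \<open>2 / g\<close>.\<close>
lemma divided_difference_step:
  assumes mono: "\<And>i j. i < j \<Longrightarrow> j < N \<Longrightarrow> y i < y j" and g: "g > 0"
    and gap: "\<And>i. i < N \<Longrightarrow> y i \<le> \<theta> \<or> \<theta> + g \<le> y i"
    and s: "\<And>i. s i = (if y i \<le> \<theta> then 1 else 0)"
    and "i + k < N"
  shows "\<bar>divided_difference y s i k\<bar> \<le> (2 / g) ^ k \<and>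
    (0 < k \<longrightarrow> s i = s (i + k) \<longrightarrow> divided_difference y s i k = 0)"
  using assms(5)
proof (induction k arbitrary: i)
  case 0
  then show ?case by (simp add: s)
next
  case (Suc k)
  let ?d = "divided_difference y s"
  have IH1: "\<bar>?d i k\<bar> \<le> (2 / g) ^ k" "\<bar>?d (Suc i) k\<bar> \<le> (2 / g) ^ k"
    using Suc.IH[of i] Suc.IH[of "Suc i"] Suc.prems by auto
  show ?case
  proof (cases "s i = s (i + Suc k)")
    case True
    have mono_le: "y i \<le> y j" if "i \<le> j" "j < N" for i j
      using mono[of i j] that by (cases "i = j") auto
    have le: "y i \<le> y (Suc i)" "y (Suc i) \<le> y (i + Suc k)" "y i \<le> y (i + k)" "y (i + k) \<le> y (i + Suc k)"
      using Suc.prems by (intro mono_le; simp)+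
    then have sides: "s (Suc i) = s (Suc i + k)" "s i = s (i + k)" "s (Suc i) = s i"
      using True by (auto simp: s split: if_splits)
    have "?d (Suc i) k - ?d i k = 0"
    proof (cases "k = 0")
      case False
      then have "?d i k = 0" "?d (Suc i) k = 0"
        using Suc.IH[of i] Suc.IH[of "Suc i"] Suc.prems sides(1,2) by simp_all
      then show ?thesis by simp
    next
      case True
      show ?thesis using sides(3) unfolding True divided_difference.simps by simp
    qed
    then show ?thesis using g by simp
  next
    case False
    have "y i < y (i + Suc k)" using mono[of i "i + Suc k"] Suc.prems by simp
    then have "y i \<le> \<theta>" "\<not> y (i + Suc k) \<le> \<theta>" using False by (auto simp: s split: if_splits)
    then have d: "g \<le> y (i + Suc k) - y i" using gap[of "i + Suc k"] Suc.prems by simp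
    have "\<bar>?d i (Suc k)\<bar> = \<bar>?d (Suc i) k - ?d i k\<bar> / (y (i + Suc k) - y i)"
      using d g by (simp add: abs_divide)
    also have "\<dots> \<le> (2 * (2 / g) ^ k) / g"
      using IH1 d g by (intro frac_le) auto
    finally show ?thesis using False by (simp del: divided_difference.simps)
  qed
qed

text \<open>The mass below the gap is the integral of a step function, which agrees on the nodes with its
  Newton interpolation polynomial.\<close>
lemma mass_below_gap_le_newton_moments:
  fixes y w :: "nat \<Rightarrow> real"
  assumes mono: "\<And>i j. i < j \<Longrightarrow> j < N \<Longrightarrow> y i < y j" and g: "g > 0"
    and gap: "\<And>i. i < N \<Longrightarrow> y i \<le> \<theta> \<or> \<theta> + g \<le> y i"
    and B: "\<And>m. m < N \<Longrightarrow> \<bar>\<Sum>i<N. w i * (\<Prod>l<m. y i - y l)\<bar> \<le> B"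
  shows "\<bar>\<Sum>i | i < N \<and> y i \<le> \<theta>. w i\<bar> \<le> B * (\<Sum>m<N. (2 / g) ^ m)"
proof -
  define s where "s i = (if y i \<le> \<theta> then 1 else 0 :: real)" for i
  let ?c = "divided_difference y s 0"
  have s_eq: "s i = (\<Sum>m<N. ?c m * (\<Prod>l<m. y i - y l))" if "i < N" for i
  proof -
    have "s i = (\<Sum>m\<le>i. ?c m * (\<Prod>l<m. y i - y l))"
      using newton_interpolation[OF mono, where N = N and i = 0 and n = i and s = s] that by simp
    also have "\<dots> = (\<Sum>m<N. ?c m * (\<Prod>l<m. y i - y l))"
    proof (rule sum.mono_neutral_left)
      show "\<forall>m\<in>{..<N} - {..i}. ?c m * (\<Prod>l<m. y i - y l) = 0"
        by (auto simp: prod_zero_iff)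
    qed (use that in auto)
    finally show ?thesis .
  qed
  have "(\<Sum>i | i < N \<and> y i \<le> \<theta>. w i) = (\<Sum>i<N. w i * s i)"
    by (rule sum.mono_neutral_cong_left) (auto simp: s_def)
  also have "\<dots> = (\<Sum>m<N. ?c m * (\<Sum>i<N. w i * (\<Prod>l<m. y i - y l)))"
    by (subst sum_distrib_left, subst sum.swap) (simp add: s_eq sum_distrib_left mult_ac)
  also have "\<bar>\<dots>\<bar> \<le> (\<Sum>m<N. \<bar>?c m * (\<Sum>i<N. w i * (\<Prod>l<m. y i - y l))\<bar>)"
    by (rule sum_abs)
  also have "\<dots> \<le> (\<Sum>m<N. (2 / g) ^ m * B)"
    unfolding abs_mult
    using divided_difference_step[where y = y and N = N and s = s and i = 0, OF mono g gap] B g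
    by (intro sum_mono mult_mono) (auto simp: s_def)
  finally show ?thesis by (simp add: sum_distrib_left mult.commute)
qed

text \<open>The vectors of \<open>U\<close> are treated one after the other: if \<open>v\<close> is nearly orthogonal to the new vector
  \<open>u\<close>, a small multiple of \<open>u\<close> is added, which spoils at most half of what was achieved before. The
  constant depends only on the number of vectors.\<close>
lemma transversal_direction:
  fixes U :: "'a::real_inner set"
  assumes "finite U"
  shows "\<exists>v. norm v \<le> 1 - (1 / 4) ^ card U \<and> (\<forall>u\<in>U. (1 / 4) ^ card U * norm u \<le> \<bar>u \<bullet> v\<bar>)"
  using assms
proof (induction U rule: finite_induct)
  case empty
  then show ?case by (intro exI[of _ 0]) simp
next
  case (insert u U)
  define \<kappa> :: real where "\<kappa> = (1 / 4) ^ card U"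
  have \<kappa>: "\<kappa> > 0" by (simp add: \<kappa>_def)
  have card: "(1 / 4) ^ card (insert u U) = \<kappa> / 4" using insert.hyps by (simp add: \<kappa>_def)
  obtain v where v: "norm v \<le> 1 - \<kappa>" "\<And>x. x \<in> U \<Longrightarrow> \<kappa> * norm x \<le> \<bar>x \<bullet> v\<bar>"
    using insert.IH unfolding \<kappa>_def by blast
  show ?case
  proof (cases "\<kappa> / 4 * norm u \<le> \<bar>u \<bullet> v\<bar>")
    case True
    have "\<kappa> / 4 * norm x \<le> \<bar>x \<bullet> v\<bar>" if "x \<in> insert u U" for x
    proof (cases "x = u")
      case False
      have "\<kappa> / 4 * norm x \<le> \<kappa> * norm x" using \<kappa> by (intro mult_right_mono) auto
      then show ?thesis using v(2)[of x] that False by simp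
    qed (use True in simp)
    then show ?thesis unfolding card using v(1) \<kappa> by (intro exI[of _ v]) auto
  next
    case False
    define e where "e = u /\<^sub>R norm u"
    define v' where "v' = v + (\<kappa> / 2) *\<^sub>R e"
    have "u \<noteq> 0" using False by auto
    then have e: "norm e = 1" "u \<bullet> e = norm u"
      by (simp_all add: e_def dot_square_norm power2_eq_square)
    have "norm v' \<le> norm v + \<kappa> / 2"
      unfolding v'_def using norm_triangle_ineq[of v "(\<kappa> / 2) *\<^sub>R e"] e \<kappa> by simp
    then have 1: "norm v' \<le> 1 - \<kappa> / 4" using v(1) \<kappa> by linarith
    have "\<kappa> / 4 * norm x \<le> \<bar>x \<bullet> v'\<bar>" if "x \<in> insert u U" for x
    proof (cases "x = u")
      case True
      have "x \<bullet> v' = u \<bullet> v + \<kappa> / 2 * norm u" by (simp add: True v'_def inner_add_right e)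
      then show ?thesis using False True by simp
    next
      case False
      have "\<bar>x \<bullet> e\<bar> \<le> norm x" using Cauchy_Schwarz_ineq2[of x e] e by simp
      then have "\<bar>\<kappa> / 2 * (x \<bullet> e)\<bar> \<le> \<kappa> / 2 * norm x"
        using \<kappa> by (simp add: abs_mult)
      moreover have "x \<bullet> v' = x \<bullet> v + \<kappa> / 2 * (x \<bullet> e)" by (simp add: v'_def inner_add_right)
      moreover have "0 \<le> \<kappa> * norm x" using \<kappa> by simp
      moreover have "\<kappa> * norm x \<le> \<bar>x \<bullet> v\<bar>" using v(2)[of x] that False by simp
      ultimately show ?thesis by linarith
    qed
    then show ?thesis unfolding card using 1 by blast
  qed
qed

section \<open>Partial transport along a path\<close>

definition partial_coupling ::
    "nat \<Rightarrow> (nat \<Rightarrow> real) \<Rightarrow> (nat \<Rightarrow> real) \<Rightarrow> (nat \<Rightarrow> nat \<Rightarrow> real) \<Rightarrow> bool" where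
  "partial_coupling n a b q \<longleftrightarrow> (\<forall>i j. 0 \<le> q i j) \<and> (\<forall>i<n. (\<Sum>j<n. q i j) \<le> a i) \<and>
     (\<forall>j<n. (\<Sum>i<n. q i j) \<le> b j) \<and>
     (\<Sum>i<n. \<Sum>j<n. q i j) = min (\<Sum>i<n. a i) (\<Sum>j<n. b j)"

lemma partial_coupling_swap: "partial_coupling n a b q \<Longrightarrow> partial_coupling n b a (\<lambda>i j. q j i)"
  unfolding partial_coupling_def by (subst sum.swap) (auto simp: min.commute)

text \<open>Mass that is not matched at a point is carried to the next point of the path; hence the net mass
  that crosses from the \<open>r\<close>-th point to its successor is the difference of the partial sums. The
  surplus that arrives at the end stays unmatched. The induction removes the first point and adds its
  surplus \<open>w\<close> to the second one.\<close>
lemma partial_coupling_along_path: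
  fixes p :: "nat \<Rightarrow> 'a::metric_space"
  assumes "\<And>i. 0 \<le> a i" "\<And>i. 0 \<le> b i"
  shows "\<exists>q. partial_coupling (Suc n) a b q \<and>
    (\<Sum>i<Suc n. \<Sum>j<Suc n. q i j * dist (p i) (p j)) \<le> (\<Sum>r<n. \<bar>\<Sum>i\<le>r. a i - b i\<bar> * dist (p r) (p (Suc r)))"
  using assms
proof (induction n arbitrary: p a b)
  case 0
  then show ?case
    by (intro exI[of _ "\<lambda>i j. min (a 0) (b 0)"]) (auto simp: partial_coupling_def)
next
  case (Suc n)
  have main: "\<exists>q. partial_coupling (Suc (Suc n)) a b q \<and>
    (\<Sum>i<Suc (Suc n). \<Sum>j<Suc (Suc n). q i j * dist (p i) (p j)) \<le>
    (\<Sum>r<Suc n. \<bar>\<Sum>i\<le>r. a i - b i\<bar> * dist (p r) (p (Suc r)))"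
    if a: "\<And>i. 0 \<le> a i" and b: "\<And>i. 0 \<le> b i" and ge: "b 0 \<le> a 0" for a b :: "nat \<Rightarrow> real"
  proof -
    define w where "w = a 0 - b 0"
    define a' where "a' i = a (Suc i) + (if i = 0 then w else 0)" for i
    define b' where "b' i = b (Suc i)" for i
    have w: "w \<ge> 0" using ge by (simp add: w_def)
    have a': "a' i \<ge> 0" "b' i \<ge> 0" for i using a b w by (auto simp: a'_def b'_def)
    obtain q' where q': "partial_coupling (Suc n) a' b' q'"
      and cost: "(\<Sum>i<Suc n. \<Sum>j<Suc n. q' i j * dist (p (Suc i)) (p (Suc j))) \<le>
        (\<Sum>r<n. \<bar>\<Sum>i\<le>r. a' i - b' i\<bar> * dist (p (Suc r)) (p (Suc (Suc r))))"
      using Suc.IH[where a = a' and b = b' and p = "\<lambda>i. p (Suc i)"] a' by blast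
    have q'0: "0 \<le> q' i j" for i j using q' by (simp add: partial_coupling_def)
    \<comment> \<open>The share of the mass at the second point that comes from the first one.\<close>
    define \<mu> where "\<mu> = (if a' 0 = 0 then 0 else w / a' 0)"
    have \<mu>: "0 \<le> \<mu>" "\<mu> \<le> 1" "\<mu> * a' 0 = w" "(1 - \<mu>) * a' 0 = a 1"
      using w a(1)[of 1] by (auto simp: \<mu>_def a'_def field_simps add_nonneg_eq_0_iff)
    define q where "q i j = (case i of 0 \<Rightarrow> (case j of 0 \<Rightarrow> b 0 | Suc j \<Rightarrow> \<mu> * q' 0 j)
      | Suc i \<Rightarrow> (case j of 0 \<Rightarrow> 0 | Suc j \<Rightarrow> (if i = 0 then 1 - \<mu> else 1) * q' i j))" for i j
    have q_simps: "q 0 0 = b 0" "q 0 (Suc j) = \<mu> * q' 0 j" "q (Suc i) 0 = 0"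
      "q (Suc i) (Suc j) = (if i = 0 then 1 - \<mu> else 1) * q' i j" for i j
      by (simp_all add: q_def)
    have split: "(\<Sum>i<Suc (Suc n). \<Sum>j<Suc (Suc n). q i j * h i j) =
      b 0 * h 0 0 + (\<Sum>i<Suc n. \<Sum>j<Suc n. q' i j * h (Suc i) (Suc j)) +
      \<mu> * (\<Sum>j<Suc n. q' 0 j * (h 0 (Suc j) - h 1 (Suc j)))" for h :: "nat \<Rightarrow> nat \<Rightarrow> real"
    proof -
      have "(\<Sum>i<Suc (Suc n). \<Sum>j<Suc (Suc n). q i j * h i j) =
        b 0 * h 0 0 + (\<Sum>j<Suc n. \<mu> * q' 0 j * h 0 (Suc j)) +
        (\<Sum>i<Suc n. \<Sum>j<Suc n. (if i = 0 then 1 - \<mu> else 1) * q' i j * h (Suc i) (Suc j))"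
        by (simp only: sum.lessThan_Suc_shift[of _ "Suc n"] q_simps) (simp add: o_def)
      also have "(\<Sum>i<Suc n. \<Sum>j<Suc n. (if i = 0 then 1 - \<mu> else 1) * q' i j * h (Suc i) (Suc j)) =
        (\<Sum>i<Suc n. \<Sum>j<Suc n. q' i j * h (Suc i) (Suc j)) - \<mu> * (\<Sum>j<Suc n. q' 0 j * h 1 (Suc j))"
        unfolding sum.lessThan_Suc_shift[of _ n]
        by (simp add: left_diff_distrib sum_subtractf sum_distrib_left distrib_left mult.assoc right_diff_distrib)
      finally show ?thesis
        by (simp add: right_diff_distrib sum_subtractf sum_distrib_left mult.assoc del: sum.lessThan_Suc)
    qed
    have row0: "(\<Sum>j<Suc n. q' 0 j) \<le> a' 0" using q' by (simp add: partial_coupling_def)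
    have "partial_coupling (Suc (Suc n)) a b q"
      unfolding partial_coupling_def
    proof (intro conjI allI impI)
      show "0 \<le> q i j" for i j
        using \<mu> q'0 b by (auto simp: q_def split: nat.splits)
      show "(\<Sum>j<Suc (Suc n). q i j) \<le> a i" if "i < Suc (Suc n)" for i
      proof (cases i)
        case 0
        have "(\<Sum>j<Suc (Suc n). q i j) = b 0 + \<mu> * (\<Sum>j<Suc n. q' 0 j)"
          by (simp only: 0 sum.lessThan_Suc_shift[of _ "Suc n"] q_simps) (simp add: sum_distrib_left distrib_left)
        also have "\<dots> \<le> b 0 + \<mu> * a' 0" using row0 \<mu> by (intro add_left_mono mult_left_mono) auto
        finally show ?thesis using \<mu> by (simp add: 0 w_def)
      next
        case (Suc i')
        have "(\<Sum>j<Suc (Suc n). q i j) = (if i' = 0 then 1 - \<mu> else 1) * (\<Sum>j<Suc n. q' i' j)"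
          by (simp only: Suc sum.lessThan_Suc_shift[of _ "Suc n"] q_simps) (simp add: sum_distrib_left distrib_left)
        also have "\<dots> \<le> (if i' = 0 then 1 - \<mu> else 1) * a' i'"
          using q' that Suc \<mu> by (intro mult_left_mono) (auto simp: partial_coupling_def)
        also have "\<dots> = a i" using \<mu> by (simp add: Suc a'_def)
        finally show ?thesis .
      qed
      show "(\<Sum>i<Suc (Suc n). q i j) \<le> b j" if "j < Suc (Suc n)" for j
      proof (cases j)
        case 0
        then show ?thesis by (simp only: 0 sum.lessThan_Suc_shift[of _ "Suc n"] q_simps) simp
      next
        case (Suc j')
        have "(\<Sum>i<Suc (Suc n). q i j) = (\<Sum>i<Suc n. q' i j')"
          by (simp only: Suc sum.lessThan_Suc_shift[of _ "Suc n"] sum.lessThan_Suc_shift[of _ n] q_simps)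
            (simp add: algebra_simps)
        then show ?thesis using q' that Suc by (simp add: partial_coupling_def b'_def)
      qed
      have "(\<Sum>i<Suc n. \<Sum>j<Suc n. q' i j) = min (\<Sum>i<Suc n. a' i) (\<Sum>j<Suc n. b' j)"
        using q' by (simp add: partial_coupling_def)
      moreover have "(\<Sum>i<Suc n. a' i) = (\<Sum>i<Suc n. a (Suc i)) + w"
        unfolding a'_def sum.distrib by simp
      ultimately show "(\<Sum>i<Suc (Suc n). \<Sum>j<Suc (Suc n). q i j) =
          min (\<Sum>i<Suc (Suc n). a i) (\<Sum>j<Suc (Suc n). b j)"
        using split[of "\<lambda>_ _. 1"]
        unfolding sum.lessThan_Suc_shift[of a "Suc n"] sum.lessThan_Suc_shift[of b "Suc n"]
        by (simp add: b'_def w_def min_def del: sum.lessThan_Suc)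
    qed
    moreover have "(\<Sum>i<Suc (Suc n). \<Sum>j<Suc (Suc n). q i j * dist (p i) (p j)) \<le>
      (\<Sum>r<Suc n. \<bar>\<Sum>i\<le>r. a i - b i\<bar> * dist (p r) (p (Suc r)))"
    proof -
      have "\<mu> * (\<Sum>j<Suc n. q' 0 j * (dist (p 0) (p (Suc j)) - dist (p 1) (p (Suc j)))) \<le>
        \<mu> * (\<Sum>j<Suc n. q' 0 j * dist (p 0) (p 1))"
      proof (intro mult_left_mono sum_mono)
        show "dist (p 0) (p (Suc j)) - dist (p 1) (p (Suc j)) \<le> dist (p 0) (p 1)" for j
          using dist_triangle[of "p 0" "p (Suc j)" "p 1"] by simp
      qed (use q'0 \<mu> in auto)
      also have "\<dots> \<le> \<mu> * (a' 0 * dist (p 0) (p 1))"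
        using row0 \<mu> by (intro mult_left_mono) (auto simp: sum_distrib_right[symmetric] mult_right_mono simp del: sum.lessThan_Suc)
      also have "\<dots> = w * dist (p 0) (p 1)" using \<mu>(3) by (simp add: mult.assoc[symmetric])
      finally have 1: "\<mu> * (\<Sum>j<Suc n. q' 0 j * (dist (p 0) (p (Suc j)) - dist (p 1) (p (Suc j)))) \<le>
        w * dist (p 0) (p 1)" .
      have prefix: "(\<Sum>i\<le>r. a' i - b' i) = (\<Sum>i\<le>Suc r. a i - b i)" for r
      proof -
        have "(\<Sum>i\<le>r. a' i - b' i) = (\<Sum>i\<le>r. (a (Suc i) - b (Suc i)) + (if i = 0 then w else 0))"
          by (intro sum.cong) (auto simp: a'_def b'_def)
        also have "\<dots> = w + (\<Sum>i\<le>r. a (Suc i) - b (Suc i))"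
          unfolding sum.distrib by simp
        also have "\<dots> = (\<Sum>i\<le>Suc r. a i - b i)"
          by (subst sum.atMost_Suc_shift) (simp add: w_def)
        finally show ?thesis .
      qed
      have "(\<Sum>r<Suc n. \<bar>\<Sum>i\<le>r. a i - b i\<bar> * dist (p r) (p (Suc r))) =
        w * dist (p 0) (p 1) + (\<Sum>r<n. \<bar>\<Sum>i\<le>r. a' i - b' i\<bar> * dist (p (Suc r)) (p (Suc (Suc r))))"
        using w unfolding prefix by (subst sum.lessThan_Suc_shift) (simp add: w_def)
      then show ?thesis
        using cost 1 split[of "\<lambda>i j. dist (p i) (p j)"] by simp
    qed
    ultimately show ?thesis by blast
  qed
  show ?case
  proof (cases "b 0 \<le> a 0")
    case True
    then show ?thesis by (intro main Suc.prems)
  next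
    case False
    then obtain q where q: "partial_coupling (Suc (Suc n)) b a q"
      "(\<Sum>i<Suc (Suc n). \<Sum>j<Suc (Suc n). q i j * dist (p i) (p j)) \<le>
       (\<Sum>r<Suc n. \<bar>\<Sum>i\<le>r. b i - a i\<bar> * dist (p r) (p (Suc r)))"
      using main[of b a] Suc.prems by auto
    have "(\<Sum>i<Suc (Suc n). \<Sum>j<Suc (Suc n). q j i * dist (p i) (p j)) =
       (\<Sum>i<Suc (Suc n). \<Sum>j<Suc (Suc n). q i j * dist (p i) (p j))"
      by (subst sum.swap) (simp add: dist_commute)
    moreover have "\<bar>\<Sum>i\<le>r. b i - a i\<bar> = \<bar>\<Sum>i\<le>r. a i - b i\<bar>" for r
      by (simp add: sum_subtractf abs_minus_commute)
    ultimately show ?thesis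
      using q partial_coupling_swap[OF q(1)] by (intro exI[of _ "\<lambda>i j. q j i"]) (simp del: sum.lessThan_Suc)
  qed
qed

lemma finite_discrete_emeasure:
  fixes G :: "'a::metric_space measure"
  assumes "finite_discrete G" "B \<in> sets borel"
  shows "emeasure G B = ennreal (\<Sum>x\<in>atoms G \<inter> B. measure G {x})"
proof -
  interpret finite_measure G using assms by (simp add: finite_discrete_def)
  have sets: "sets G = sets borel" and fin: "finite (atoms G)" and null: "emeasure G (- atoms G) = 0"
    using assms by (auto simp: finite_discrete_def)
  have atomsB: "atoms G \<in> sets borel" using fin by (simp add: finite_imp_closed)
  have "emeasure G B = emeasure G (atoms G \<inter> B \<union> (B - atoms G))"
    by (rule arg_cong[where f = "emeasure G"]) auto
  also have "\<dots> = emeasure G (atoms G \<inter> B) + emeasure G (B - atoms G)"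
    using assms atomsB by (intro plus_emeasure[symmetric]) (auto simp: sets)
  also have "emeasure G (B - atoms G) = 0"
  proof -
    have "emeasure G (B - atoms G) \<le> emeasure G (- atoms G)"
      using atomsB by (intro emeasure_mono) (auto simp: sets)
    then show ?thesis using null by simp
  qed
  also have "emeasure G (atoms G \<inter> B) = (\<Sum>x\<in>atoms G \<inter> B. emeasure G {x})"
    using fin by (intro emeasure_eq_sum_singleton) (auto simp: sets)
  also have "\<dots> = ennreal (\<Sum>x\<in>atoms G \<inter> B. measure G {x})"
    by (simp add: emeasure_eq_measure)
  finally show ?thesis by simp
qed

lemma finite_discrete_measure:
  fixes G :: "'a::metric_space measure"
  assumes "finite_discrete G" "B \<in> sets borel"
  shows "measure G B = (\<Sum>x\<in>atoms G \<inter> B. measure G {x})"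
  using finite_discrete_emeasure[OF assms] by (simp add: measure_def sum_nonneg)

lemma finite_discrete_mass:
  fixes G :: "'a::metric_space measure"
  assumes "finite_discrete G"
  shows "mass G = (\<Sum>x\<in>atoms G. measure G {x})"
proof -
  have "space G = UNIV" using assms sets_eq_imp_space_eq[of G borel] by (simp add: finite_discrete_def)
  then show ?thesis using finite_discrete_measure[OF assms, of UNIV] by (simp add: mass_def)
qed

lemma sum_measure_superset_atoms:
  assumes "finite A" "atoms G \<inter> B \<subseteq> A" "A \<subseteq> B"
  shows "(\<Sum>x\<in>A. measure G {x}) = (\<Sum>x\<in>atoms G \<inter> B. measure G {x})"
proof (rule sum.mono_neutral_right)
  show "\<forall>x\<in>A - atoms G \<inter> B. measure G {x} = 0"
    using assms(3) by (auto simp: atoms_def zero_less_measure_iff)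
qed (use assms in auto)

definition discrete_measure :: "'a::metric_space set \<Rightarrow> ('a \<Rightarrow> real) \<Rightarrow> 'a measure" where
  "discrete_measure A r = distr (point_measure A (\<lambda>x. ennreal (r x))) borel (\<lambda>x. x)"

lemma emeasure_discrete_measure:
  assumes "finite A" "\<And>x. 0 \<le> r x" "B \<in> sets borel"
  shows "emeasure (discrete_measure A r) B = ennreal (\<Sum>x\<in>A \<inter> B. r x)"
proof -
  have "(\<lambda>x. x) \<in> measurable (point_measure A (\<lambda>x. ennreal (r x))) borel"
    by (simp add: measurable_def point_measure_def)
  then have "emeasure (discrete_measure A r) B = emeasure (point_measure A (\<lambda>x. ennreal (r x))) (B \<inter> A)"
    using assms unfolding discrete_measure_def by (subst emeasure_distr) (auto simp: space_point_measure)
  also have "\<dots> = (\<Sum>x\<in>B \<inter> A. ennreal (r x))"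
    using assms by (intro emeasure_point_measure_finite) auto
  finally show ?thesis using assms by (simp add: Int_commute)
qed

lemma measure_discrete_measure_singleton:
  assumes "finite A" "\<And>x. 0 \<le> r x"
  shows "measure (discrete_measure A r) {x} = (if x \<in> A then r x else 0)"
  using emeasure_discrete_measure[OF assms, of "{x}"] assms
  by (simp add: measure_def)

lemma atoms_discrete_measure:
  assumes "finite A" "\<And>x. 0 \<le> r x"
  shows "atoms (discrete_measure A r) = {x\<in>A. 0 < r x}"
  unfolding atoms_def measure_discrete_measure_singleton[OF assms] by auto

lemma finite_discrete_discrete_measure:
  assumes "finite A" "\<And>x. 0 \<le> r x"
  shows "finite_discrete (discrete_measure A r)" "mass (discrete_measure A r) = (\<Sum>x\<in>A. r x)"
proof -
  have sp: "space (discrete_measure A r) = UNIV" by (simp add: discrete_measure_def)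
  have B: "- {x \<in> A. 0 < r x} \<in> sets borel"
    using assms(1) by (intro borel_open open_Compl finite_imp_closed) simp
  have "emeasure (discrete_measure A r) (- {x \<in> A. 0 < r x}) = ennreal (\<Sum>x\<in>A \<inter> - {x \<in> A. 0 < r x}. r x)"
    by (rule emeasure_discrete_measure[OF assms B])
  also have "(\<Sum>x\<in>A \<inter> - {x \<in> A. 0 < r x}. r x) = 0"
    using assms(2) by (intro sum.neutral) (auto simp: not_less intro: antisym)
  finally have "emeasure (discrete_measure A r) (- atoms (discrete_measure A r)) = 0"
    unfolding atoms_discrete_measure[OF assms] by simp
  moreover have "finite_measure (discrete_measure A r)"
    using emeasure_discrete_measure[OF assms, of UNIV] by (intro finite_measureI) (simp add: sp)
  ultimately show "finite_discrete (discrete_measure A r)"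
    using assms by (simp add: finite_discrete_def atoms_discrete_measure) (simp add: discrete_measure_def)
  show "mass (discrete_measure A r) = (\<Sum>x\<in>A. r x)"
    using emeasure_discrete_measure[OF assms, of UNIV] assms(2) sp by (simp add: mass_def measure_def sum_nonneg)
qed

text \<open>The product coupling shows that the infimum is taken over a nonempty set; on the empty
  set the value of the infimum is arbitrary.\<close>
lemma wasserstein_1_nonneg:
  fixes \<mu> \<nu> :: "'a::metric_space measure"
  assumes "finite_discrete \<mu>" "finite_discrete \<nu>" "mass \<mu> = mass \<nu>"
  shows "0 \<le> wasserstein 1 \<mu> \<nu>"
proof -
  define M where "M = mass \<mu>"
  have \<mu>: "(\<Sum>x\<in>atoms \<mu>. measure \<mu> {x}) = M" and \<nu>: "(\<Sum>x\<in>atoms \<nu>. measure \<nu> {x}) = M"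
    using finite_discrete_mass[OF assms(1)] finite_discrete_mass[OF assms(2)] assms(3) by (simp_all add: M_def)
  have M0: "M \<ge> 0" by (simp add: M_def mass_def)
  have M: "M > 0" if "x \<in> atoms \<mu> \<or> x \<in> atoms \<nu>" for x
  proof -
    have "measure \<mu> {x} \<le> M" if "x \<in> atoms \<mu>"
      unfolding \<mu>[symmetric] using assms that by (intro member_le_sum) (auto simp: finite_discrete_def)
    moreover have "measure \<nu> {x} \<le> M" if "x \<in> atoms \<nu>"
      unfolding \<nu>[symmetric] using assms that by (intro member_le_sum) (auto simp: finite_discrete_def)
    ultimately show ?thesis using that by (auto simp: atoms_def)
  qed
  define q where "q x y = measure \<mu> {x} * measure \<nu> {y} / M" for x y
  have "(\<Sum>y\<in>atoms \<nu>. q x y) = measure \<mu> {x}" if "x \<in> atoms \<mu>" for x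
  proof -
    have "(\<Sum>y\<in>atoms \<nu>. q x y) = measure \<mu> {x} * (\<Sum>y\<in>atoms \<nu>. measure \<nu> {y}) / M"
      by (simp add: q_def sum_distrib_left sum_divide_distrib)
    then show ?thesis using M[of x] that by (simp add: \<nu>)
  qed
  moreover have "(\<Sum>x\<in>atoms \<mu>. q x y) = measure \<nu> {y}" if "y \<in> atoms \<nu>" for y
  proof -
    have "(\<Sum>x\<in>atoms \<mu>. q x y) = (\<Sum>x\<in>atoms \<mu>. measure \<mu> {x}) * measure \<nu> {y} / M"
      by (simp add: q_def sum_distrib_right sum_divide_distrib)
    then show ?thesis using M[of y] that by (simp add: \<mu>)
  qed
  ultimately have "q \<in> couplings \<mu> \<nu>" using M0 by (simp add: couplings_def q_def)
  then have "0 \<le> (INF q\<in>couplings \<mu> \<nu>. \<Sum>x\<in>atoms \<mu>. \<Sum>y\<in>atoms \<nu>. q x y * dist x y ^ 1)"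
    by (intro cINF_greatest sum_nonneg) (auto simp: couplings_def)
  then show ?thesis by (simp add: wasserstein_def)
qed

lemma wasserstein_1_le:
  assumes "q \<in> couplings \<mu> \<nu>"
  shows "wasserstein 1 \<mu> \<nu> \<le> (\<Sum>x\<in>atoms \<mu>. \<Sum>y\<in>atoms \<nu>. q x y * dist x y)"
proof -
  have "(INF q\<in>couplings \<mu> \<nu>. \<Sum>x\<in>atoms \<mu>. \<Sum>y\<in>atoms \<nu>. q x y * dist x y ^ 1)
    \<le> (\<Sum>x\<in>atoms \<mu>. \<Sum>y\<in>atoms \<nu>. q x y * dist x y ^ 1)"
    by (rule cINF_lower[OF bdd_belowI[where m = 0] assms]) (auto simp: couplings_def intro!: sum_nonneg)
  then show ?thesis by (simp add: wasserstein_def)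
qed

text \<open>The marginals of a partial coupling are admissible submeasures.\<close>
lemma POT_1_bounds:
  fixes G1 G2 :: "'a::metric_space measure"
  assumes G: "finite_discrete G1" "finite_discrete G2"
    and p: "inj_on p {..<n}" "atoms G1 \<subseteq> p ` {..<n}" "atoms G2 \<subseteq> p ` {..<n}"
    and q: "partial_coupling n (\<lambda>i. measure G1 {p i}) (\<lambda>i. measure G2 {p i}) q"
  shows "0 \<le> POT 1 G1 G2"
    "POT 1 G1 G2 \<le> (\<Sum>i<n. \<Sum>j<n. q i j * dist (p i) (p j)) + \<bar>mass G1 - mass G2\<bar>"
proof -
  define A where "A = p ` {..<n}"
  define idx where "idx = the_inv_into {..<n} p"
  have idx: "idx (p i) = i" if "i < n" for i
    using the_inv_into_f_f[OF p(1)] that by (simp add: idx_def)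
  have A: "finite A" "atoms G1 \<subseteq> A" "atoms G2 \<subseteq> A" using p by (auto simp: A_def)
  have sumA: "(\<Sum>x\<in>A. h x) = (\<Sum>i<n. h (p i))" for h :: "'a \<Rightarrow> real"
    unfolding A_def by (simp add: sum.reindex[OF p(1)])
  have q0: "0 \<le> q i j" and row: "i < n \<Longrightarrow> (\<Sum>j<n. q i j) \<le> measure G1 {p i}"
    and col: "j < n \<Longrightarrow> (\<Sum>i<n. q i j) \<le> measure G2 {p j}"
    and tot: "(\<Sum>i<n. \<Sum>j<n. q i j) = min (\<Sum>i<n. measure G1 {p i}) (\<Sum>i<n. measure G2 {p i})" for i j
    using q by (auto simp: partial_coupling_def)
  have mass: "mass G1 = (\<Sum>i<n. measure G1 {p i})" "mass G2 = (\<Sum>i<n. measure G2 {p i})"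
    using sum_measure_superset_atoms[of A G1 UNIV] sum_measure_superset_atoms[of A G2 UNIV] A
    unfolding finite_discrete_mass[OF G(1)] finite_discrete_mass[OF G(2)] sumA by simp_all
  define r1 where "r1 x = (\<Sum>j<n. q (idx x) j)" for x
  define r2 where "r2 y = (\<Sum>i<n. q i (idx y))" for y
  have r0: "0 \<le> r1 x" "0 \<le> r2 x" for x using q0 by (auto simp: r1_def r2_def intro: sum_nonneg)
  define \<mu> where "\<mu> = discrete_measure A r1"
  define \<nu> where "\<nu> = discrete_measure A r2"
  note \<mu>_simps = atoms_discrete_measure[where r = r1, OF A(1) r0(1), folded \<mu>_def]
    measure_discrete_measure_singleton[where r = r1, OF A(1) r0(1), folded \<mu>_def]
  note \<nu>_simps = atoms_discrete_measure[where r = r2, OF A(1) r0(2), folded \<nu>_def]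
    measure_discrete_measure_singleton[where r = r2, OF A(1) r0(2), folded \<nu>_def]
  have fd: "finite_discrete \<mu>" "finite_discrete \<nu>"
    unfolding \<mu>_def \<nu>_def by (intro finite_discrete_discrete_measure A r0)+
  have m: "mass \<mu> = min (mass G1) (mass G2)" "mass \<nu> = min (mass G1) (mass G2)"
  proof -
    show "mass \<mu> = min (mass G1) (mass G2)"
      unfolding \<mu>_def finite_discrete_discrete_measure(2)[where r = r1, OF A(1) r0(1)] sumA mass tot[symmetric] r1_def
      by (simp add: idx)
    have "mass \<nu> = (\<Sum>j<n. \<Sum>i<n. q i j)"
      unfolding \<nu>_def finite_discrete_discrete_measure(2)[where r = r2, OF A(1) r0(2)] sumA r2_def
      by (simp add: idx)
    then show "mass \<nu> = min (mass G1) (mass G2)" by (subst (asm) sum.swap) (simp add: tot mass)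
  qed
  have dom: "dominated (discrete_measure A r) G"
    if "finite_discrete G" "\<And>x. 0 \<le> r x" "\<And>i. i < n \<Longrightarrow> r (p i) \<le> measure G {p i}" "atoms G \<subseteq> A" for G r
    unfolding dominated_def
  proof
    fix B :: "'a set" assume B: "B \<in> sets borel"
    have "(\<Sum>x\<in>A \<inter> B. r x) \<le> (\<Sum>x\<in>A \<inter> B. measure G {x})"
      using that(3) by (intro sum_mono) (auto simp: A_def)
    also have "\<dots> = (\<Sum>x\<in>atoms G \<inter> B. measure G {x})"
      using A(1) that(4) by (intro sum_measure_superset_atoms) auto
    finally show "emeasure (discrete_measure A r) B \<le> emeasure G B"
      unfolding emeasure_discrete_measure[OF A(1) that(2) B] finite_discrete_emeasure[OF that(1) B]
      by (rule ennreal_leI)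
  qed
  have "dominated \<mu> G1" "dominated \<nu> G2"
    unfolding \<mu>_def \<nu>_def using row col A by (auto intro!: dom G r0 simp: r1_def r2_def idx)
  then have pair: "(\<mu>, \<nu>) \<in> sub_pairs G1 G2" using fd m by (simp add: sub_pairs_def)
  define q' where "q' x y = q (idx x) (idx y)" for x y
  have zero: "q i j = 0" if "i < n" "j < n" "r1 (p i) = 0 \<or> r2 (p j) = 0" for i j
  proof -
    have "q i j \<le> r1 (p i)" unfolding r1_def idx[OF that(1)]
      by (rule member_le_sum) (use q0 that in auto)
    moreover have "q i j \<le> r2 (p j)" unfolding r2_def idx[OF that(2)]
      by (rule member_le_sum[where f = "\<lambda>i. q i j"]) (use q0 that in auto)
    ultimately show ?thesis using q0[of i j] that(3) by auto
  qed
  have zero': "q' x y = 0" if xy: "x \<in> A" "y \<in> A" "x \<notin> atoms \<mu> \<or> y \<notin> atoms \<nu>" for x y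
  proof -
    obtain i j where ij: "x = p i" "i < n" "y = p j" "j < n" using xy(1,2) unfolding A_def by blast
    have "r1 x = 0 \<or> r2 y = 0" using xy r0[of x] r0[of y] by (auto simp: \<mu>_simps \<nu>_simps)
    then show ?thesis using zero ij by (simp add: q'_def idx)
  qed
  have sub: "atoms \<mu> \<subseteq> A" "atoms \<nu> \<subseteq> A" by (auto simp: \<mu>_simps \<nu>_simps)
  have "q' \<in> couplings \<mu> \<nu>"
    unfolding couplings_def
  proof (intro CollectI conjI allI ballI)
    show "0 \<le> q' x y" for x y using q0 by (simp add: q'_def)
    show "(\<Sum>y\<in>atoms \<nu>. q' x y) = measure \<mu> {x}" if "x \<in> atoms \<mu>" for x
    proof -
      have "(\<Sum>y\<in>atoms \<nu>. q' x y) = (\<Sum>y\<in>A. q' x y)"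
        using A sub that zero' by (intro sum.mono_neutral_left) auto
      also have "\<dots> = r1 x" unfolding sumA q'_def r1_def by (simp add: idx)
      finally show ?thesis using that sub by (auto simp: \<mu>_simps)
    qed
    show "(\<Sum>x\<in>atoms \<mu>. q' x y) = measure \<nu> {y}" if "y \<in> atoms \<nu>" for y
    proof -
      have "(\<Sum>x\<in>atoms \<mu>. q' x y) = (\<Sum>x\<in>A. q' x y)"
        using A sub that zero' by (intro sum.mono_neutral_left) auto
      also have "\<dots> = r2 y" unfolding sumA q'_def r2_def by (simp add: idx)
      finally show ?thesis using that sub by (auto simp: \<nu>_simps)
    qed
  qed
  then have "wasserstein 1 \<mu> \<nu> \<le> (\<Sum>x\<in>atoms \<mu>. \<Sum>y\<in>atoms \<nu>. q' x y * dist x y)"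
    by (rule wasserstein_1_le)
  also have "\<dots> \<le> (\<Sum>x\<in>A. \<Sum>y\<in>A. q' x y * dist x y)"
  proof -
    have "(\<Sum>y\<in>atoms \<nu>. q' x y * dist x y) \<le> (\<Sum>y\<in>A. q' x y * dist x y)" for x
      using A sub q0 by (intro sum_mono2) (auto simp: q'_def)
    then have "(\<Sum>x\<in>atoms \<mu>. \<Sum>y\<in>atoms \<nu>. q' x y * dist x y) \<le> (\<Sum>x\<in>atoms \<mu>. \<Sum>y\<in>A. q' x y * dist x y)"
      by (intro sum_mono)
    also have "\<dots> \<le> (\<Sum>x\<in>A. \<Sum>y\<in>A. q' x y * dist x y)"
      using A sub q0 by (intro sum_mono2) (auto simp: q'_def intro!: sum_nonneg)
    finally show ?thesis .
  qed
  also have "\<dots> = (\<Sum>i<n. \<Sum>j<n. q i j * dist (p i) (p j))"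
    unfolding sumA q'_def by (simp add: idx)
  finally have W: "wasserstein 1 \<mu> \<nu> \<le> (\<Sum>i<n. \<Sum>j<n. q i j * dist (p i) (p j))" .
  have nonneg: "0 \<le> wasserstein 1 (fst m) (snd m)" if "m \<in> sub_pairs G1 G2" for m
    using that by (auto simp: sub_pairs_def intro!: wasserstein_1_nonneg simp del: One_nat_def)
  let ?I = "INF (\<mu>1, \<mu>2)\<in>sub_pairs G1 G2. wasserstein 1 \<mu>1 \<mu>2 ^ 1"
  have POT: "POT 1 G1 G2 = ?I + \<bar>mass G1 - mass G2\<bar>"
    by (simp add: POT_def)
  have "0 \<le> ?I"
    using pair nonneg by (intro cINF_greatest) auto
  then show "0 \<le> POT 1 G1 G2" unfolding POT by simp
  have "?I \<le> (case (\<mu>, \<nu>) of (\<mu>1, \<mu>2) \<Rightarrow> wasserstein 1 \<mu>1 \<mu>2 ^ 1)"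
    using nonneg by (intro cINF_lower[OF bdd_belowI[where m = 0] pair]) auto
  then show "POT 1 G1 G2 \<le> (\<Sum>i<n. \<Sum>j<n. q i j * dist (p i) (p j)) + \<bar>mass G1 - mass G2\<bar>"
    unfolding POT using W by simp
qed

lemma restrict_measure_facts:
  fixes G :: "'a::metric_space measure"
  assumes "finite_discrete G" "V \<in> sets borel"
  shows "finite_discrete (restrict_measure G V)" "atoms (restrict_measure G V) = atoms G \<inter> V"
    "\<And>x. measure (restrict_measure G V) {x} = (if x \<in> V then measure G {x} else 0)"
proof -
  interpret finite_measure G using assms by (simp add: finite_discrete_def)
  have sets: "sets G = sets borel" and null: "emeasure G (- atoms G) = 0" and fin: "finite (atoms G)"
    using assms by (auto simp: finite_discrete_def)
  have em: "emeasure (restrict_measure G V) B = emeasure G (V \<inter> B)" if "B \<in> sets borel" for B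
    unfolding restrict_measure_def
    using that assms by (subst emeasure_restricted) (auto simp: sets)
  show m: "measure (restrict_measure G V) {x} = (if x \<in> V then measure G {x} else 0)" for x
    using em[of "{x}"] by (simp add: measure_def)
  show at: "atoms (restrict_measure G V) = atoms G \<inter> V"
    unfolding atoms_def m by auto
  have sp: "space (restrict_measure G V) = space G" by (simp add: restrict_measure_def)
  have "finite_measure (restrict_measure G V)"
  proof (rule finite_measureI)
    have "space G = UNIV" using sets_eq_imp_space_eq[OF sets] by simp
    then show "emeasure (restrict_measure G V) (space (restrict_measure G V)) \<noteq> \<infinity>"
      unfolding sp using em[of UNIV] by simp
  qed
  moreover have "emeasure (restrict_measure G V) (- (atoms G \<inter> V)) = 0"
  proof -
    have c: "- (atoms G \<inter> V) \<in> sets borel" "- atoms G \<in> sets borel"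
      using fin by (intro borel_open open_Compl finite_imp_closed finite_Int disjI1; assumption)+
    have "emeasure G (V \<inter> - (atoms G \<inter> V)) \<le> emeasure G (- atoms G)"
      using c by (intro emeasure_mono) (auto simp: sets)
    then show ?thesis using em[OF c(1)] null by simp
  qed
  ultimately show "finite_discrete (restrict_measure G V)"
    using fin unfolding finite_discrete_def at by (simp add: restrict_measure_def sets)
qed

section \<open>Flow through the gaps of a configuration\<close>

lemma sorted_enumeration:
  fixes \<phi> :: "'a \<Rightarrow> real"
  assumes "finite A" "inj_on \<phi> A"
  obtains p where "bij_betw p {..<card A} A" "\<And>i j. i < j \<Longrightarrow> j < card A \<Longrightarrow> \<phi> (p i) < \<phi> (p j)"
proof -
  define xs where "xs = sorted_list_of_set (\<phi> ` A)"
  define h where "h = (!) xs"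
  have h: "bij_betw h {..<card (\<phi> ` A)} (\<phi> ` A)"
    unfolding h_def by (rule bij_betw_nth) (use assms(1) in \<open>auto simp: xs_def\<close>)
  have h_mono: "h i < h j" if "i < j" "j < card (\<phi> ` A)" for i j
    using that sorted_wrt_nth_less[of "(<)" xs i j] unfolding h_def xs_def by simp
  have card: "card (\<phi> ` A) = card A" using assms(2) by (rule card_image)
  have \<phi>: "\<phi> (inv_into A \<phi> (h i)) = h i" if "i < card A" for i
    using h that by (intro f_inv_into_f) (auto simp: bij_betw_def card)
  show ?thesis
  proof (rule that)
    show "bij_betw (inv_into A \<phi> \<circ> h) {..<card A} A"
      using h assms(2) unfolding card
      by (intro bij_betw_trans[of h _ "\<phi> ` A"] bij_betw_inv_into inj_on_imp_bij_betw)
    show "\<phi> ((inv_into A \<phi> \<circ> h) i) < \<phi> ((inv_into A \<phi> \<circ> h) j)" if "i < j" "j < card A" for i j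
      using h_mono[OF that(1)] that \<phi> by (simp add: card)
  qed
qed

lemma POT_restrict_le_path:
  fixes G G' :: "'a::metric_space measure"
  assumes "finite_discrete G" "finite_discrete G'" "V \<in> sets borel"
    and p: "bij_betw p {..<n} A" "(atoms G \<union> atoms G') \<inter> V \<subseteq> A" "A \<subseteq> V"
  shows "0 \<le> POT 1 (restrict_measure G V) (restrict_measure G' V)"
    "POT 1 (restrict_measure G V) (restrict_measure G' V) \<le>
      \<bar>\<Sum>i<n. measure G {p i} - measure G' {p i}\<bar> +
      (\<Sum>r<n - 1. \<bar>\<Sum>i\<le>r. measure G {p i} - measure G' {p i}\<bar> * dist (p r) (p (Suc r)))"
proof -
  let ?G = "restrict_measure G V" and ?G' = "restrict_measure G' V"
  note r = restrict_measure_facts[OF assms(1,3)] and r' = restrict_measure_facts[OF assms(2,3)]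
  have inj: "inj_on p {..<n}" and im: "p ` {..<n} = A" using p(1) by (auto simp: bij_betw_def)
  have fin: "finite A" using im by auto
  have pV: "p i \<in> V" if "i < n" for i using im that p(3) by auto
  have m: "measure ?G {p i} = measure G {p i}" "measure ?G' {p i} = measure G' {p i}" if "i < n" for i
    using pV[OF that] r(3) r'(3) by auto
  have mass: "mass H = (\<Sum>i<n. measure H {p i})" if "finite_discrete H" "atoms H \<subseteq> A" for H
  proof -
    have "mass H = (\<Sum>x\<in>A. measure H {x})"
      using finite_discrete_mass[OF that(1)] sum_measure_superset_atoms[of A H UNIV] fin that by simp
    also have "\<dots> = (\<Sum>i<n. measure H {p i})" unfolding im[symmetric] by (simp add: sum.reindex[OF inj])
    finally show ?thesis .
  qed
  have at: "atoms ?G \<subseteq> p ` {..<n}" "atoms ?G' \<subseteq> p ` {..<n}" using p(2) by (auto simp: r r' im)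
  have "\<exists>q. partial_coupling n (\<lambda>i. measure ?G {p i}) (\<lambda>i. measure ?G' {p i}) q \<and>
    (\<Sum>i<n. \<Sum>j<n. q i j * dist (p i) (p j)) \<le>
    (\<Sum>r<n - 1. \<bar>\<Sum>i\<le>r. measure ?G {p i} - measure ?G' {p i}\<bar> * dist (p r) (p (Suc r)))"
  proof (cases n)
    case 0
    then show ?thesis by (intro exI[of _ "\<lambda>_ _. 0"]) (simp add: partial_coupling_def)
  next
    case (Suc n')
    show ?thesis
      using partial_coupling_along_path[where n = n' and a = "\<lambda>i. measure ?G {p i}" and b = "\<lambda>i. measure ?G' {p i}" and p = p]
      unfolding Suc by simp
  qed
  then obtain q where q: "partial_coupling n (\<lambda>i. measure ?G {p i}) (\<lambda>i. measure ?G' {p i}) q"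
    and cost: "(\<Sum>i<n. \<Sum>j<n. q i j * dist (p i) (p j)) \<le>
    (\<Sum>r<n - 1. \<bar>\<Sum>i\<le>r. measure ?G {p i} - measure ?G' {p i}\<bar> * dist (p r) (p (Suc r)))"
    by blast
  note POT = POT_1_bounds[OF r(1) r'(1) inj at q]
  show "0 \<le> POT 1 ?G ?G'" by (rule POT(1))
  have "(\<Sum>i\<le>r. measure ?G {p i} - measure ?G' {p i}) = (\<Sum>i\<le>r. measure G {p i} - measure G' {p i})"
    if "r < n - 1" for r
    using that by (intro sum.cong) (auto simp: m)
  then have "(\<Sum>r<n - 1. \<bar>\<Sum>i\<le>r. measure ?G {p i} - measure ?G' {p i}\<bar> * dist (p r) (p (Suc r))) =
    (\<Sum>r<n - 1. \<bar>\<Sum>i\<le>r. measure G {p i} - measure G' {p i}\<bar> * dist (p r) (p (Suc r)))"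
    by (intro sum.cong) auto
  moreover have "mass ?G - mass ?G' = (\<Sum>i<n. measure G {p i} - measure G' {p i})"
    using mass[OF r(1)] mass[OF r'(1)] at by (simp add: im sum_subtractf m)
  ultimately show "POT 1 ?G ?G' \<le> \<bar>\<Sum>i<n. measure G {p i} - measure G' {p i}\<bar> +
      (\<Sum>r<n - 1. \<bar>\<Sum>i\<le>r. measure G {p i} - measure G' {p i}\<bar> * dist (p r) (p (Suc r)))"
    using POT(2) cost by simp
qed

text \<open>For \<open>g \<le> h\<close> the bound \<open>F \<le> 1\<close> suffices. For \<open>g > h\<close> all quotients \<open>h\<^sup>n\<^sup>-\<^sup>1 / g\<^sup>m\<^sup>-\<^sup>1\<close> with \<open>1 \<le> m < n\<close>
  are at most \<open>h\<close>. In the application \<open>h\<^sup>n\<^sup>-\<^sup>1\<close> is the Kolmogorov distance.\<close>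
lemma gap_flow_bound:
  fixes g h R K F :: real
  assumes "2 \<le> n" "0 < g" "g \<le> R" "0 \<le> h" "h \<le> 1" "0 \<le> K" "0 \<le> F" "F \<le> 1"
    and F: "F \<le> K * h ^ (n - 1) * (\<Sum>m<n. (2 / g) ^ m)"
  shows "g * F \<le> (1 + K * (R + real n * 2 ^ n)) * h"
proof (cases "g \<le> h")
  case True
  have "g * F \<le> h * 1" using assms True by (intro mult_mono) auto
  also have "\<dots> \<le> (1 + K * (R + real n * 2 ^ n)) * h"
    using assms by (simp add: distrib_right)
  finally show ?thesis .
next
  case False
  have summand: "g * (h ^ (n - 1) * (2 / g) ^ m) \<le> (if m = 0 then R else 2 ^ n) * h" if "m < n" for m
  proof (cases m)
    case 0
    have "h ^ (n - 1) \<le> h ^ 1" using assms by (intro power_decreasing) auto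
    then have "g * h ^ (n - 1) \<le> R * h" using assms by (intro mult_mono) auto
    then show ?thesis by (simp add: 0)
  next
    case (Suc m')
    have "h ^ (n - 1) \<le> h ^ m" using assms that by (intro power_decreasing) auto
    also have "\<dots> \<le> h * g ^ m'" using assms False unfolding Suc by (simp add: mult_left_mono power_mono)
    finally have "h ^ (n - 1) / g ^ m' \<le> h" using assms by (simp add: pos_divide_le_eq)
    moreover have "(2::real) ^ m \<le> 2 ^ n" using that by (intro power_increasing) auto
    ultimately have "2 ^ m * (h ^ (n - 1) / g ^ m') \<le> 2 ^ n * h"
      using assms by (intro mult_mono) auto
    moreover have "g * (h ^ (n - 1) * (2 / g) ^ m) = 2 ^ m * (h ^ (n - 1) / g ^ m')"
      using assms by (simp add: Suc power_divide field_simps)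
    moreover have "m \<noteq> 0" by (simp add: Suc)
    ultimately show ?thesis by (simp only: if_False)
  qed
  have "g * F \<le> g * (K * h ^ (n - 1) * (\<Sum>m<n. (2 / g) ^ m))"
    using F assms by (intro mult_left_mono) auto
  also have "\<dots> = K * (\<Sum>m<n. g * (h ^ (n - 1) * (2 / g) ^ m))"
    by (simp add: sum_distrib_left mult_ac)
  also have "\<dots> \<le> K * (\<Sum>m<n. (if m = 0 then R else 2 ^ n) * h)"
    using assms summand by (intro mult_left_mono sum_mono) auto
  also have "\<dots> \<le> K * (R * h + (\<Sum>m<n. 2 ^ n * h))"
  proof (intro mult_left_mono)
    obtain n' where n': "n = Suc n'" using assms(1) by (cases n) auto
    have "(\<Sum>m<n. (if m = 0 then R else 2 ^ n) * h) = R * h + (\<Sum>m<n'. 2 ^ n * h)"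
      unfolding n' by (subst sum.lessThan_Suc_shift) simp
    also have "\<dots> \<le> R * h + (\<Sum>m<n. 2 ^ n * h)" using assms by (simp add: n' algebra_simps)
    finally show "(\<Sum>m<n. (if m = 0 then R else 2 ^ n) * h) \<le> R * h + (\<Sum>m<n. 2 ^ n * h)" .
  qed (use assms in auto)
  also have "\<dots> \<le> (1 + K * (R + real n * 2 ^ n)) * h"
    using assms by (simp add: algebra_simps)
  finally show ?thesis .
qed

text \<open>The atoms in the cell \<open>V\<close> are sorted by their projections to \<open>v\<close>, and mass is moved along this
  path. The mass that crosses a gap is the sum over the clusters in \<open>V\<close> of their masses on one side
  of it. Projections of different clusters may interleave; this does no harm, since a gap between
  consecutive atoms of \<open>V\<close> contains no atom of any cluster in \<open>V\<close>. The exponent is at least \<open>n - 1\<close>,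
  with \<open>n\<close> the number of distinct atoms in \<open>V\<close>.\<close>
lemma POT_cell_bound:
  fixes G G' :: "'a::real_inner measure" and cl :: "'s \<Rightarrow> 'a set"
  defines "w \<equiv> \<lambda>x. measure G {x} - measure G' {x}" and "P \<equiv> atoms G \<union> atoms G'"
  assumes G: "finite_discrete G" "finite_discrete G'" "prob_space G" "prob_space G'"
    and V: "V \<in> sets borel" and card: "card (atoms G) \<le> k" "card (atoms G') \<le> k" and "1 \<le> k"
    and v: "norm v \<le> 1" "0 < \<kappa>" "\<And>x y. x \<in> P \<Longrightarrow> y \<in> P \<Longrightarrow> \<kappa> * norm (x - y) \<le> \<bar>(x - y) \<bullet> v\<bar>"
    and R: "0 \<le> R" "\<And>x y. x \<in> P \<Longrightarrow> y \<in> P \<Longrightarrow> norm (x - y) \<le> R"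
    and cl: "finite S" "P = (\<Union>s\<in>S. cl s)" "disjoint_family_on cl S" "\<And>s. s \<in> S \<Longrightarrow> cl s \<subseteq> V \<or> cl s \<inter> V = {}"
    and K: "0 \<le> K" and \<Delta>: "0 \<le> \<Delta>" "\<Delta> \<le> 1"
    and moments: "\<And>s h m. s \<in> S \<Longrightarrow> bij_betw h {..<card (cl s)} (cl s) \<Longrightarrow> m < card (cl s) \<Longrightarrow>
        \<bar>\<Sum>i<card (cl s). w (h i) * (\<Prod>l<m. (h i - h l) \<bullet> v)\<bar> \<le> K * \<Delta>"
  defines "K1 \<equiv> real (card S) * K"
  defines "K3 \<equiv> 1 + K1 + 2 * real k * ((1 + K1 * (R + 2 * real k * 2 ^ (2 * k))) / \<kappa>)"
  shows "POT 1 (restrict_measure G V) (restrict_measure G' V) ^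
      max (card (atoms G \<inter> V) + card (atoms G' \<inter> V) - 1) 1 \<le> K3 ^ (2 * k) * \<Delta>"
proof -
  let ?POT = "POT 1 (restrict_measure G V) (restrict_measure G' V)"
  let ?\<phi> = "\<lambda>x. x \<bullet> v"
  define A where "A = P \<inter> V"
  define n where "n = card A"
  have finP: "finite P" using G by (simp add: P_def finite_discrete_def)
  have finA: "finite A" using finP by (simp add: A_def)
  have fincl: "finite (cl s)" "cl s \<subseteq> P" if "s \<in> S" for s
    using that finP cl(2) by (auto intro: finite_subset)
  have inj: "inj_on ?\<phi> P"
  proof (rule inj_onI)
    fix x y assume "x \<in> P" "y \<in> P" "x \<bullet> v = y \<bullet> v"
    then have "\<kappa> * norm (x - y) \<le> 0" using v(3)[of x y] by (simp add: inner_diff_left)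
    then show "x = y" using v(2) by (simp add: mult_le_0_iff)
  qed
  have K1: "0 \<le> K1" using K by (simp add: K1_def)
  have n_le: "n \<le> card (atoms G \<inter> V) + card (atoms G' \<inter> V)"
    unfolding n_def A_def P_def Int_Un_distrib2 by (rule card_Un_le)
  have cardV: "card (atoms G \<inter> V) \<le> k" "card (atoms G' \<inter> V) \<le> k"
    using card G card_mono[of "atoms G" "atoms G \<inter> V"] card_mono[of "atoms G'" "atoms G' \<inter> V"]
    by (auto simp: finite_discrete_def)
  have n2k: "n \<le> 2 * k" using n_le cardV by simp
  obtain p where p: "bij_betw p {..<n} A" and mono: "\<And>i j. i < j \<Longrightarrow> j < n \<Longrightarrow> ?\<phi> (p i) < ?\<phi> (p j)"
    using sorted_enumeration[of A ?\<phi>] finA inj_on_subset[OF inj, of A] unfolding n_def A_def by blast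
  have pP: "p i \<in> P" "p i \<in> V" if "i < n" for i
    using p that by (auto simp: bij_betw_def A_def)
  have le1: "\<bar>\<Sum>x\<in>B. w x\<bar> \<le> 1" if "finite B" for B
  proof -
    have "0 \<le> (\<Sum>x\<in>B. measure H {x}) \<and> (\<Sum>x\<in>B. measure H {x}) \<le> 1" if "finite_discrete H" "prob_space H" for H :: "'a measure"
    proof -
      interpret prob_space H by fact
      have "(\<Sum>x\<in>B. measure H {x}) = measure H B"
        using \<open>finite B\<close> that(1)
        by (intro measure_eq_sum_singleton[symmetric]) (auto simp: finite_discrete_def)
      then show ?thesis by (simp add: prob_le_1)
    qed
    from this[OF G(1,3)] this[OF G(2,4)] show ?thesis
      unfolding w_def sum_subtractf by linarith
  qed
  have w0: "w x = 0" if "x \<notin> P" for x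
    using that by (auto simp: w_def P_def atoms_def zero_less_measure_iff)
  have cluster_split: "(\<Sum>x\<in>{x\<in>A. Q x}. w x) = (\<Sum>s\<in>{s\<in>S. cl s \<subseteq> V}. \<Sum>x\<in>{x\<in>cl s. Q x}. w x)" for Q
  proof -
    have "{x\<in>A. Q x} = (\<Union>s\<in>{s\<in>S. cl s \<subseteq> V}. {x\<in>cl s. Q x})"
      using cl(2,4) unfolding A_def by blast
    moreover have "disjoint_family_on (\<lambda>s. {x\<in>cl s. Q x}) {s\<in>S. cl s \<subseteq> V}"
      using cl(3) unfolding disjoint_family_on_def by blast
    ultimately show ?thesis
      using cl(1) fincl by (simp only:) (subst sum.UNION_disjoint_family, auto)
  qed
  have sum_le: "\<bar>\<Sum>x\<in>{x\<in>A. Q x}. w x\<bar> \<le> K1 * \<Delta> * c"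
    if "\<And>s. s \<in> S \<Longrightarrow> cl s \<subseteq> V \<Longrightarrow> \<bar>\<Sum>x\<in>{x\<in>cl s. Q x}. w x\<bar> \<le> K * \<Delta> * c" "0 \<le> c" for Q c
  proof -
    have "\<bar>\<Sum>x\<in>{x\<in>A. Q x}. w x\<bar> \<le> (\<Sum>s\<in>{s\<in>S. cl s \<subseteq> V}. \<bar>\<Sum>x\<in>{x\<in>cl s. Q x}. w x\<bar>)"
      unfolding cluster_split by (rule sum_abs)
    also have "\<dots> \<le> (\<Sum>s\<in>{s\<in>S. cl s \<subseteq> V}. K * \<Delta> * c)" using that by (intro sum_mono) auto
    also have "\<dots> \<le> (\<Sum>s\<in>S. K * \<Delta> * c)" using cl(1) K \<Delta> that(2) by (intro sum_mono2) auto
    finally show ?thesis by (simp add: K1_def)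
  qed
  have total: "\<bar>\<Sum>i<n. w (p i)\<bar> \<le> K1 * \<Delta>"
  proof -
    have "\<bar>\<Sum>x\<in>{x\<in>cl s. True}. w x\<bar> \<le> K * \<Delta> * 1" if s: "s \<in> S" for s
    proof (cases "cl s = {}")
      case True then show ?thesis using K \<Delta> by simp
    next
      case False
      then have c: "0 < card (cl s)" using fincl[OF s] by (simp add: card_gt_0_iff)
      obtain h where h: "bij_betw h {..<card (cl s)} (cl s)"
        using ex_bij_betw_nat_finite[OF fincl(1)[OF s]] by (auto simp: atLeast0LessThan)
      have "(\<Sum>i<card (cl s). w (h i)) = (\<Sum>x\<in>cl s. w x)"
        using h by (rule sum.reindex_bij_betw)
      then show ?thesis using moments[OF s h c] by simp
    qed
    from sum_le[of "\<lambda>_. True" 1, OF this] have "\<bar>\<Sum>x\<in>A. w x\<bar> \<le> K1 * \<Delta>" by simp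
    moreover have "(\<Sum>i<n. w (p i)) = (\<Sum>x\<in>A. w x)" using p by (rule sum.reindex_bij_betw)
    ultimately show ?thesis by simp
  qed
  have flow: "\<bar>\<Sum>i\<le>r. w (p i)\<bar> \<le> 1"
      "\<bar>\<Sum>i\<le>r. w (p i)\<bar> \<le> K1 * \<Delta> * (\<Sum>m<n. (2 / (?\<phi> (p (Suc r)) - ?\<phi> (p r))) ^ m)" if r: "Suc r < n" for r
  proof -
    define \<theta> where "\<theta> = ?\<phi> (p r)"
    define g where "g = ?\<phi> (p (Suc r)) - ?\<phi> (p r)"
    have g: "g > 0" using mono[of r "Suc r"] r by (simp add: g_def)
    have split: "?\<phi> (p i) \<le> \<theta> \<longleftrightarrow> i \<le> r" "i \<le> r \<or> \<theta> + g \<le> ?\<phi> (p i)" if "i < n" for i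
    proof -
      have "?\<phi> (p i) \<le> \<theta>" if "i \<le> r" using mono[of i r] that r by (cases "i = r") (auto simp: \<theta>_def)
      moreover have "\<theta> + g \<le> ?\<phi> (p i)" if "\<not> i \<le> r"
        using mono[of "Suc r" i] that \<open>i < n\<close> by (cases "i = Suc r") (auto simp: \<theta>_def g_def)
      ultimately show "?\<phi> (p i) \<le> \<theta> \<longleftrightarrow> i \<le> r" "i \<le> r \<or> \<theta> + g \<le> ?\<phi> (p i)" using g by force+
    qed
    have gap: "?\<phi> x \<le> \<theta> \<or> \<theta> + g \<le> ?\<phi> x" if "x \<in> A" for x
    proof -
      obtain i where "i < n" "x = p i" using p \<open>x \<in> A\<close> by (auto simp: bij_betw_def)
      then show ?thesis using split by blast
    qed
    have "bij_betw p {..r} {x\<in>A. ?\<phi> x \<le> \<theta>}"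
      unfolding bij_betw_def
    proof
      show "inj_on p {..r}" by (rule inj_on_subset[of p "{..<n}"]) (use p r in \<open>auto simp: bij_betw_def\<close>)
      have "A = p ` {..<n}" using p by (simp add: bij_betw_def)
      then show "p ` {..r} = {x\<in>A. ?\<phi> x \<le> \<theta>}" using split(1) r by (auto simp: image_iff)
    qed
    then have eq: "(\<Sum>i\<le>r. w (p i)) = (\<Sum>x\<in>{x\<in>A. ?\<phi> x \<le> \<theta>}. w x)" by (rule sum.reindex_bij_betw)
    show "\<bar>\<Sum>i\<le>r. w (p i)\<bar> \<le> 1" unfolding eq by (rule le1) (use finA in simp)
    have "\<bar>\<Sum>x\<in>{x\<in>cl s. ?\<phi> x \<le> \<theta>}. w x\<bar> \<le> K * \<Delta> * (\<Sum>m<n. (2 / g) ^ m)" if s: "s \<in> S" "cl s \<subseteq> V" for s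
    proof -
      let ?N = "card (cl s)"
      have clA: "cl s \<subseteq> A" using fincl[OF s(1)] s(2) by (simp add: A_def)
      obtain h where h: "bij_betw h {..<?N} (cl s)"
        and hmono: "\<And>i j. i < j \<Longrightarrow> j < ?N \<Longrightarrow> ?\<phi> (h i) < ?\<phi> (h j)"
        using sorted_enumeration[of "cl s" ?\<phi>] fincl[OF s(1)] inj_on_subset[OF inj, of "cl s"] by blast
      have "\<bar>\<Sum>i | i < ?N \<and> ?\<phi> (h i) \<le> \<theta>. w (h i)\<bar> \<le> K * \<Delta> * (\<Sum>m<?N. (2 / g) ^ m)"
      proof (rule mass_below_gap_le_newton_moments[where y = "\<lambda>i. ?\<phi> (h i)"])
        show "?\<phi> (h i) \<le> \<theta> \<or> \<theta> + g \<le> ?\<phi> (h i)" if "i < ?N" for i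
          using gap h clA that by (auto simp: bij_betw_def)
        show "\<bar>\<Sum>i<?N. w (h i) * (\<Prod>l<m. ?\<phi> (h i) - ?\<phi> (h l))\<bar> \<le> K * \<Delta>" if "m < ?N" for m
          using moments[OF s(1) h that] by (simp add: inner_diff_left)
      qed (use hmono g in auto)
      also have "(\<Sum>i | i < ?N \<and> ?\<phi> (h i) \<le> \<theta>. w (h i)) = (\<Sum>x\<in>{x\<in>cl s. ?\<phi> x \<le> \<theta>}. w x)"
      proof (rule sum.reindex_bij_betw)
        show "bij_betw h {i. i < ?N \<and> ?\<phi> (h i) \<le> \<theta>} {x\<in>cl s. ?\<phi> x \<le> \<theta>}"
          using h by (auto simp: bij_betw_def inj_on_def image_iff)
      qed
      also have "K * \<Delta> * (\<Sum>m<?N. (2 / g) ^ m) \<le> K * \<Delta> * (\<Sum>m<n. (2 / g) ^ m)"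
      proof (intro mult_left_mono sum_mono2)
        show "{..<?N} \<subseteq> {..<n}" using card_mono[OF finA clA] by (auto simp: n_def)
      qed (use g K \<Delta> in auto)
      finally show ?thesis .
    qed
    moreover have "0 \<le> (\<Sum>m<n. (2 / g) ^ m)" using g by (intro sum_nonneg) auto
    ultimately show "\<bar>\<Sum>i\<le>r. w (p i)\<bar> \<le> K1 * \<Delta> * (\<Sum>m<n. (2 / (?\<phi> (p (Suc r)) - ?\<phi> (p r))) ^ m)"
      unfolding eq g_def[symmetric] by (rule sum_le)
  qed
  have sub: "(atoms G \<union> atoms G') \<inter> V \<subseteq> A" "A \<subseteq> V" by (auto simp: A_def P_def)
  have P0: "0 \<le> ?POT"
    and Ple: "?POT \<le> \<bar>\<Sum>i<n. w (p i)\<bar> + (\<Sum>r<n - 1. \<bar>\<Sum>i\<le>r. w (p i)\<bar> * dist (p r) (p (Suc r)))"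
    using POT_restrict_le_path[OF G(1,2) V p sub] by (simp_all add: w_def)
  have K3: "1 + K1 \<le> K3" "1 \<le> K3" using K1 R(1) v(2) unfolding K3_def by auto
  define r where "r = max (card (atoms G \<inter> V) + card (atoms G' \<inter> V) - 1) 1"
  have r: "1 \<le> r" "n - 1 \<le> r" "r \<le> 2 * k" using n_le cardV \<open>1 \<le> k\<close> by (auto simp: r_def)
  have "?POT ^ r \<le> K3 ^ (2 * k) * \<Delta>"
  proof (cases "2 \<le> n")
    case False
    then have "n - 1 = 0" by simp
    then have "?POT \<le> K1 * \<Delta>" using Ple total by simp
    also have "\<dots> \<le> K3 * \<Delta>" using K3 \<Delta> by (intro mult_right_mono) auto
    finally have "?POT ^ r \<le> (K3 * \<Delta>) ^ r" using P0 by (intro power_mono)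
    also have "\<dots> \<le> K3 ^ (2 * k) * \<Delta> ^ 1"
      unfolding power_mult_distrib using K3 \<Delta> r by (intro mult_mono power_increasing power_decreasing) auto
    finally show ?thesis by simp
  next
    case True
    define h where "h = root (n - 1) \<Delta>"
    have h: "0 \<le> h" "h \<le> 1" "h ^ (n - 1) = \<Delta>"
      using True \<Delta> by (auto simp: h_def real_root_ge_zero real_root_pow_pos2)
    have \<Delta>h: "\<Delta> \<le> h"
    proof -
      have "h ^ (n - 1) \<le> h ^ 1" using True h by (intro power_decreasing) auto
      then show ?thesis unfolding h(3) by simp
    qed
    let ?K2 = "1 + K1 * (R + 2 * real k * 2 ^ (2 * k))"
    have step: "\<bar>\<Sum>i\<le>r. w (p i)\<bar> * dist (p r) (p (Suc r)) \<le> ?K2 / \<kappa> * h" if "r < n - 1" for r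
    proof -
      have r: "Suc r < n" using that by simp
      let ?g = "?\<phi> (p (Suc r)) - ?\<phi> (p r)"
      have g: "0 < ?g" using mono[of r "Suc r"] r by simp
      have inP: "p r \<in> P" "p (Suc r) \<in> P" using pP r by auto
      have "?g = (p (Suc r) - p r) \<bullet> v" by (simp add: inner_diff_left)
      also have "\<dots> \<le> norm (p (Suc r) - p r) * norm v" by (rule norm_cauchy_schwarz)
      also have "\<dots> \<le> R * 1" using v(1) R inP by (intro mult_mono) auto
      finally have gR: "?g \<le> R" by simp
      have "?g * \<bar>\<Sum>i\<le>r. w (p i)\<bar> \<le> (1 + K1 * (R + real n * 2 ^ n)) * h"
        using True g gR h K1 flow[OF r] by (intro gap_flow_bound) auto
      also have "\<dots> \<le> ?K2 * h"
        using K1 h R n2k by (intro mult_right_mono add_left_mono mult_left_mono mult_mono power_increasing) auto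
      finally have "?g * \<bar>\<Sum>i\<le>r. w (p i)\<bar> \<le> ?K2 * h" .
      moreover have "\<kappa> * dist (p r) (p (Suc r)) \<le> ?g"
        using v(3)[OF inP(2,1)] g by (simp add: dist_norm norm_minus_commute inner_diff_left)
      then have "\<kappa> * dist (p r) (p (Suc r)) * \<bar>\<Sum>i\<le>r. w (p i)\<bar> \<le> ?g * \<bar>\<Sum>i\<le>r. w (p i)\<bar>"
        by (intro mult_right_mono) auto
      ultimately have "\<kappa> * (\<bar>\<Sum>i\<le>r. w (p i)\<bar> * dist (p r) (p (Suc r))) \<le> ?K2 * h"
        by (simp add: mult_ac)
      then show ?thesis using v(2) by (simp add: field_simps)
    qed
    have "?POT \<le> K1 * h + (\<Sum>r<n - 1. ?K2 / \<kappa> * h)"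
      using Ple total \<Delta>h K1 step
      by (intro order.trans[OF Ple] add_mono sum_mono) (auto intro: order.trans mult_left_mono)
    also have "\<dots> \<le> K1 * h + 2 * real k * (?K2 / \<kappa> * h)"
    proof -
      have "0 \<le> ?K2 / \<kappa> * h" using K1 R h v(2) by (intro mult_nonneg_nonneg divide_nonneg_pos add_nonneg_nonneg) auto
      moreover have "real (n - 1) \<le> 2 * real k" using n2k by simp
      ultimately show ?thesis
        unfolding sum_constant card_lessThan by (intro add_left_mono mult_right_mono)
    qed
    also have "\<dots> \<le> K3 * h" using h by (simp add: K3_def algebra_simps)
    finally have "?POT ^ r \<le> (K3 * h) ^ r" using P0 by (intro power_mono)
    also have "\<dots> \<le> K3 ^ (2 * k) * h ^ (n - 1)"
      unfolding power_mult_distrib using K3 h r by (intro mult_mono power_increasing power_decreasing) auto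
    finally show ?thesis unfolding h(3) .
  qed
  then show ?thesis by (simp add: r_def)
qed

section \<open>The Voronoi loss is dominated by the Kolmogorov distance\<close>

lemma density_family_integrable:
  assumes "density_family f \<Gamma>" "\<gamma> \<in> \<Gamma>"
  shows "integrable lborel (\<lambda>x. f x \<gamma>)" "(\<integral>x. f x \<gamma> \<partial>lborel) = 1" "0 \<le> f x \<gamma>"
    "(\<lambda>x. f x \<gamma>) \<in> borel_measurable borel"
proof -
  have meas: "(\<lambda>x. f x \<gamma>) \<in> borel_measurable borel" and nn: "\<And>x. 0 \<le> f x \<gamma>"
    and int: "(\<integral>\<^sup>+x. ennreal (f x \<gamma>) \<partial>lborel) = 1"
    using assms by (auto simp: density_family_def)
  show "integrable lborel (\<lambda>x. f x \<gamma>)"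
    by (rule integrableI_nonneg) (use meas nn int in auto)
  show "(\<integral>x. f x \<gamma> \<partial>lborel) = 1"
    by (subst integral_eq_nn_integral) (use meas nn int in auto)
qed (use assms in \<open>auto simp: density_family_def\<close>)

definition lower_orthant :: "real^'b \<Rightarrow> (real^'b) set" where
  "lower_orthant x = {t. \<forall>i. t $ i < x $ i}"

lemma lower_orthant_borel: "lower_orthant x \<in> sets borel"
proof -
  have "lower_orthant x = (\<Inter>i. {t. t $ i < x $ i})" by (auto simp: lower_orthant_def)
  also have "open \<dots>" by (intro open_INT finite ballI open_Collect_less continuous_intros)
  finally show ?thesis by (rule borel_open)
qed

lemma mcdf_bounds:
  fixes f :: "real^'b \<Rightarrow> real^'d \<Rightarrow> real"
  assumes "density_family f \<Gamma>" "\<gamma> \<in> \<Gamma>"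
  shows "0 \<le> mcdf f x \<gamma>" "mcdf f x \<gamma> \<le> 1"
proof -
  note f = density_family_integrable[OF assms]
  show "0 \<le> mcdf f x \<gamma>"
    unfolding mcdf_def set_lebesgue_integral_def by (intro integral_nonneg_AE) (simp add: f(3))
  have "mcdf f x \<gamma> \<le> (\<integral>x. f x \<gamma> \<partial>lborel)"
    unfolding mcdf_def set_lebesgue_integral_def lower_orthant_def[symmetric]
    using lower_orthant_borel f
    by (intro integral_mono integrable_mult_indicator) (auto simp: indicator_def)
  then show "mcdf f x \<gamma> \<le> 1" by (simp add: f)
qed

definition mix_cdf :: "(real^'b \<Rightarrow> real^'d \<Rightarrow> real) \<Rightarrow> (real^'d) measure \<Rightarrow> real^'b \<Rightarrow> real" where
  "mix_cdf f G x = (\<Sum>\<gamma>\<in>atoms G. measure G {\<gamma>} * mcdf f x \<gamma>)"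

definition kolmogorov_dist ::
    "(real^'b \<Rightarrow> real^'d \<Rightarrow> real) \<Rightarrow> (real^'d) measure \<Rightarrow> (real^'d) measure \<Rightarrow> real" where
  "kolmogorov_dist f G G' = (SUP x. \<bar>mix_cdf f G x - mix_cdf f G' x\<bar>)"

lemma mixing_leD:
  fixes G :: "'a::metric_space measure"
  assumes "G \<in> mixing_le k \<Gamma>"
  shows "finite_discrete G" "prob_space G" "atoms G \<subseteq> \<Gamma>" "finite (atoms G)" "atoms G \<noteq> {}"
    "card (atoms G) \<le> k" "(\<Sum>\<gamma>\<in>atoms G. measure G {\<gamma>}) = 1"
proof -
  show G: "finite_discrete G" "prob_space G" "atoms G \<subseteq> \<Gamma>" "finite (atoms G)" "atoms G \<noteq> {}" "card (atoms G) \<le> k"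
    using assms by (auto simp: mixing_le_def finite_discrete_def)
  show "(\<Sum>\<gamma>\<in>atoms G. measure G {\<gamma>}) = 1"
    using finite_discrete_mass[OF G(1)] prob_space.prob_space[OF G(2)] by (simp add: mass_def)
qed

lemma mix_cdf_bounds:
  assumes "density_family f \<Gamma>" "G \<in> mixing_le k \<Gamma>"
  shows "0 \<le> mix_cdf f G x" "mix_cdf f G x \<le> 1"
proof -
  note G = mixing_leD[OF assms(2)]
  have b: "0 \<le> mcdf f x \<gamma>" "mcdf f x \<gamma> \<le> 1" if "\<gamma> \<in> atoms G" for \<gamma>
    using mcdf_bounds[OF assms(1)] G(3) that by auto
  show "0 \<le> mix_cdf f G x" unfolding mix_cdf_def using b by (intro sum_nonneg) auto
  have "mix_cdf f G x \<le> (\<Sum>\<gamma>\<in>atoms G. measure G {\<gamma>} * 1)"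
    unfolding mix_cdf_def using b by (intro sum_mono mult_left_mono) auto
  then show "mix_cdf f G x \<le> 1" using G(7) by simp
qed

lemma kolmogorov_dist_bounds:
  assumes "density_family f \<Gamma>" "G \<in> mixing_le k \<Gamma>" "G' \<in> mixing_le k \<Gamma>"
  shows "\<bar>mix_cdf f G x - mix_cdf f G' x\<bar> \<le> kolmogorov_dist f G G'"
    "0 \<le> kolmogorov_dist f G G'" "kolmogorov_dist f G G' \<le> 1"
proof -
  have le1: "\<bar>mix_cdf f G x - mix_cdf f G' x\<bar> \<le> 1" for x
    using mix_cdf_bounds[OF assms(1,2), of x] mix_cdf_bounds[OF assms(1,3), of x] by linarith
  then have "bdd_above (range (\<lambda>x. \<bar>mix_cdf f G x - mix_cdf f G' x\<bar>))" by (intro bdd_aboveI2)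
  then show *: "\<bar>mix_cdf f G x - mix_cdf f G' x\<bar> \<le> kolmogorov_dist f G G'" for x
    unfolding kolmogorov_dist_def by (intro cSUP_upper) auto
  show "0 \<le> kolmogorov_dist f G G'" using *[of 0] by linarith
  show "kolmogorov_dist f G G' \<le> 1" unfolding kolmogorov_dist_def using le1 by (intro cSUP_least) auto
qed

lemma voronoi_ext_borel:
  assumes "compact \<Gamma>"
  shows "voronoi_ext \<Gamma> k H \<delta> \<gamma>0 j \<in> sets borel"
proof -
  let ?W = "voronoi_cell \<Gamma> H \<gamma>0"
  have "voronoi_ext \<Gamma> k H \<delta> \<gamma>0 j = \<Gamma> \<inter> {\<gamma>. infdist \<gamma> ?W < real j * \<delta> / (2 * real k)}"
    by (auto simp: voronoi_ext_def)
  moreover have "open {\<gamma>. infdist \<gamma> ?W < real j * \<delta> / (2 * real k)}"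
    by (intro open_Collect_less continuous_intros)
  moreover have "\<Gamma> \<in> sets borel" using assms by (intro borel_closed compact_imp_closed)
  ultimately show ?thesis by (simp only: sets.Int borel_open)
qed

text \<open>The levels \<open>c, 2c, \<dots>, mc\<close> are so far apart that each point of \<open>S\<close> is close to at most one of
  them.\<close>
lemma level_avoiding_clusters:
  fixes d :: "'a::metric_space \<Rightarrow> real"
  assumes "finite S" "card S < m" "\<epsilon> \<le> c / 2"
  obtains j where "j \<in> {1..m}" "\<And>s. s \<in> S \<Longrightarrow> \<epsilon> \<le> \<bar>d s - real j * c\<bar>"
proof (rule ccontr)
  note found = that
  assume "\<not> thesis"
  then have "\<exists>s\<in>S. \<bar>d s - real j * c\<bar> < \<epsilon>" if "j \<in> {1..m}" for j
    using that found[of j] by (meson not_le)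
  then obtain \<sigma> where \<sigma>: "\<And>j. j \<in> {1..m} \<Longrightarrow> \<sigma> j \<in> S \<and> \<bar>d (\<sigma> j) - real j * c\<bar> < \<epsilon>" by metis
  have "inj_on \<sigma> {1..m}"
  proof (rule inj_onI)
    fix i j assume ij: "i \<in> {1..m}" "j \<in> {1..m}" "\<sigma> i = \<sigma> j"
    have c: "c > 0" using \<sigma>[OF ij(1)] assms(3) by linarith
    have "\<bar>real i * c - real j * c\<bar> < c" 
    proof -
      have "\<bar>d (\<sigma> i) - real i * c\<bar> < \<epsilon>" "\<bar>d (\<sigma> i) - real j * c\<bar> < \<epsilon>"
        using \<sigma>[OF ij(1)] \<sigma>[OF ij(2)] unfolding ij(3) by blast+
      then show ?thesis using assms(3) by linarith
    qed
    then have "\<bar>real i - real j\<bar> * c < 1 * c" using c by (simp add: left_diff_distrib[symmetric] abs_mult)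
    then have "\<bar>real i - real j\<bar> < 1" using c by (simp only: mult_less_cancel_right)
    then show "i = j" by linarith
  qed
  then have "card {1..m} \<le> card S" using \<sigma> assms(1) by (intro card_inj_on_le[of \<sigma>]) auto
  then show False using assms(2) by simp
qed

text \<open>All constants depend only on the limit configuration \<open>l\<close>. For each reference atom a level is
  chosen whose cell contains every cluster entirely or not at all: by
  \<open>level_avoiding_clusters\<close> if \<open>l\<close> takes fewer than \<open>2k\<close> values, and trivially otherwise, because then
  every cluster has at most one atom.\<close>
lemma VPOT_le_kolmogorov_near_configuration:
  fixes f :: "real^'b \<Rightarrow> real^'d \<Rightarrow> real" and l :: "nat \<Rightarrow> real^'d"
  assumes "compact \<Gamma>" "density_family f \<Gamma>" "assumption_C (2 * k) f \<Gamma>" "1 \<le> k" "\<delta> > 0"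
    and l: "\<And>i. i < 2 * k \<Longrightarrow> l i \<in> \<Gamma>"
  shows "\<exists>\<epsilon>>0. \<exists>C\<ge>0. \<forall>G\<in>mixing_le k \<Gamma>. \<forall>G'\<in>mixing_le k \<Gamma>. \<forall>H\<in>mixing_le k \<Gamma>. \<forall>g.
    g ` {..<2 * k} = atoms G \<union> atoms G' \<longrightarrow> (\<forall>i<2 * k. dist (l i) (g i) < \<epsilon>) \<longrightarrow>
    VPOT \<Gamma> k H \<delta> G G' \<le> C * kolmogorov_dist f G G'"
proof -
  define S where "S = l ` {..<2 * k}"
  have S: "finite S" "S \<subseteq> \<Gamma>" using l by (auto simp: S_def)
  obtain \<epsilon>0 K where \<epsilon>0: "\<epsilon>0 > 0" and K: "K > 0"
    and disj: "\<forall>s\<in>S. \<forall>s'\<in>S. s \<noteq> s' \<longrightarrow> ball s \<epsilon>0 \<inter> ball s' \<epsilon>0 = {}"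
    and moments: "\<forall>N \<gamma> w B. (\<forall>s\<in>S. N s \<le> 2 * k \<and> (\<forall>i<N s. \<gamma> s i \<in> ball s \<epsilon>0 \<inter> \<Gamma>)) \<longrightarrow>
       (\<forall>x. \<bar>\<Sum>s\<in>S. \<Sum>i<N s. w s i * mcdf f x (\<gamma> s i)\<bar> \<le> B) \<longrightarrow>
       (\<forall>s\<in>S. \<forall>m<N s. \<forall>z. norm z \<le> 1 \<longrightarrow>
          \<bar>\<Sum>i<N s. w s i * (\<Prod>l<m. (\<gamma> s i - \<gamma> s l) \<bullet> z)\<bar> \<le> K * B)"
    using newton_moments_le_cdf_distance[OF assms(3) S] by (elim exE conjE) (rule that)
  define \<epsilon> where "\<epsilon> = min \<epsilon>0 (\<delta> / (2 * real k) / 2)"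
  have \<epsilon>: "\<epsilon> > 0" "\<epsilon> \<le> \<epsilon>0" "\<epsilon> \<le> \<delta> / (2 * real k) / 2" using \<epsilon>0 assms by (auto simp: \<epsilon>_def)
  define \<kappa> :: real where "\<kappa> = (1 / 4) ^ (4 * k * k)"
  have \<kappa>: "\<kappa> > 0" by (simp add: \<kappa>_def)
  define R where "R = diameter \<Gamma>"
  have R: "norm (x - y) \<le> R" if "x \<in> \<Gamma>" "y \<in> \<Gamma>" for x y
    using diameter_bounded_bound[OF compact_imp_bounded[OF assms(1)] that] by (simp add: R_def dist_norm)
  have R0: "R \<ge> 0" unfolding R_def by (intro diameter_ge_0 compact_imp_bounded assms)
  define K1 where "K1 = real (card S) * K"
  define K3 where "K3 = 1 + K1 + 2 * real k * ((1 + K1 * (R + 2 * real k * 2 ^ (2 * k))) / \<kappa>)"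
  have K3: "K3 \<ge> 0" unfolding K3_def K1_def using K R0 \<kappa> by auto
  define C where "C = real k * K3 ^ (2 * k)"
  have C: "C \<ge> 0" using K3 by (simp add: C_def)
  have "VPOT \<Gamma> k H \<delta> G G' \<le> C * kolmogorov_dist f G G'"
    if G: "G \<in> mixing_le k \<Gamma>" and G': "G' \<in> mixing_le k \<Gamma>" and H: "H \<in> mixing_le k \<Gamma>"
      and g: "g ` {..<2 * k} = atoms G \<union> atoms G'" and near: "\<And>i. i < 2 * k \<Longrightarrow> dist (l i) (g i) < \<epsilon>" for G G' H g
  proof -
    note gG = mixing_leD[OF G] and gG' = mixing_leD[OF G']
    define P where "P = atoms G \<union> atoms G'"
    define \<Delta> where "\<Delta> = kolmogorov_dist f G G'"
    note kd = kolmogorov_dist_bounds[OF assms(2) G G', folded \<Delta>_def]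
    define w where "w x = measure G {x} - measure G' {x}" for x
    define cl where "cl s = P \<inter> ball s \<epsilon>" for s
    have P: "finite P" "P \<subseteq> \<Gamma>" using gG gG' by (auto simp: P_def)
    have cardP: "card P \<le> 2 * k"
      unfolding P_def using card_Un_le[of "atoms G" "atoms G'"] gG(6) gG'(6) by simp
    have cl_disj: "cl s \<inter> cl s' = {}" if "s \<in> S" "s' \<in> S" "s \<noteq> s'" for s s'
    proof -
      have "ball s \<epsilon>0 \<inter> ball s' \<epsilon>0 = {}" using disj that by blast
      moreover have "cl s \<subseteq> ball s \<epsilon>0" "cl s' \<subseteq> ball s' \<epsilon>0" using \<epsilon>(2) by (auto simp: cl_def)
      ultimately show ?thesis by blast
    qed
    have cl_UN: "P = (\<Union>s\<in>S. cl s)"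
    proof
      show "P \<subseteq> (\<Union>s\<in>S. cl s)"
      proof
        fix x assume x: "x \<in> P"
        then obtain i where i: "i < 2 * k" "x = g i" using g unfolding P_def by auto
        then have "x \<in> cl (l i)" using x near by (simp add: cl_def)
        then show "x \<in> (\<Union>s\<in>S. cl s)" using i by (auto simp: S_def)
      qed
    qed (auto simp: cl_def)
    \<comment> \<open>A direction that separates all pairs of atoms, with the constant \<open>\<kappa>\<close>.\<close>
    define U where "U = (\<lambda>(x, y). x - y) ` (P \<times> P)"
    have U: "finite U" using P by (simp add: U_def)
    have "card U \<le> card (P \<times> P)" unfolding U_def using P by (intro card_image_le) auto
    also have "\<dots> \<le> (2 * k) * (2 * k)" unfolding card_cartesian_product using cardP by (intro mult_mono) auto
    finally have cardU: "card U \<le> 4 * k * k" by simp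
    obtain v where v: "norm v \<le> 1 - (1 / 4) ^ card U" "\<And>u. u \<in> U \<Longrightarrow> (1 / 4) ^ card U * norm u \<le> \<bar>u \<bullet> v\<bar>"
      using transversal_direction[OF U] by blast
    have v1: "norm v \<le> 1" using v(1) by (smt (verit) zero_le_power divide_nonneg_nonneg)
    have v\<kappa>: "\<kappa> * norm (x - y) \<le> \<bar>(x - y) \<bullet> v\<bar>" if "x \<in> P" "y \<in> P" for x y
    proof -
      have "\<kappa> \<le> (1 / 4) ^ card U" unfolding \<kappa>_def using cardU by (intro power_decreasing) auto
      then have "\<kappa> * norm (x - y) \<le> (1 / 4) ^ card U * norm (x - y)" by (intro mult_right_mono) auto
      also have "\<dots> \<le> \<bar>(x - y) \<bullet> v\<bar>" using that by (intro v(2)) (auto simp: U_def)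
      finally show ?thesis .
    qed
    have cdf_eq: "mix_cdf f G x - mix_cdf f G' x = (\<Sum>y\<in>P. w y * mcdf f x y)" for x
    proof -
      have "mix_cdf f M x = (\<Sum>y\<in>P. measure M {y} * mcdf f x y)" if "atoms M \<subseteq> P" for M
        unfolding mix_cdf_def using that P
        by (intro sum.mono_neutral_left) (auto simp: atoms_def zero_less_measure_iff)
      then show ?thesis by (simp add: P_def w_def left_diff_distrib sum_subtractf)
    qed
    have clP: "finite (cl s)" "cl s \<subseteq> P" for s using P by (auto simp: cl_def)
    have cl_moments: "\<bar>\<Sum>i<card (cl s). w (h i) * (\<Prod>l<m. (h i - h l) \<bullet> v)\<bar> \<le> K * \<Delta>"
      if s: "s \<in> S" and h: "bij_betw h {..<card (cl s)} (cl s)" and m: "m < card (cl s)" for s h m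
    proof -
      have "\<exists>h. bij_betw h {..<card (cl s)} (cl s)" for s
        using ex_bij_betw_nat_finite[OF clP(1)] by (auto simp: atLeast0LessThan)
      then obtain h0 where h0: "\<And>s. bij_betw (h0 s) {..<card (cl s)} (cl s)" by metis
      define hh where "hh = h0(s := h)"
      have hh: "bij_betw (hh s) {..<card (cl s)} (cl s)" for s using h h0 by (auto simp: hh_def)
      have c2k: "card (cl s) \<le> 2 * k" for s using card_mono[OF P(1) clP(2)] cardP by (rule le_trans)
      have hh_in: "hh s i \<in> ball s \<epsilon>0 \<inter> \<Gamma>" if "i < card (cl s)" for s i
      proof -
        have "hh s i \<in> cl s" using hh that by (auto simp: bij_betw_def)
        then show ?thesis using P \<epsilon> by (auto simp: cl_def)
      qed
      have diff: "\<bar>\<Sum>s\<in>S. \<Sum>i<card (cl s). w (hh s i) * mcdf f x (hh s i)\<bar> \<le> \<Delta>" for x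
      proof -
        have "(\<Sum>i<card (cl s). w (hh s i) * mcdf f x (hh s i)) = (\<Sum>y\<in>cl s. w y * mcdf f x y)" for s
          using hh[of s] by (rule sum.reindex_bij_betw)
        then have "(\<Sum>s\<in>S. \<Sum>i<card (cl s). w (hh s i) * mcdf f x (hh s i)) = (\<Sum>s\<in>S. \<Sum>y\<in>cl s. w y * mcdf f x y)"
          by simp
        also have "\<dots> = (\<Sum>y\<in>(\<Union>s\<in>S. cl s). w y * mcdf f x y)"
          using S(1) clP(1) cl_disj by (intro sum.UNION_disjoint[symmetric]) auto
        also have "\<dots> = mix_cdf f G x - mix_cdf f G' x" unfolding cdf_eq cl_UN[symmetric] ..
        finally show ?thesis using kd(1)[of x] by simp
      qed
      have "\<forall>s\<in>S. card (cl s) \<le> 2 * k \<and> (\<forall>i<card (cl s). hh s i \<in> ball s \<epsilon>0 \<inter> \<Gamma>)"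
        using c2k hh_in by simp
      from moments[THEN spec, of "\<lambda>s. card (cl s)", THEN spec, of hh, THEN spec, of "\<lambda>s i. w (hh s i)",
          THEN spec, of \<Delta>, THEN mp, OF this, THEN mp, OF allI[OF diff], THEN bspec, OF s] m v1
      have "\<bar>\<Sum>i<card (cl s). w (hh s i) * (\<Prod>l<m. (hh s i - hh s l) \<bullet> v)\<bar> \<le> K * \<Delta>"
        by simp
      then show ?thesis by (simp add: hh_def)
    qed
    have cell: "(MIN j\<in>{1..2 * k}.
        (let V = voronoi_ext \<Gamma> k H \<delta> \<gamma>0 j in
           POT 1 (restrict_measure G V) (restrict_measure G' V)
             ^ max (card (atoms G \<inter> V) + card (atoms G' \<inter> V) - 1) 1)) \<le> K3 ^ (2 * k) * \<Delta>" for \<gamma>0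
    proof -
      let ?W = "voronoi_cell \<Gamma> H \<gamma>0"
      obtain j where j: "j \<in> {1..2 * k}"
        and resp: "\<And>s. s \<in> S \<Longrightarrow> cl s \<subseteq> voronoi_ext \<Gamma> k H \<delta> \<gamma>0 j \<or> cl s \<inter> voronoi_ext \<Gamma> k H \<delta> \<gamma>0 j = {}"
      proof (cases "card S < 2 * k")
        case True
        obtain j where j: "j \<in> {1..2 * k}"
          and lev: "\<And>s. s \<in> S \<Longrightarrow> \<epsilon> \<le> \<bar>infdist s ?W - real j * (\<delta> / (2 * real k))\<bar>"
          using level_avoiding_clusters[OF S(1) True \<epsilon>(3), where d = "\<lambda>s. infdist s ?W"] by blast
        show thesis
        proof (rule that[OF j])
          fix s assume s: "s \<in> S"
          have inf: "\<bar>infdist x ?W - infdist s ?W\<bar> < \<epsilon>" "x \<in> \<Gamma>" if "x \<in> cl s" for x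
            using infdist_triangle_abs[of x ?W s] that P(2) by (auto simp: cl_def dist_commute)
          show "cl s \<subseteq> voronoi_ext \<Gamma> k H \<delta> \<gamma>0 j \<or> cl s \<inter> voronoi_ext \<Gamma> k H \<delta> \<gamma>0 j = {}"
          proof (cases "infdist s ?W \<le> real j * (\<delta> / (2 * real k))")
            case True
            have "x \<in> voronoi_ext \<Gamma> k H \<delta> \<gamma>0 j" if "x \<in> cl s" for x
            proof -
              have "infdist x ?W < real j * (\<delta> / (2 * real k))" using inf(1)[OF that] lev[OF s] True by linarith
              then show ?thesis using inf(2)[OF that] by (simp add: voronoi_ext_def)
            qed
            then show ?thesis by blast
          next
            case False
            have "x \<notin> voronoi_ext \<Gamma> k H \<delta> \<gamma>0 j" if "x \<in> cl s" for x
            proof -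
              have "\<not> infdist x ?W < real j * (\<delta> / (2 * real k))" using inf(1)[OF that] lev[OF s] False by linarith
              then show ?thesis by (simp add: voronoi_ext_def)
            qed
            then show ?thesis by blast
          qed
        qed
      next
        case False
        have "inj_on l {..<2 * k}"
          using False card_image_le[of "{..<2 * k}" l] by (intro eq_card_imp_inj_on) (auto simp: S_def)
        have "x = y" if s: "s \<in> S" and x: "x \<in> cl s" and y: "y \<in> cl s" for s x y
        proof -
          have "\<exists>i<2 * k. x = g i \<and> l i = s" if xcl: "x \<in> cl s" for x
          proof -
            obtain i where i: "i < 2 * k" "x = g i" using xcl g unfolding cl_def P_def by auto
            then have "x \<in> cl (l i)" using xcl near by (simp add: cl_def)
            moreover have "l i \<in> S" using i by (simp add: S_def)
            ultimately have "l i = s" using cl_disj[of "l i" s] s xcl by blast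
            then show ?thesis using i by blast
          qed
          from this[OF x] this[OF y] show ?thesis using \<open>inj_on l {..<2 * k}\<close>
            by (auto simp: inj_on_def)
        qed
        then show thesis using that[of 1] assms(4) by force
      qed
      let ?V = "voronoi_ext \<Gamma> k H \<delta> \<gamma>0 j"
      have "POT 1 (restrict_measure G ?V) (restrict_measure G' ?V) ^
        max (card (atoms G \<inter> ?V) + card (atoms G' \<inter> ?V) - 1) 1 \<le> K3 ^ (2 * k) * \<Delta>"
        unfolding K3_def K1_def
      proof (rule POT_cell_bound[where cl = cl and S = S and v = v])
        show "disjoint_family_on cl S" using cl_disj unfolding disjoint_family_on_def by blast
        show "\<bar>\<Sum>i<card (cl s). (measure G {h i} - measure G' {h i}) * (\<Prod>l<m. (h i - h l) \<bullet> v)\<bar> \<le> K * \<Delta>"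
          if "s \<in> S" "bij_betw h {..<card (cl s)} (cl s)" "m < card (cl s)" for s h m
          using cl_moments[OF that] by (simp add: w_def)
        show "?V \<in> sets borel" by (rule voronoi_ext_borel[OF assms(1)])
        show "norm (x - y) \<le> R" if "x \<in> atoms G \<union> atoms G'" "y \<in> atoms G \<union> atoms G'" for x y
          using that P(2) unfolding P_def by (intro R) auto
        show "atoms G \<union> atoms G' = (\<Union>s\<in>S. cl s)" using cl_UN by (simp add: P_def)
      qed (use gG gG' assms v1 \<kappa> v\<kappa> R0 S(1) K kd resp in \<open>simp_all add: P_def less_imp_le\<close>)
      moreover have "(MIN j\<in>{1..2 * k}. (let V = voronoi_ext \<Gamma> k H \<delta> \<gamma>0 j in
           POT 1 (restrict_measure G V) (restrict_measure G' V)
             ^ max (card (atoms G \<inter> V) + card (atoms G' \<inter> V) - 1) 1)) \<le>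
        (let V = ?V in POT 1 (restrict_measure G V) (restrict_measure G' V)
             ^ max (card (atoms G \<inter> V) + card (atoms G' \<inter> V) - 1) 1)"
        by (rule Min_le) (use j in auto)
      ultimately show ?thesis by (simp add: Let_def)
    qed
    have "VPOT \<Gamma> k H \<delta> G G' \<le> (\<Sum>\<gamma>0\<in>atoms H. K3 ^ (2 * k) * \<Delta>)"
      unfolding VPOT_def by (intro sum_mono cell)
    also have "\<dots> \<le> real k * (K3 ^ (2 * k) * \<Delta>)"
      using mixing_leD(6)[OF H] K3 kd(2) by (simp add: mult_right_mono)
    finally show ?thesis by (simp add: C_def \<Delta>_def mult.assoc)
  qed
  then show ?thesis using \<epsilon>(1) C by (intro exI[of _ \<epsilon>] conjI exI[of _ C] ballI allI impI) auto
qed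

lemma tuple_convergent_subsequence:
  fixes g :: "nat \<Rightarrow> nat \<Rightarrow> 'a::metric_space"
  assumes "compact \<Gamma>" "\<And>n i. i < m \<Longrightarrow> g n i \<in> \<Gamma>"
  shows "\<exists>l r. strict_mono r \<and> (\<forall>i<m. l i \<in> \<Gamma> \<and> (\<lambda>n. g (r n) i) \<longlonglongrightarrow> l i)"
  using assms(2)
proof (induction m)
  case 0
  then show ?case by (intro exI[of _ undefined] exI[of _ id]) (simp add: strict_mono_id)
next
  case (Suc m)
  then obtain l r where r: "strict_mono r" and l: "\<And>i. i < m \<Longrightarrow> l i \<in> \<Gamma> \<and> (\<lambda>n. g (r n) i) \<longlonglongrightarrow> l i"
    by (meson less_SucI)
  have "\<forall>n. g (r n) m \<in> \<Gamma>" using Suc.prems by simp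
  then obtain y r' where r': "y \<in> \<Gamma>" "strict_mono r'" "((\<lambda>n. g (r n) m) \<circ> r') \<longlonglongrightarrow> y"
    using assms(1) compact_imp_seq_compact seq_compactE by metis
  have "(\<lambda>n. g ((r \<circ> r') n) i) \<longlonglongrightarrow> (l(m := y)) i \<and> (l(m := y)) i \<in> \<Gamma>" if "i < Suc m" for i
  proof (cases "i = m")
    case False
    then have "i < m" using that by simp
    then show ?thesis using LIMSEQ_subseq_LIMSEQ[of "\<lambda>n. g (r n) i" "l i" r'] l r' by (simp add: o_def)
  qed (use r' in \<open>simp add: o_def\<close>)
  then show ?case using strict_mono_o[OF r r'(2)] by blast
qed

text \<open>A sequence of counterexamples would have a subsequence along which the \<open>2k\<close> atoms, repeated if
  necessary, converge to a limit configuration.\<close>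
lemma VPOT_le_kolmogorov:
  fixes f :: "real^'b \<Rightarrow> real^'d \<Rightarrow> real"
  assumes "compact \<Gamma>" "density_family f \<Gamma>" "assumption_C (2 * k) f \<Gamma>" "1 \<le> k" "\<delta> > 0"
  shows "\<exists>C>0. \<forall>G\<in>mixing_le k \<Gamma>. \<forall>G'\<in>mixing_le k \<Gamma>. \<forall>H\<in>mixing_le k \<Gamma>.
    VPOT \<Gamma> k H \<delta> G G' \<le> C * kolmogorov_dist f G G'"
proof (rule ccontr)
  assume neg: "\<not> ?thesis"
  have "\<exists>G G' H. G \<in> mixing_le k \<Gamma> \<and> G' \<in> mixing_le k \<Gamma> \<and> H \<in> mixing_le k \<Gamma> \<and>
    \<not> VPOT \<Gamma> k H \<delta> G G' \<le> (real n + 1) * kolmogorov_dist f G G'" for n :: nat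
  proof -
    have "(0::real) < real n + 1" by simp
    then show ?thesis using neg by blast
  qed
  then obtain G G' H where G: "\<And>n. G n \<in> mixing_le k \<Gamma>" and G': "\<And>n. G' n \<in> mixing_le k \<Gamma>"
    and H: "\<And>n. H n \<in> mixing_le k \<Gamma>"
    and large: "\<And>n. \<not> VPOT \<Gamma> k (H n) \<delta> (G n) (G' n) \<le> (real n + 1) * kolmogorov_dist f (G n) (G' n)"
    by metis
  have "\<exists>g. g ` {..<2 * k} = atoms (G n) \<union> atoms (G' n)" for n
  proof -
    let ?P = "atoms (G n) \<union> atoms (G' n)"
    have fin: "finite ?P" "?P \<noteq> {}" using mixing_leD[OF G] mixing_leD[OF G'] by auto
    have card: "card ?P \<le> 2 * k" "0 < card ?P"
      using card_Un_le[of "atoms (G n)" "atoms (G' n)"] mixing_leD(6)[OF G, of n] mixing_leD(6)[OF G', of n] fin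
      by (auto simp: card_gt_0_iff)
    obtain h where h: "bij_betw h {..<card ?P} ?P"
      using ex_bij_betw_nat_finite[OF fin(1)] by (auto simp: atLeast0LessThan)
    have "(\<lambda>i. if i < card ?P then h i else h 0) ` {..<2 * k} = h ` {..<card ?P}"
      using card by (auto simp: image_iff)
    moreover have "h ` {..<card ?P} = ?P" using h by (simp add: bij_betw_def)
    ultimately show ?thesis by (intro exI) (rule trans)
  qed
  then obtain g where g: "\<And>n. g n ` {..<2 * k} = atoms (G n) \<union> atoms (G' n)" by metis
  have "g n i \<in> \<Gamma>" if "i < 2 * k" for n i
  proof -
    have "g n i \<in> atoms (G n) \<union> atoms (G' n)" using g[of n] that by blast
    then show ?thesis using mixing_leD(3)[OF G, of n] mixing_leD(3)[OF G', of n] by blast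
  qed
  then obtain l r where r: "strict_mono r"
    and l: "\<And>i. i < 2 * k \<Longrightarrow> l i \<in> \<Gamma>" "\<And>i. i < 2 * k \<Longrightarrow> (\<lambda>n. g (r n) i) \<longlonglongrightarrow> l i"
    using tuple_convergent_subsequence[OF assms(1), of "2 * k" g] by blast
  have "\<exists>\<epsilon>>0. \<exists>C\<ge>0. \<forall>G\<in>mixing_le k \<Gamma>. \<forall>G'\<in>mixing_le k \<Gamma>. \<forall>H\<in>mixing_le k \<Gamma>. \<forall>g.
      g ` {..<2 * k} = atoms G \<union> atoms G' \<longrightarrow> (\<forall>i<2 * k. dist (l i) (g i) < \<epsilon>) \<longrightarrow>
      VPOT \<Gamma> k H \<delta> G G' \<le> C * kolmogorov_dist f G G'"
    by (rule VPOT_le_kolmogorov_near_configuration[OF assms]) (rule l(1))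
  then obtain \<epsilon> C where \<epsilon>: "\<epsilon> > 0" and C: "0 \<le> C"
    and bound: "\<forall>G\<in>mixing_le k \<Gamma>. \<forall>G'\<in>mixing_le k \<Gamma>. \<forall>H\<in>mixing_le k \<Gamma>. \<forall>g.
      g ` {..<2 * k} = atoms G \<union> atoms G' \<longrightarrow> (\<forall>i<2 * k. dist (l i) (g i) < \<epsilon>) \<longrightarrow>
      VPOT \<Gamma> k H \<delta> G G' \<le> C * kolmogorov_dist f G G'"
    by (elim exE conjE) (rule that)
  have "\<forall>\<^sub>F n in sequentially. \<forall>i\<in>{..<2 * k}. dist (g (r n) i) (l i) < \<epsilon>"
    using l(2) \<epsilon> by (intro eventually_ball_finite ballI tendstoD) auto
  moreover have "\<forall>\<^sub>F n in sequentially. C \<le> real n"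
    by (rule eventually_sequentiallyI[of "nat \<lceil>C\<rceil>"]) linarith
  ultimately have "\<forall>\<^sub>F n in sequentially. (\<forall>i\<in>{..<2 * k}. dist (g (r n) i) (l i) < \<epsilon>) \<and> C \<le> real n"
    by (rule eventually_conj)
  then obtain n where n: "\<And>i. i < 2 * k \<Longrightarrow> dist (g (r n) i) (l i) < \<epsilon>" "C \<le> real n"
    by (auto simp: eventually_sequentially)
  have "real n \<le> real (r n)" using seq_suble[OF r, of n] by simp
  then have "C * kolmogorov_dist f (G (r n)) (G' (r n)) \<le> (real (r n) + 1) * kolmogorov_dist f (G (r n)) (G' (r n))"
    using n(2) kolmogorov_dist_bounds(2)[OF assms(2) G G'] by (intro mult_right_mono) auto
  moreover have "VPOT \<Gamma> k (H (r n)) \<delta> (G (r n)) (G' (r n)) \<le> C * kolmogorov_dist f (G (r n)) (G' (r n))"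
    using bound[rule_format, OF G G' H g] n(1) by (simp add: dist_commute)
  ultimately show False using large[of "r n"] by linarith
qed

section \<open>Decay of the densities and Hellinger affinity\<close>

text \<open>The dominating function in the decay condition on the densities, up to the constant factor.\<close>
definition decay :: "real \<Rightarrow> 'a::real_normed_vector \<Rightarrow> real" where
  "decay a x = (if norm x \<le> 1 then 1 else norm x powr (- a))"

lemma decay_pos: "0 < decay a x"
  by (auto simp: decay_def)

lemma decay_borel [measurable]: "decay a \<in> borel_measurable (borel :: 'a::euclidean_space measure)"
  unfolding decay_def by measurable

lemma decay_powr: "decay a x powr t = decay (a * t) x"
  by (simp add: decay_def powr_powr)

lemma decay_antimono: "a \<le> b \<Longrightarrow> decay b x \<le> decay a x"
  by (auto simp: decay_def intro!: powr_mono)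

lemma decay_eq:
  assumes "0 \<le> a"
  shows "(if x = 0 then 1 else min 1 (norm x powr (- a))) = decay a x"
proof (cases "norm x \<le> 1")
  case True
  have "1 \<le> norm x powr (- a)" if "x \<noteq> 0"
  proof -
    have "norm x powr a \<le> 1" using True assms by (intro powr_le1) auto
    moreover have "0 < norm x powr a" using that by simp
    ultimately show ?thesis by (simp add: powr_minus one_le_inverse)
  qed
  then show ?thesis using True by (auto simp: decay_def)
next
  case False
  then have "norm x powr (- a) \<le> norm x powr 0" using assms by (intro powr_mono) auto
  then show ?thesis using False by (auto simp: decay_def)
qed

lemma nn_integral_decay_real_finite:
  assumes "1 < s"
  shows "(\<integral>\<^sup>+t. ennreal (decay s (t::real)) \<partial>lborel) < \<infinity>"
proof -
  define h where "h t = ennreal (t powr (- s)) * indicator {1..} t" for t :: real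
  have [measurable]: "h \<in> borel_measurable borel" unfolding h_def by measurable
  have "(\<integral>\<^sup>+t. h t \<partial>lborel) = ennreal (0 - (1 powr (1 - s) / (1 - s)))"
    unfolding h_def
  proof (rule nn_integral_FTC_atLeast[where F = "\<lambda>t. t powr (1 - s) / (1 - s)" and f = "\<lambda>t. t powr (- s)"])
    show "((\<lambda>t. t powr (1 - s) / (1 - s)) has_real_derivative t powr (- s)) (at t)" if "1 \<le> t" for t
      using DERIV_cdivide[OF has_real_derivative_powr[of t "1 - s"], of "1 - s"] that assms by simp
    have "((\<lambda>t::real. t powr (1 - s)) \<longlongrightarrow> 0) at_top"
      by (rule tendsto_neg_powr) (use assms in \<open>auto intro: filterlim_ident\<close>)
    then show "((\<lambda>t. t powr (1 - s) / (1 - s)) \<longlongrightarrow> 0) at_top"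
      using tendsto_divide[of "\<lambda>t. t powr (1 - s)" 0 at_top "\<lambda>_. 1 - s" "1 - s"] assms by simp
  qed auto
  then have h: "(\<integral>\<^sup>+t. h t \<partial>lborel) < \<infinity>" by simp
  have h': "(\<integral>\<^sup>+t. h (- t) \<partial>lborel) < \<infinity>"
    using nn_integral_real_affine[of h "-1" 0] h by simp
  have "(\<integral>\<^sup>+t. ennreal (decay s (t::real)) \<partial>lborel) \<le> (\<integral>\<^sup>+t. indicator {-1..1::real} t + (h t + h (- t)) \<partial>lborel)"
    by (intro nn_integral_mono) (auto simp: decay_def h_def indicator_def abs_if)
  also have "\<dots> = 2 + ((\<integral>\<^sup>+t. h t \<partial>lborel) + (\<integral>\<^sup>+t. h (- t) \<partial>lborel))"
    by (simp add: nn_integral_add)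
  also have "\<dots> < \<infinity>" using h h' by (simp add: ennreal_add_less_top)
  finally show ?thesis .
qed

text \<open>The norm dominates each coordinate, so that the function is at most a product of functions of one
  variable with exponent \<open>a / DIM('a) > 1\<close>.\<close>
lemma nn_integral_decay_finite:
  assumes "real DIM('a) < a"
  shows "(\<integral>\<^sup>+x. ennreal (decay a (x::'a::euclidean_space)) \<partial>lborel) < \<infinity>"
proof -
  define s where "s = a / real DIM('a)"
  have s: "1 < s" using assms by (simp add: s_def)
  have "decay a x \<le> (\<Prod>b\<in>Basis. decay s (x \<bullet> b))" for x :: 'a
  proof (cases "norm x \<le> 1")
    case True
    have "decay s (x \<bullet> b) = 1" if "b \<in> Basis" for b
      using Basis_le_norm[OF that, of x] True by (simp add: decay_def)
    then show ?thesis using True by (simp add: decay_def)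
  next
    case False
    have "decay a x = (\<Prod>b\<in>(Basis::'a set). norm x powr (- s))"
    proof -
      have "x \<noteq> 0" using False by auto
      then show ?thesis using False by (simp add: decay_def s_def powr_realpow[symmetric] powr_powr)
    qed
    also have "\<dots> \<le> (\<Prod>b\<in>Basis. decay s (x \<bullet> b))"
    proof (intro prod_mono conjI)
      fix b :: 'a assume b: "b \<in> Basis"
      show "norm x powr (- s) \<le> decay s (x \<bullet> b)"
      proof (cases "\<bar>x \<bullet> b\<bar> \<le> 1")
        case True
        have "norm x powr (- s) \<le> norm x powr 0" using False s by (intro powr_mono) auto
        moreover have "x \<noteq> 0" using False by auto
        ultimately show ?thesis using True False by (simp add: decay_def)
      next
        case F: False
        then show ?thesis using Basis_le_norm[OF b, of x] s by (auto simp: decay_def intro!: powr_mono2')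
      qed
    qed simp
    finally show ?thesis .
  qed
  then have "(\<integral>\<^sup>+x. ennreal (decay a (x::'a)) \<partial>lborel) \<le> (\<integral>\<^sup>+x. (\<Prod>b\<in>Basis. ennreal (decay s ((x::'a) \<bullet> b))) \<partial>lborel)"
    by (intro nn_integral_mono) (simp add: prod_ennreal less_imp_le[OF decay_pos] ennreal_leI)
  also have "\<dots> = (\<Prod>b\<in>(Basis::'a set). \<integral>\<^sup>+t. ennreal (decay s (t::real)) \<partial>lborel)"
    by (rule nn_integral_lborel_prod) auto
  also have "\<dots> < \<infinity>"
    using nn_integral_decay_real_finite[OF s] by (simp add: power_less_top_ennreal)
  finally show ?thesis .
qed

lemma le_powr_interpolate:
  fixes t u v :: real
  assumes "0 \<le> t" "t \<le> u" "t \<le> v" "0 \<le> \<theta>" "\<theta> \<le> 1"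
  shows "t \<le> u powr \<theta> * v powr (1 - \<theta>)"
proof (cases "t = 0")
  case False
  then have "t = t powr \<theta> * t powr (1 - \<theta>)" using assms by (simp add: powr_add[symmetric])
  also have "\<dots> \<le> u powr \<theta> * v powr (1 - \<theta>)" using assms by (intro mult_mono powr_mono2) auto
  finally show ?thesis .
qed simp

lemma mix_density_facts:
  fixes f :: "real^'b \<Rightarrow> real^'d \<Rightarrow> real"
  assumes "density_family f \<Gamma>" "G \<in> mixing_le k \<Gamma>"
  shows "mix_density f G \<in> borel_measurable borel" "0 \<le> mix_density f G x"
    "integrable lborel (mix_density f G)" "(\<integral>x. mix_density f G x \<partial>lborel) = 1"
    "mix_cdf f G x = (\<integral>t. indicator (lower_orthant x) t * mix_density f G t \<partial>lborel)"
proof -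
  note G = mixing_leD[OF assms(2)]
  have f: "integrable lborel (\<lambda>x. f x \<gamma>)" "(\<integral>x. f x \<gamma> \<partial>lborel) = 1" "0 \<le> f y \<gamma>"
    "(\<lambda>x. f x \<gamma>) \<in> borel_measurable borel" if "\<gamma> \<in> atoms G" for \<gamma> y
    using density_family_integrable[OF assms(1)] that G(3) by auto
  show "mix_density f G \<in> borel_measurable borel"
    unfolding mix_density_def[abs_def] using f by (intro borel_measurable_sum borel_measurable_times) auto
  show "0 \<le> mix_density f G x" unfolding mix_density_def using f by (intro sum_nonneg) auto
  show "integrable lborel (mix_density f G)"
    unfolding mix_density_def[abs_def] using f by (intro Bochner_Integration.integrable_sum integrable_mult_right) auto
  show "(\<integral>x. mix_density f G x \<partial>lborel) = 1"
    unfolding mix_density_def using f G(7) by (subst Bochner_Integration.integral_sum) auto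
  have "integrable lborel (\<lambda>t. indicator (lower_orthant x) t * f t \<gamma>)" if "\<gamma> \<in> atoms G" for \<gamma>
    using integrable_mult_indicator[OF _ f(1)[OF that], of "lower_orthant x"] lower_orthant_borel[of x] by simp
  then have "(\<integral>t. (\<Sum>\<gamma>\<in>atoms G. measure G {\<gamma>} * (indicator (lower_orthant x) t * f t \<gamma>)) \<partial>lborel) =
      (\<Sum>\<gamma>\<in>atoms G. measure G {\<gamma>} * (\<integral>t. indicator (lower_orthant x) t * f t \<gamma> \<partial>lborel))"
    by (subst Bochner_Integration.integral_sum) auto
  then show "mix_cdf f G x = (\<integral>t. indicator (lower_orthant x) t * mix_density f G t \<partial>lborel)"
    unfolding mix_cdf_def mcdf_def set_lebesgue_integral_def lower_orthant_def[symmetric] mix_density_def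
    by (simp add: sum_distrib_left mult_ac)
qed

text \<open>The inequality between total variation and Hellinger distance, with a constant that is
  not sharp: \<open>|p - q| = |\<surd>p - \<surd>q| (\<surd>p + \<surd>q)\<close>, and the arithmetic-geometric mean
  inequality with weight \<open>\<tau>\<close> replaces the Cauchy--Schwarz inequality.\<close>
lemma affinity_le:
  fixes p q :: "'a::euclidean_space \<Rightarrow> real"
  assumes p: "integrable lborel p" "\<And>x. 0 \<le> p x" "(\<integral>x. p x \<partial>lborel) = 1"
    and q: "integrable lborel q" "\<And>x. 0 \<le> q x" "(\<integral>x. q x \<partial>lborel) = 1"
    and A: "A \<in> sets borel" and s: "0 < s"
    and diff: "s \<le> \<bar>(\<integral>x. indicator A x * p x \<partial>lborel) - (\<integral>x. indicator A x * q x \<partial>lborel)\<bar>"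
  shows "integrable lborel (\<lambda>x. sqrt (p x * q x))" "(\<integral>x. sqrt (p x * q x) \<partial>lborel) \<le> 1 - s\<^sup>2 / 8"
proof -
  have [measurable]: "p \<in> borel_measurable lborel" "q \<in> borel_measurable lborel"
    using p q by auto
  have amgm: "sqrt (p x * q x) \<le> p x + q x" for x
    using arith_geo_mean_sqrt[OF p(2) q(2), of x x] p(2)[of x] q(2)[of x] by simp
  show int: "integrable lborel (\<lambda>x. sqrt (p x * q x))"
    by (rule Bochner_Integration.integrable_bound[of _ "\<lambda>x. p x + q x"])
       (use p q amgm in \<open>auto simp: abs_of_nonneg\<close>)
  define \<rho> where "\<rho> = (\<integral>x. sqrt (p x * q x) \<partial>lborel)"
  \<comment> \<open>With this weight the second summand of the bound below integrates to half of \<open>s\<close>.\<close>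
  define \<tau> where "\<tau> = s / 4"
  have \<tau>: "\<tau> > 0" using s by (simp add: \<tau>_def)
  have pt: "\<bar>indicator A x * p x - indicator A x * q x\<bar> \<le>
      (1 / (2 * \<tau>)) * (p x + q x - 2 * sqrt (p x * q x)) + \<tau> * (p x + q x)" for x
  proof -
    define a where "a = sqrt (p x)"
    define b where "b = sqrt (q x)"
    have ab: "0 \<le> a" "0 \<le> b" "p x = a\<^sup>2" "q x = b\<^sup>2" "sqrt (p x * q x) = a * b"
      using p q by (auto simp: a_def b_def real_sqrt_mult)
    have "\<bar>indicator A x * p x - indicator A x * q x\<bar> \<le> \<bar>p x - q x\<bar>"
      by (simp add: indicator_def)
    also have "\<dots> = \<bar>a - b\<bar> * (a + b)"
      using ab by (simp add: power2_eq_square square_diff_square_factored abs_mult)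
    also have "\<dots> \<le> (1 / (2 * \<tau>)) * (a - b)\<^sup>2 + \<tau> / 2 * (a + b)\<^sup>2"
    proof -
      have "0 \<le> (\<bar>a - b\<bar> - \<tau> * (a + b))\<^sup>2" by simp
      then have "2 * \<tau> * (\<bar>a - b\<bar> * (a + b)) \<le> (a - b)\<^sup>2 + \<tau>\<^sup>2 * (a + b)\<^sup>2"
        by (simp add: power2_diff power_mult_distrib mult_ac)
      then have "\<bar>a - b\<bar> * (a + b) \<le> ((a - b)\<^sup>2 + \<tau>\<^sup>2 * (a + b)\<^sup>2) / (2 * \<tau>)"
        using \<tau> by (simp add: pos_le_divide_eq mult_ac)
      also have "\<dots> = (1 / (2 * \<tau>)) * (a - b)\<^sup>2 + \<tau> / 2 * (a + b)\<^sup>2"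
        using \<tau> by (simp add: field_simps power2_eq_square)
      finally show ?thesis .
    qed
    also have "\<dots> \<le> (1 / (2 * \<tau>)) * (a - b)\<^sup>2 + \<tau> / 2 * (2 * (a\<^sup>2 + b\<^sup>2))"
    proof (intro add_left_mono mult_left_mono)
      have "0 \<le> (a - b)\<^sup>2" by simp
      then show "(a + b)\<^sup>2 \<le> 2 * (a\<^sup>2 + b\<^sup>2)" by (simp add: power2_sum power2_diff)
    qed (use \<tau> in simp)
    also have "\<dots> = (1 / (2 * \<tau>)) * (p x + q x - 2 * sqrt (p x * q x)) + \<tau> * (p x + q x)"
      unfolding ab(5) unfolding ab(3,4) power2_diff by (simp add: mult.assoc)
    finally show ?thesis .
  qed
  have ind: "integrable lborel (\<lambda>x. indicator A x * p x)" "integrable lborel (\<lambda>x. indicator A x * q x)"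
    using integrable_mult_indicator[of A lborel p] integrable_mult_indicator[of A lborel q] A p q by auto
  have "s \<le> \<bar>\<integral>x. indicator A x * p x - indicator A x * q x \<partial>lborel\<bar>"
    using diff ind by simp
  also have "\<dots> \<le> (\<integral>x. \<bar>indicator A x * p x - indicator A x * q x\<bar> \<partial>lborel)"
    by (rule integral_abs_bound)
  also have "\<dots> \<le> (\<integral>x. (1 / (2 * \<tau>)) * (p x + q x - 2 * sqrt (p x * q x)) + \<tau> * (p x + q x) \<partial>lborel)"
    using ind p q int pt by (intro integral_mono) auto
  also have "\<dots> = (1 / (2 * \<tau>)) * (2 - 2 * \<rho>) + \<tau> * 2"
    using p q int by (simp add: \<rho>_def)
  also have "\<dots> = 4 * (1 - \<rho>) / s + s / 2" using s by (simp add: \<tau>_def field_simps)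
  finally have "s / 2 \<le> 4 * (1 - \<rho>) / s" by linarith
  then have "s / 2 * s \<le> 4 * (1 - \<rho>)" using s by (simp add: pos_le_divide_eq)
  then show "(\<integral>x. sqrt (p x * q x) \<partial>lborel) \<le> 1 - s\<^sup>2 / 8"
    unfolding \<rho>_def[symmetric] by (simp add: power2_eq_square)
qed

text \<open>One observation contributes the affinity of \<open>p\<close> with the upper end \<open>q + e\<close> of a bracket. The
  width \<open>1 / n\<^sup>2\<close> of the bracket enters through \<open>\<surd>(e p) \<le> (n e + p / n) / 2\<close>, whose integral is at
  most \<open>1 / n\<close>.\<close>
lemma nn_integral_sqrt_ratio:
  fixes p q e :: "'a::euclidean_space \<Rightarrow> real"
  assumes p: "p \<in> borel_measurable borel" "integrable lborel p" "\<And>x. 0 \<le> p x" "(\<integral>x. p x \<partial>lborel) = 1"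
    and q: "q \<in> borel_measurable borel" "integrable lborel q" "\<And>x. 0 \<le> q x" "(\<integral>x. q x \<partial>lborel) = 1"
    and e: "e \<in> borel_measurable borel" "\<And>x. 0 \<le> e x" "(\<integral>\<^sup>+x. ennreal (e x) \<partial>lborel) \<le> ennreal (1 / (real n)\<^sup>2)"
    and A: "A \<in> sets borel" and s: "0 < s" and n: "1 \<le> n"
    and diff: "s \<le> \<bar>(\<integral>x. indicator A x * q x \<partial>lborel) - (\<integral>x. indicator A x * p x \<partial>lborel)\<bar>"
  shows "(\<integral>\<^sup>+x. ennreal (sqrt ((q x + e x) / p x)) \<partial>density lborel (\<lambda>x. ennreal (p x))) \<le>
    ennreal (exp (1 / real n - s\<^sup>2 / 8))"
proof -
  note [measurable] = p(1) q(1) e(1)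
  note aff = affinity_le[OF q(2-4) p(2-4) A s diff]
  let ?n = "real n"
  have n0: "?n > 0" using n by simp
  have pt: "sqrt ((q x + e x) * p x) \<le> sqrt (q x * p x) + (?n / 2 * e x + 1 / (2 * ?n) * p x)" for x
  proof -
    have "sqrt ((q x + e x) * p x) \<le> sqrt (q x * p x) + sqrt (e x * p x)"
      using p q e by (simp add: distrib_right sqrt_add_le_add_sqrt)
    also have "sqrt (e x * p x) = sqrt ((?n * e x) * (p x / ?n))" using n0 by simp
    also have "\<dots> \<le> (?n * e x + p x / ?n) / 2"
      using p e n0 by (intro arith_geo_mean_sqrt) auto
    finally show ?thesis by (simp add: field_simps)
  qed
  have "(\<integral>\<^sup>+x. ennreal (sqrt ((q x + e x) / p x)) \<partial>density lborel (\<lambda>x. ennreal (p x))) =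
      (\<integral>\<^sup>+x. ennreal (p x) * ennreal (sqrt ((q x + e x) / p x)) \<partial>lborel)"
    by (rule nn_integral_density) auto
  also have "\<dots> = (\<integral>\<^sup>+x. ennreal (sqrt ((q x + e x) * p x)) \<partial>lborel)"
  proof (rule nn_integral_cong)
    fix x
    have "p x * sqrt ((q x + e x) / p x) = sqrt ((q x + e x) * p x)"
    proof (cases "p x = 0")
      case False
      then have "p x > 0" using p(3)[of x] by simp
      then have "(q x + e x) * p x = (q x + e x) / p x * (p x)\<^sup>2"
        by (simp add: power2_eq_square)
      then have "sqrt ((q x + e x) * p x) = sqrt ((q x + e x) / p x) * sqrt ((p x)\<^sup>2)"
        by (simp only: real_sqrt_mult)
      then show ?thesis using \<open>p x > 0\<close> by simp
    qed simp
    then show "ennreal (p x) * ennreal (sqrt ((q x + e x) / p x)) = ennreal (sqrt ((q x + e x) * p x))"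
      using p(3)[of x] by (simp add: ennreal_mult'[symmetric])
  qed
  also have "\<dots> \<le> (\<integral>\<^sup>+x. ennreal (sqrt (q x * p x)) + (ennreal (?n / 2) * ennreal (e x) + ennreal (1 / (2 * ?n)) * ennreal (p x)) \<partial>lborel)"
  proof (rule nn_integral_mono)
    fix x
    have "ennreal (sqrt ((q x + e x) * p x)) \<le> ennreal (sqrt (q x * p x) + (?n / 2 * e x + 1 / (2 * ?n) * p x))"
      by (rule ennreal_leI[OF pt])
    also have "\<dots> = ennreal (sqrt (q x * p x)) + (ennreal (?n / 2) * ennreal (e x) + ennreal (1 / (2 * ?n)) * ennreal (p x))"
      using p(3)[of x] q(3)[of x] e(2)[of x] n0 by (simp add: ennreal_plus[symmetric] ennreal_mult'[symmetric] del: ennreal_plus)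
    finally show "ennreal (sqrt ((q x + e x) * p x)) \<le> ennreal (sqrt (q x * p x)) + (ennreal (?n / 2) * ennreal (e x) + ennreal (1 / (2 * ?n)) * ennreal (p x))" .
  qed
  also have "\<dots> = (\<integral>\<^sup>+x. ennreal (sqrt (q x * p x)) \<partial>lborel) +
      (ennreal (?n / 2) * (\<integral>\<^sup>+x. ennreal (e x) \<partial>lborel) + ennreal (1 / (2 * ?n)) * (\<integral>\<^sup>+x. ennreal (p x) \<partial>lborel))"
    by (simp add: nn_integral_add nn_integral_cmult)
  also have "(\<integral>\<^sup>+x. ennreal (p x) \<partial>lborel) = 1"
    using nn_integral_eq_integral[OF p(2)] p by simp
  also have "(\<integral>\<^sup>+x. ennreal (sqrt (q x * p x)) \<partial>lborel) = ennreal (\<integral>x. sqrt (q x * p x) \<partial>lborel)"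
    using nn_integral_eq_integral[OF aff(1)] p q by simp
  also have "ennreal (\<integral>x. sqrt (q x * p x) \<partial>lborel) +
      (ennreal (?n / 2) * (\<integral>\<^sup>+x. ennreal (e x) \<partial>lborel) + ennreal (1 / (2 * ?n)) * 1)
    \<le> ennreal (\<integral>x. sqrt (q x * p x) \<partial>lborel) + (ennreal (?n / 2) * ennreal (1 / ?n\<^sup>2) + ennreal (1 / (2 * ?n)) * 1)"
    by (intro add_mono mult_left_mono e) auto
  also have "\<dots> = ennreal ((\<integral>x. sqrt (q x * p x) \<partial>lborel) + (?n / 2 * (1 / ?n\<^sup>2) + 1 / (2 * ?n)))"
    using n0 p q by (simp add: ennreal_plus[symmetric] ennreal_mult'[symmetric] del: ennreal_plus)
  also have "\<dots> \<le> ennreal (exp (1 / ?n - s\<^sup>2 / 8))"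
  proof (rule ennreal_leI)
    have "?n / 2 * (1 / ?n\<^sup>2) + 1 / (2 * ?n) = 1 / ?n" using n0 by (simp add: field_simps power2_eq_square)
    then have "(\<integral>x. sqrt (q x * p x) \<partial>lborel) + (?n / 2 * (1 / ?n\<^sup>2) + 1 / (2 * ?n)) \<le> 1 + (1 / ?n - s\<^sup>2 / 8)"
      using aff(2) by simp
    also have "\<dots> \<le> exp (1 / ?n - s\<^sup>2 / 8)" by (rule exp_ge_add_one_self)
    finally show "(\<integral>x. sqrt (q x * p x) \<partial>lborel) + (?n / 2 * (1 / ?n\<^sup>2) + 1 / (2 * ?n)) \<le> exp (1 / ?n - s\<^sup>2 / 8)" .
  qed
  finally show ?thesis .
qed

section \<open>Brackets of polynomial cardinality\<close>

lemma mix_density_enumeration: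
  fixes f :: "real^'b \<Rightarrow> real^'d \<Rightarrow> real"
  assumes "G \<in> mixing_le k \<Gamma>"
  shows "\<exists>p \<pi>. (\<forall>i. p i \<in> \<Gamma>) \<and> (\<forall>i. 0 \<le> \<pi> i \<and> \<pi> i \<le> 1) \<and> (\<forall>x. mix_density f G x = (\<Sum>i<k. \<pi> i * f x (p i)))"
proof -
  note G = mixing_leD[OF assms]
  let ?m = "card (atoms G)"
  obtain h where h: "bij_betw h {..<?m} (atoms G)"
    using ex_bij_betw_nat_finite[OF G(4)] by (auto simp: atLeast0LessThan)
  have "0 < ?m" using G(4,5) by (simp add: card_gt_0_iff)
  then have h_in: "h i \<in> atoms G" if "i < ?m" for i using h that by (auto simp: bij_betw_def)
  define p where "p i = (if i < ?m then h i else h 0)" for i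
  define \<pi> where "\<pi> i = (if i < ?m then measure G {h i} else 0)" for i
  have "p i \<in> \<Gamma>" for i using h_in[of i] h_in[of 0] \<open>0 < ?m\<close> G(3) by (auto simp: p_def)
  moreover have "0 \<le> \<pi> i \<and> \<pi> i \<le> 1" for i
    using prob_space.prob_le_1[OF G(2)] by (simp add: \<pi>_def)
  moreover have "mix_density f G x = (\<Sum>i<k. \<pi> i * f x (p i))" for x
  proof -
    have "mix_density f G x = (\<Sum>i<?m. measure G {h i} * f x (h i))"
      unfolding mix_density_def using sum.reindex_bij_betw[OF h, of "\<lambda>\<gamma>. measure G {\<gamma>} * f x \<gamma>"] by simp
    also have "\<dots> = (\<Sum>i<?m. \<pi> i * f x (p i))" by (intro sum.cong) (auto simp: \<pi>_def p_def)
    also have "\<dots> = (\<Sum>i<k. \<pi> i * f x (p i))"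
      using G(6) by (intro sum.mono_neutral_left) (auto simp: \<pi>_def)
    finally show ?thesis .
  qed
  ultimately show ?thesis by blast
qed

lemma abs_diff_le_of_floor_eq:
  fixes a b Q :: real
  assumes "\<lfloor>Q * a\<rfloor> = \<lfloor>Q * b\<rfloor>" "0 < Q"
  shows "\<bar>a - b\<bar> \<le> 1 / Q"
proof -
  have "\<bar>Q * a - Q * b\<bar> \<le> 1" using assms(1) by linarith
  then have "Q * \<bar>a - b\<bar> \<le> 1" using assms(2) by (simp add: abs_mult right_diff_distrib[symmetric])
  then show ?thesis using assms(2) by (simp add: field_simps)
qed

lemma density_decay_and_modulus:
  fixes f :: "real^'b \<Rightarrow> real^'d \<Rightarrow> real"
  assumes "density_family f \<Gamma>" "assumption_A f \<Gamma>" "assumption_B f \<Gamma>"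
  obtains L c a where "L > 0" "c > 0" "a > real CARD('b)"
    "\<And>x \<gamma> \<gamma>'. \<gamma> \<in> \<Gamma> \<Longrightarrow> \<gamma>' \<in> \<Gamma> \<Longrightarrow> \<bar>f x \<gamma> - f x \<gamma>'\<bar> \<le> L * norm (\<gamma> - \<gamma>')"
    "\<And>x \<gamma>. \<gamma> \<in> \<Gamma> \<Longrightarrow> f x \<gamma> \<le> c * decay a x"
proof -
  obtain L where L: "L > 0" "\<forall>\<gamma>\<in>\<Gamma>. \<forall>\<gamma>'\<in>\<Gamma>. sup_norm (\<lambda>x. f x \<gamma> - f x \<gamma>') \<le> ereal (L * norm (\<gamma> - \<gamma>'))"
    using assms(2) unfolding assumption_A_def by blast
  obtain c \<zeta> where c: "c > 0" "\<zeta> > 0"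
    "\<forall>x. \<forall>\<gamma>\<in>\<Gamma>. f x \<gamma> \<le> c * (if x = 0 then 1 else min 1 (norm x powr (- (real CARD('b) + \<zeta>))))"
    using assms(3) unfolding assumption_B_def by blast
  show ?thesis
  proof (rule that[OF L(1) c(1), of "real CARD('b) + \<zeta>"])
    show "\<bar>f x \<gamma> - f x \<gamma>'\<bar> \<le> L * norm (\<gamma> - \<gamma>')" if "\<gamma> \<in> \<Gamma>" "\<gamma>' \<in> \<Gamma>" for x \<gamma> \<gamma>'
    proof -
      have "ereal \<bar>f x \<gamma> - f x \<gamma>'\<bar> \<le> sup_norm (\<lambda>x. f x \<gamma> - f x \<gamma>')"
        unfolding sup_norm_def by (rule SUP_upper) simp
      also have "\<dots> \<le> ereal (L * norm (\<gamma> - \<gamma>'))" using L(2) that by blast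
      finally show ?thesis by simp
    qed
    show "f x \<gamma> \<le> c * decay (real CARD('b) + \<zeta>) x" if "\<gamma> \<in> \<Gamma>" for x \<gamma>
      using c(3)[rule_format, OF that, of x] decay_eq[of "real CARD('b) + \<zeta>" x] c(2) by (simp only: add_nonneg_nonneg of_nat_0_le_iff less_imp_le)
  qed (use c in simp)
qed

text \<open>The function \<open>\<kappa>\<close> rounds the weights and the coordinates of the atoms down to multiples of \<open>1 / Q\<close>.
  Mixtures with the same value of \<open>\<kappa>\<close> differ by at most a multiple of \<open>min (1/Q) (decay a)\<close>, and
  this is at most \<open>(1/Q) powr \<theta>\<close> times \<open>decay a powr (1 - \<theta>)\<close>, which is still integrable if \<open>\<theta>\<close> is
  small. Taking \<open>\<theta> = 1/m\<close> for a natural number \<open>m\<close> makes \<open>Q\<close>, and with it the number of brackets, a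
  polynomial in \<open>n\<close>.\<close>
lemma polynomial_bracketing:
  fixes f :: "real^'b \<Rightarrow> real^'d \<Rightarrow> real"
  assumes "compact \<Gamma>" "density_family f \<Gamma>" "assumption_A f \<Gamma>" "assumption_B f \<Gamma>"
  shows "\<exists>N a :: nat. \<forall>n\<ge>1. \<exists>(\<kappa> :: (real^'d) measure \<Rightarrow> nat \<Rightarrow> int \<times> ('d \<Rightarrow> int)) e.
    e \<in> borel_measurable borel \<and> (\<forall>x. 0 \<le> e x) \<and>
    (\<integral>\<^sup>+x. ennreal (e x) \<partial>lborel) \<le> ennreal (1 / (real n)\<^sup>2) \<and>
    finite (\<kappa> ` mixing_le k \<Gamma>) \<and> card (\<kappa> ` mixing_le k \<Gamma>) \<le> N * n ^ a \<and>
    (\<forall>G\<in>mixing_le k \<Gamma>. \<forall>G'\<in>mixing_le k \<Gamma>. \<kappa> G = \<kappa> G' \<longrightarrow>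
       (\<forall>x. mix_density f G x \<le> mix_density f G' x + e x))"
proof -
  obtain L c a where L: "L > 0" and c: "c > 0" and a: "a > real CARD('b)"
    and lip: "\<And>x \<gamma> \<gamma>'. \<gamma> \<in> \<Gamma> \<Longrightarrow> \<gamma>' \<in> \<Gamma> \<Longrightarrow> \<bar>f x \<gamma> - f x \<gamma>'\<bar> \<le> L * norm (\<gamma> - \<gamma>')"
    and dec: "\<And>x \<gamma>. \<gamma> \<in> \<Gamma> \<Longrightarrow> f x \<gamma> \<le> c * decay a x"
    by (rule density_decay_and_modulus[OF assms(2-4)]) (rule that)
  have f0: "0 \<le> f x \<gamma>" if "\<gamma> \<in> \<Gamma>" for x \<gamma>
    using assms(2) that by (simp add: density_family_def)
  have a0: "a > 0" using a by (rule less_trans[rotated]) simp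
  obtain m :: nat where m: "m > 0" "real CARD('b) < a * (1 - 1 / real m)"
  proof -
    obtain m :: nat where m: "real m > a / (a - real CARD('b))" using reals_Archimedean2 by blast
    have m0: "real m > 0" using a a0 by (intro le_less_trans[OF _ m]) auto
    have "a < real m * (a - real CARD('b))" using m a by (simp add: pos_divide_less_eq)
    then have "a / real m < a - real CARD('b)" using m0 by (simp add: pos_divide_less_eq mult.commute)
    then show thesis using m0 by (intro that[of m]) (simp_all add: right_diff_distrib)
  qed
  define \<theta> where "\<theta> = 1 / real m"
  have \<theta>: "0 < \<theta>" "\<theta> \<le> 1" using m by (simp_all add: \<theta>_def)
  define a' where "a' = a * (1 - \<theta>)"
  have a': "real CARD('b) < a'" "a' \<le> a" using m(2) \<theta> a0 by (auto simp: a'_def \<theta>_def)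
  define W where "W = (\<integral>\<^sup>+x. ennreal (decay a' (x::real^'b)) \<partial>lborel)"
  have "W < \<infinity>" unfolding W_def by (rule nn_integral_decay_finite) (use a' in simp)
  then obtain w where w: "0 \<le> w" "W = ennreal w" by (cases W) auto
  define d where "d = real CARD('d)"
  have d: "d > 0" by (simp add: d_def)
  define K where "K = real k * (c + (L * d) powr \<theta> * c powr (1 - \<theta>))"
  have K: "0 \<le> K" using c L d by (simp add: K_def)
  obtain B :: nat where B: "B \<ge> 1" "K * w \<le> real B"
  proof -
    obtain B :: nat where "K * w \<le> real B" using real_arch_simple by blast
    then show thesis by (intro that[of "Suc B"]) auto
  qed
  obtain M :: nat where M: "M \<ge> 1" "\<And>\<gamma> j. \<gamma> \<in> \<Gamma> \<Longrightarrow> \<bar>\<gamma> $ j\<bar> \<le> real M"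
  proof -
    obtain r where r: "\<And>\<gamma>. \<gamma> \<in> \<Gamma> \<Longrightarrow> norm \<gamma> \<le> r"
      using compact_imp_bounded[OF assms(1)] bounded_iff by blast
    obtain M :: nat where M: "r \<le> real M" using real_arch_simple by blast
    show thesis
    proof (rule that[of "Suc M"])
      show "\<bar>\<gamma> $ j\<bar> \<le> real (Suc M)" if "\<gamma> \<in> \<Gamma>" for \<gamma> j
        using component_le_norm_cart[of \<gamma> j] r[OF that] M by simp
    qed simp
  qed
  define represents where "represents G z \<longleftrightarrow> (\<forall>i. fst z i \<in> \<Gamma>) \<and> (\<forall>i. 0 \<le> snd z i \<and> snd z i \<le> 1) \<and>
      (\<forall>x. mix_density f G x = (\<Sum>i<k. snd z i * f x (fst z i)))" for G and z :: "(nat \<Rightarrow> real^'d) \<times> (nat \<Rightarrow> real)"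
  define pts where "pts G = (SOME z. represents G z)" for G
  have represents_pts: "represents G (pts G)" if G: "G \<in> mixing_le k \<Gamma>" for G
  proof -
    obtain p \<pi> where "(\<forall>i. p i \<in> \<Gamma>) \<and> (\<forall>i. 0 \<le> \<pi> i \<and> \<pi> i \<le> 1) \<and>
        (\<forall>x. mix_density f G x = (\<Sum>i<k. \<pi> i * f x (p i)))"
      using mix_density_enumeration[OF G, of f] by (elim exE) (rule that)
    then have "represents G (p, \<pi>)" unfolding represents_def fst_conv snd_conv .
    then show ?thesis unfolding pts_def by (rule someI)
  qed
  note pts = represents_pts[unfolded represents_def]
  define N where "N = (2 * B ^ m * (3 * M * B ^ m) ^ CARD('d)) ^ k"
  define \<alpha> where "\<alpha> = 2 * m * (CARD('d) + 1) * k"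
  have "\<exists>(\<kappa> :: (real^'d) measure \<Rightarrow> nat \<Rightarrow> int \<times> ('d \<Rightarrow> int)) e.
    e \<in> borel_measurable borel \<and> (\<forall>x. 0 \<le> e x) \<and>
    (\<integral>\<^sup>+x. ennreal (e x) \<partial>lborel) \<le> ennreal (1 / (real n)\<^sup>2) \<and>
    finite (\<kappa> ` mixing_le k \<Gamma>) \<and> card (\<kappa> ` mixing_le k \<Gamma>) \<le> N * n ^ \<alpha> \<and>
    (\<forall>G\<in>mixing_le k \<Gamma>. \<forall>G'\<in>mixing_le k \<Gamma>. \<kappa> G = \<kappa> G' \<longrightarrow>
       (\<forall>x. mix_density f G x \<le> mix_density f G' x + e x))" if n: "n \<ge> 1" for n :: nat
  proof -
    define Q where "Q = (B * n ^ 2) ^ m"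
    have Q1: "Q \<ge> 1" using B n by (simp add: Q_def)
    then have Q: "real Q > 0" by simp
    have Q\<theta>: "real Q powr \<theta> = real B * (real n)\<^sup>2"
    proof -
      have "real B * (real n)\<^sup>2 > 0" using B n by simp
      moreover have "real Q = (real B * (real n)\<^sup>2) powr real m"
        using calculation by (simp add: Q_def powr_realpow)
      ultimately show ?thesis using m by (simp add: \<theta>_def powr_powr)
    qed
    define \<kappa> where "\<kappa> G = (\<lambda>i\<in>{..<k}. (\<lfloor>real Q * snd (pts G) i\<rfloor>, \<lambda>j. \<lfloor>real Q * fst (pts G) i $ j\<rfloor>))" for G
    define e where "e x = K / (real B * (real n)\<^sup>2) * decay a' x" for x :: "real^'b"
    have e0: "0 \<le> e x" for x using K decay_pos[of a' x] by (simp add: e_def)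
    have [measurable]: "e \<in> borel_measurable borel" unfolding e_def by measurable
    have eI: "(\<integral>\<^sup>+x. ennreal (e x) \<partial>lborel) \<le> ennreal (1 / (real n)\<^sup>2)"
    proof -
      have "(\<integral>\<^sup>+x. ennreal (e x) \<partial>lborel) = ennreal (K / (real B * (real n)\<^sup>2)) * W"
        unfolding e_def W_def using K decay_pos[of a']
        by (subst nn_integral_cmult[symmetric]) (auto simp: ennreal_mult'[symmetric] less_imp_le)
      also have "\<dots> = ennreal (K / (real B * (real n)\<^sup>2) * w)" using K unfolding w(2) by (intro ennreal_mult[symmetric] w(1)) simp
      also have "\<dots> \<le> ennreal (1 / (real n)\<^sup>2)"
        using B n by (intro ennreal_leI) (simp add: field_simps)
      finally show ?thesis .
    qed
    define Kset where "Kset = ({0..int Q} \<times> (UNIV \<rightarrow>\<^sub>E {- int (Q * M)..int (Q * M)}) :: (int \<times> ('d \<Rightarrow> int)) set)"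
    have \<kappa>_in: "\<kappa> G \<in> {..<k} \<rightarrow>\<^sub>E Kset" if "G \<in> mixing_le k \<Gamma>" for G
    proof -
      have "\<lfloor>real Q * snd (pts G) i\<rfloor> \<in> {0..int Q}" for i
      proof -
        have "0 \<le> snd (pts G) i" "snd (pts G) i \<le> 1" using pts[OF that] by blast+
        then have "0 \<le> real Q * snd (pts G) i" "real Q * snd (pts G) i \<le> real Q * 1"
          by (intro mult_nonneg_nonneg mult_left_mono; simp)+
        then show ?thesis by (auto simp: floor_le_iff)
      qed
      moreover have "\<lfloor>real Q * fst (pts G) i $ j\<rfloor> \<in> {- int (Q * M)..int (Q * M)}" for i j
      proof -
        have "\<bar>fst (pts G) i $ j\<bar> \<le> real M" using pts[OF that] M(2) by blast
        then have "\<bar>real Q * fst (pts G) i $ j\<bar> \<le> real Q * real M"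
          by (simp add: abs_mult mult_left_mono)
        then have "- real (Q * M) \<le> real Q * fst (pts G) i $ j" "real Q * fst (pts G) i $ j \<le> real (Q * M)"
          by (simp_all add: abs_le_iff)
        then show ?thesis by (simp add: le_floor_iff floor_le_iff del: of_nat_mult)
      qed
      ultimately show ?thesis by (auto simp: \<kappa>_def Kset_def)
    qed
    have finK: "finite Kset" unfolding Kset_def by (intro finite_cartesian_product finite_PiE) auto
    have fin: "finite ({..<k} \<rightarrow>\<^sub>E Kset)" using finK by (intro finite_PiE) auto
    have sub: "\<kappa> ` mixing_le k \<Gamma> \<subseteq> {..<k} \<rightarrow>\<^sub>E Kset" using \<kappa>_in by auto
    have cardK: "card Kset = (Q + 1) * (2 * Q * M + 1) ^ CARD('d)"
    proof -
      have "card {- int j..int j} = 2 * j + 1" "card {0..int j} = j + 1" for j by (simp_all add: nat_eq_iff)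
      then show ?thesis
        unfolding Kset_def card_cartesian_product by (simp only: card_PiE[OF finite] prod_constant mult.assoc)
    qed
    have "card (\<kappa> ` mixing_le k \<Gamma>) \<le> card ({..<k} \<rightarrow>\<^sub>E Kset)" by (rule card_mono[OF fin sub])
    also have "\<dots> = card Kset ^ k" by (simp add: card_PiE)
    also have "\<dots> \<le> ((2 * Q) * (3 * Q * M) ^ CARD('d)) ^ k"
    proof -
      have "1 \<le> Q * M" using Q1 M(1) by simp
      then show ?thesis unfolding cardK using Q1 by (intro power_mono mult_mono) auto
    qed
    also have "\<dots> = N * n ^ \<alpha>"
      by (simp add: N_def \<alpha>_def Q_def power_mult_distrib power_mult[symmetric] power_add algebra_simps)
    finally have card: "card (\<kappa> ` mixing_le k \<Gamma>) \<le> N * n ^ \<alpha>" .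
    have "mix_density f G x \<le> mix_density f G' x + e x"
      if G: "G \<in> mixing_le k \<Gamma>" and G': "G' \<in> mixing_le k \<Gamma>" and eq: "\<kappa> G = \<kappa> G'" for G G' x
    proof -
      define p \<pi> p' \<pi>' where "p = fst (pts G)" and "\<pi> = snd (pts G)" and "p' = fst (pts G')" and "\<pi>' = snd (pts G')"
      have P: "\<And>i. p i \<in> \<Gamma>" "\<And>i. 0 \<le> \<pi> i" "mix_density f G x = (\<Sum>i<k. \<pi> i * f x (p i))"
        using pts[OF G] by (auto simp: p_def \<pi>_def)
      have P': "\<And>i. p' i \<in> \<Gamma>" "\<And>i. 0 \<le> \<pi>' i" "\<And>i. \<pi>' i \<le> 1" "mix_density f G' x = (\<Sum>i<k. \<pi>' i * f x (p' i))"
        using pts[OF G'] by (auto simp: p'_def \<pi>'_def)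
      have dle: "decay a x \<le> decay a' x" using a' by (intro decay_antimono)
      have step: "\<pi> i * f x (p i) - \<pi>' i * f x (p' i) \<le> (c + (L * d) powr \<theta> * c powr (1 - \<theta>)) / (real B * (real n)\<^sup>2) * decay a' x"
        if i: "i < k" for i
      proof -
        have fl: "\<lfloor>real Q * \<pi> i\<rfloor> = \<lfloor>real Q * \<pi>' i\<rfloor>" "\<lfloor>real Q * p i $ j\<rfloor> = \<lfloor>real Q * p' i $ j\<rfloor>" for j
          using fun_cong[OF eq, of i] i by (auto simp: \<kappa>_def p_def \<pi>_def p'_def \<pi>'_def dest: fun_cong)
        have w1: "\<bar>\<pi> i - \<pi>' i\<bar> \<le> 1 / real Q" by (rule abs_diff_le_of_floor_eq[OF fl(1) Q])
        have "norm (p i - p' i) \<le> (\<Sum>j\<in>UNIV. \<bar>(p i - p' i) $ j\<bar>)" by (rule norm_le_l1_cart)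
        also have "\<dots> \<le> (\<Sum>j\<in>(UNIV::'d set). 1 / real Q)"
          using abs_diff_le_of_floor_eq[OF fl(2) Q] by (intro sum_mono) simp
        finally have pp: "norm (p i - p' i) \<le> d / real Q" by (simp add: d_def)
        have "\<bar>f x (p i) - f x (p' i)\<bar> \<le> L * norm (p i - p' i)" by (rule lip[OF P(1) P'(1)])
        also have "\<dots> \<le> L * (d / real Q)" using L pp by (intro mult_left_mono) auto
        finally have u: "\<bar>f x (p i) - f x (p' i)\<bar> \<le> L * d / real Q" by simp
        have v: "\<bar>f x (p i) - f x (p' i)\<bar> \<le> c * decay a x"
          using dec[OF P(1), of x i] dec[OF P'(1), of x i] f0[OF P(1), of x i] f0[OF P'(1), of x i] by linarith
        have "\<bar>f x (p i) - f x (p' i)\<bar> \<le> (L * d / real Q) powr \<theta> * (c * decay a x) powr (1 - \<theta>)"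
          using u v \<theta> by (intro le_powr_interpolate) auto
        also have "\<dots> = (L * d) powr \<theta> * c powr (1 - \<theta>) / (real B * (real n)\<^sup>2) * decay a' x"
          using L c d Q decay_pos[of a x]
          by (simp add: powr_mult powr_divide Q\<theta> decay_powr a'_def)
        finally have fdiff: "\<bar>f x (p i) - f x (p' i)\<bar> \<le> (L * d) powr \<theta> * c powr (1 - \<theta>) / (real B * (real n)\<^sup>2) * decay a' x" .
        have "real B * (real n)\<^sup>2 \<le> real Q"
        proof -
          have "(B * n ^ 2) ^ 1 \<le> (B * n ^ 2) ^ m" using B n m by (intro power_increasing) auto
          then show ?thesis unfolding Q_def by (simp flip: of_nat_power of_nat_mult)
        qed
        then have Qle: "1 / real Q \<le> 1 / (real B * (real n)\<^sup>2)" using B n Q by (intro divide_left_mono mult_pos_pos) auto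
        have "\<pi> i * f x (p i) - \<pi>' i * f x (p' i) = (\<pi> i - \<pi>' i) * f x (p i) + \<pi>' i * (f x (p i) - f x (p' i))"
          by (simp add: algebra_simps)
        also have "\<dots> \<le> \<bar>\<pi> i - \<pi>' i\<bar> * f x (p i) + \<pi>' i * \<bar>f x (p i) - f x (p' i)\<bar>"
          using f0[OF P(1), of x i] P'(2)[of i] by (intro add_mono mult_right_mono mult_left_mono) auto
        also have "\<dots> \<le> 1 / (real B * (real n)\<^sup>2) * (c * decay a' x) + 1 * ((L * d) powr \<theta> * c powr (1 - \<theta>) / (real B * (real n)\<^sup>2) * decay a' x)"
        proof (intro add_mono mult_mono)
          show "\<bar>\<pi> i - \<pi>' i\<bar> \<le> 1 / (real B * (real n)\<^sup>2)" using w1 Qle by linarith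
          have "c * decay a x \<le> c * decay a' x" using dle c by simp
          then show "f x (p i) \<le> c * decay a' x" using dec[OF P(1), of x i] by linarith
        qed (use f0[OF P(1)] P' fdiff in auto)
        also have "\<dots> = (c + (L * d) powr \<theta> * c powr (1 - \<theta>)) / (real B * (real n)\<^sup>2) * decay a' x"
          by (simp add: add_divide_distrib distrib_right)
        finally show ?thesis .
      qed
      have "mix_density f G x - mix_density f G' x = (\<Sum>i<k. \<pi> i * f x (p i) - \<pi>' i * f x (p' i))"
        by (simp add: P P' sum_subtractf)
      also have "\<dots> \<le> (\<Sum>i<k. (c + (L * d) powr \<theta> * c powr (1 - \<theta>)) / (real B * (real n)\<^sup>2) * decay a' x)"
        using step by (intro sum_mono) auto
      also have "\<dots> = e x" by (simp add: e_def K_def)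
      finally show ?thesis by simp
    qed
    then show ?thesis
      by (intro exI[of _ \<kappa>] exI[of _ e] conjI ballI allI impI e0 eI card finite_subset[OF sub fin])
         (simp_all add: \<open>e \<in> borel_measurable borel\<close>)
  qed
  then show ?thesis by (intro exI[of _ N] exI[of _ \<alpha>] allI impI)
qed

section \<open>The risk of the maximum likelihood estimator\<close>

lemma log_likelihood_real:
  assumes "\<And>i. i < n \<Longrightarrow> 0 < mix_density f G (X i)"
  shows "log_likelihood f n X G = ereal (1 / real n * (\<Sum>i<n. ln (mix_density f G (X i))))"
proof -
  have "(\<Sum>i<n. elog (mix_density f G (X i))) = (\<Sum>i<n. ereal (ln (mix_density f G (X i))))"
    using assms by (intro sum.cong) (auto simp: elog_def)
  then show ?thesis by (simp add: log_likelihood_def)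
qed

lemma log_likelihood_minus_infinity:
  assumes "i < n" "\<not> 0 < mix_density f G (X i)"
  shows "log_likelihood f n X G = -\<infinity>"
proof -
  have fin: "elog y \<noteq> \<infinity>" for y by (simp add: elog_def)
  have "(\<Sum>i<n. elog (mix_density f G (X i))) =
      elog (mix_density f G (X i)) + (\<Sum>i\<in>{..<n} - {i}. elog (mix_density f G (X i)))"
    using assms(1) by (intro sum.remove) auto
  moreover have "(\<Sum>i\<in>{..<n} - {i}. elog (mix_density f G (X i))) \<noteq> \<infinity>"
    using fin by (simp add: sum_Pinfty)
  ultimately have "(\<Sum>i<n. elog (mix_density f G (X i))) = -\<infinity>"
    using assms(2) by (simp add: elog_def)
  moreover have "n > 0" using assms(1) by simp
  ultimately show ?thesis by (simp add: log_likelihood_def)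
qed

text \<open>Wherever the true density is positive on the sample, the maximal log-likelihood is finite, so the
  estimated density is positive on the sample too.\<close>
lemma MLE_likelihood_ratio:
  assumes mle: "is_arg_max (log_likelihood f n X) (\<lambda>G. G \<in> mixing_le k \<Gamma>) Gh"
    and "1 \<le> n" and G: "G \<in> mixing_le k \<Gamma>" and pos: "\<And>i. i < n \<Longrightarrow> 0 < mix_density f G (X i)"
    and u: "\<And>i. i < n \<Longrightarrow> mix_density f Gh (X i) \<le> u (X i)"
  shows "1 \<le> (\<Prod>i<n. sqrt (u (X i) / mix_density f G (X i)))"
proof -
  have "\<not> log_likelihood f n X Gh < log_likelihood f n X G"
    using mle G unfolding is_arg_max_def by blast
  then have le: "log_likelihood f n X G \<le> log_likelihood f n X Gh" by simp
  have posh: "0 < mix_density f Gh (X i)" if "i < n" for i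
  proof (rule ccontr)
    assume "\<not> 0 < mix_density f Gh (X i)"
    then have "log_likelihood f n X Gh = -\<infinity>" using log_likelihood_minus_infinity that by blast
    then show False using le log_likelihood_real[of n f G X, OF pos] by simp
  qed
  have "1 / real n * (\<Sum>i<n. ln (mix_density f G (X i))) \<le> 1 / real n * (\<Sum>i<n. ln (mix_density f Gh (X i)))"
    using le log_likelihood_real[of n f G X, OF pos] log_likelihood_real[of n f Gh X, OF posh] by simp
  then have "(\<Sum>i<n. ln (mix_density f G (X i))) \<le> (\<Sum>i<n. ln (mix_density f Gh (X i)))"
    using assms(2) by (simp add: divide_le_cancel)
  also have "\<dots> \<le> (\<Sum>i<n. ln (u (X i)))"
    using u posh by (intro sum_mono) (smt (verit) ln_le_cancel_iff lessThan_iff)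
  finally have "0 \<le> (\<Sum>i<n. (ln (u (X i)) - ln (mix_density f G (X i))) / 2)"
    by (simp add: sum_divide_distrib[symmetric] sum_subtractf)
  then have "1 \<le> exp (\<Sum>i<n. (ln (u (X i)) - ln (mix_density f G (X i))) / 2)" by simp
  also have "\<dots> = (\<Prod>i<n. exp ((ln (u (X i)) - ln (mix_density f G (X i))) / 2))"
    by (rule exp_sum) simp
  also have "\<dots> = (\<Prod>i<n. sqrt (u (X i) / mix_density f G (X i)))"
  proof (rule prod.cong[OF refl])
    fix i assume "i \<in> {..<n}"
    then have p: "0 < mix_density f G (X i)" "0 < u (X i)" using pos posh u by (auto intro: less_le_trans)
    then have "exp ((ln (u (X i)) - ln (mix_density f G (X i))) / 2) = exp (ln (u (X i) / mix_density f G (X i)) / 2)"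
      by (simp add: ln_div)
    also have "\<dots> = sqrt (u (X i) / mix_density f G (X i))"
      using p by (simp add: ln_sqrt[symmetric])
    finally show "exp ((ln (u (X i)) - ln (mix_density f G (X i))) / 2) = sqrt (u (X i) / mix_density f G (X i))" .
  qed
  finally show ?thesis .
qed

lemma prob_space_mix_density:
  assumes "density_family f \<Gamma>" "G \<in> mixing_le k \<Gamma>"
  shows "prob_space (density lborel (\<lambda>x. ennreal (mix_density f G x)))"
proof (rule prob_spaceI)
  note [measurable] = mix_density_facts(1)[OF assms]
  have "(\<integral>\<^sup>+x. ennreal (mix_density f G x) \<partial>lborel) = 1"
    using nn_integral_eq_integral[OF mix_density_facts(3)[OF assms]] mix_density_facts(2,4)[OF assms] by simp
  then show "emeasure (density lborel (\<lambda>x. ennreal (mix_density f G x)))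
      (space (density lborel (\<lambda>x. ennreal (mix_density f G x)))) = 1"
    by (simp add: emeasure_density)
qed

lemma AE_sample_density_pos:
  assumes "density_family f \<Gamma>" "G \<in> mixing_le k \<Gamma>"
  shows "AE X in sample_measure f G n. \<forall>i<n. 0 < mix_density f G (X i)"
proof -
  note [measurable] = mix_density_facts(1)[OF assms]
  let ?M = "density lborel (\<lambda>x. ennreal (mix_density f G x))"
  have "AE x in ?M. 0 < mix_density f G x" by (simp add: AE_density)
  then have "AE X in PiM {..<n} (\<lambda>_. ?M). 0 < mix_density f G (X i)" if "i < n" for i
    using that by (intro AE_PiM_component prob_space_mix_density[OF assms]) auto
  then have "AE X in PiM {..<n} (\<lambda>_. ?M). \<forall>i\<in>{..<n}. 0 < mix_density f G (X i)"
    by (intro AE_finite_allI) auto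
  then show ?thesis unfolding sample_measure_def by (simp add: lessThan_iff Ball_def)
qed

lemma space_sample_measure: "space (sample_measure f G n) = space (PiM {..<n} (\<lambda>_. borel))"
  by (simp add: sample_measure_def space_PiM)

lemma nn_integral_sample_prod:
  assumes "density_family f \<Gamma>" "G \<in> mixing_le k \<Gamma>" "r \<in> borel_measurable borel" "\<And>x. 0 \<le> r x"
  shows "(\<integral>\<^sup>+X. ennreal (\<Prod>i<n. r (X i)) \<partial>sample_measure f G n) =
     (\<integral>\<^sup>+x. ennreal (r x) \<partial>density lborel (\<lambda>x. ennreal (mix_density f G x))) ^ n"
proof -
  let ?M = "density lborel (\<lambda>x. ennreal (mix_density f G x))"
  interpret prob_space ?M by (rule prob_space_mix_density[OF assms(1,2)])
  interpret product_sigma_finite "\<lambda>_. ?M" by standard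
  have "(\<integral>\<^sup>+X. ennreal (\<Prod>i<n. r (X i)) \<partial>sample_measure f G n) =
     (\<integral>\<^sup>+X. (\<Prod>i\<in>{..<n}. ennreal (r (X i))) \<partial>PiM {..<n} (\<lambda>_. ?M))"
    unfolding sample_measure_def using assms(4) by (simp add: prod_ennreal)
  also have "\<dots> = (\<Prod>i\<in>{..<n}. \<integral>\<^sup>+x. ennreal (r x) \<partial>?M)"
    using assms(3) by (intro product_nn_integral_prod) auto
  finally show ?thesis by simp
qed

text \<open>Every bracket that contains a mixture at distance more than \<open>s\<close> from the truth is represented by
  such a mixture, which provides the affinity bound; in this way finitely many fixed mixtures take the
  place of the random estimator. On the event that the estimator is at distance more than \<open>s\<close>, the product that belongs to its bracket is
  at least 1 and hence dominates the distance.\<close>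
lemma MLE_kolmogorov_tail:
  fixes f :: "real^'b \<Rightarrow> real^'d \<Rightarrow> real" and \<kappa> :: "(real^'d) measure \<Rightarrow> 'key"
  assumes fam: "density_family f \<Gamma>" and G: "G \<in> mixing_le k \<Gamma>" and n: "1 \<le> n"
    and mle: "\<And>X. X \<in> space (PiM {..<n} (\<lambda>_. borel)) \<Longrightarrow>
        is_arg_max (log_likelihood f n X) (\<lambda>G. G \<in> mixing_le k \<Gamma>) (Gh X)"
    and e: "e \<in> borel_measurable borel" "\<And>x. 0 \<le> e x" "(\<integral>\<^sup>+x. ennreal (e x) \<partial>lborel) \<le> ennreal (1 / (real n)\<^sup>2)"
    and \<kappa>: "finite (\<kappa> ` mixing_le k \<Gamma>)" "card (\<kappa> ` mixing_le k \<Gamma>) \<le> N"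
    and bracket: "\<And>G G' x. G \<in> mixing_le k \<Gamma> \<Longrightarrow> G' \<in> mixing_le k \<Gamma> \<Longrightarrow> \<kappa> G = \<kappa> G' \<Longrightarrow>
        mix_density f G x \<le> mix_density f G' x + e x"
    and s: "0 < s" and C: "0 \<le> C"
    and T: "\<And>X. X \<in> space (PiM {..<n} (\<lambda>_. borel)) \<Longrightarrow> T X \<le> C * kolmogorov_dist f (Gh X) G"
  shows "expect f G n T \<le> ennreal (C * (s + real N * exp (1 - real n * s\<^sup>2 / 8)))"
proof -
  let ?p = "mix_density f G"
  note pf = mix_density_facts[OF fam G]
  define Bad where "Bad = {G' \<in> mixing_le k \<Gamma>. s < kolmogorov_dist f G' G}"
  define rep where "rep y = (SOME G'. G' \<in> Bad \<and> \<kappa> G' = y)" for y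
  have rep: "rep y \<in> Bad" "\<kappa> (rep y) = y" if "y \<in> \<kappa> ` Bad" for y
  proof -
    have "\<exists>G'. G' \<in> Bad \<and> \<kappa> G' = y" using that by blast
    from someI_ex[OF this] show "rep y \<in> Bad" "\<kappa> (rep y) = y" unfolding rep_def by auto
  qed
  have Bad_sub: "\<kappa> ` Bad \<subseteq> \<kappa> ` mixing_le k \<Gamma>" by (auto simp: Bad_def)
  have finBad: "finite (\<kappa> ` Bad)" and cardBad: "card (\<kappa> ` Bad) \<le> N"
    using finite_subset[OF Bad_sub \<kappa>(1)] card_mono[OF \<kappa>(1) Bad_sub] \<kappa>(2) by auto
  define r where "r y x = sqrt ((mix_density f (rep y) x + e x) / ?p x)" for y x
  have qf: "rep y \<in> mixing_le k \<Gamma>" if "y \<in> \<kappa> ` Bad" for y using rep(1)[OF that] by (simp add: Bad_def)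
  have r0: "0 \<le> r y x" if "y \<in> \<kappa> ` Bad" for y x
    using mix_density_facts(2)[OF fam qf[OF that]] e(2) pf(2) by (simp add: r_def)
  have rm: "r y \<in> borel_measurable borel" if "y \<in> \<kappa> ` Bad" for y
  proof -
    note [measurable] = mix_density_facts(1)[OF fam qf[OF that]] pf(1) e(1)
    show ?thesis unfolding r_def[abs_def] by measurable
  qed
  have pointwise: "ennreal (T X) \<le> ennreal C * (ennreal s + (\<Sum>y\<in>\<kappa> ` Bad. ennreal (\<Prod>i<n. r y (X i))))"
    if X: "X \<in> space (sample_measure f G n)" and pos: "\<forall>i<n. 0 < ?p (X i)" for X
  proof -
    have X': "X \<in> space (PiM {..<n} (\<lambda>_. borel))" using X by (simp only: space_sample_measure)
    have Gh: "Gh X \<in> mixing_le k \<Gamma>" using mle[OF X'] by (simp add: is_arg_max_def)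
    note kd = kolmogorov_dist_bounds[OF fam Gh G]
    have nn: "0 \<le> (\<Sum>y\<in>\<kappa> ` Bad. \<Prod>i<n. r y (X i))"
      using r0 by (intro sum_nonneg prod_nonneg) auto
    have "kolmogorov_dist f (Gh X) G \<le> s + (\<Sum>y\<in>\<kappa> ` Bad. \<Prod>i<n. r y (X i))"
    proof (cases "Gh X \<in> Bad")
      case False
      then show ?thesis using Gh nn by (simp add: Bad_def)
    next
      case True
      define y where "y = \<kappa> (Gh X)"
      have y: "y \<in> \<kappa> ` Bad" using True by (simp add: y_def)
      have "1 \<le> (\<Prod>i<n. r y (X i))"
        unfolding r_def
        by (rule MLE_likelihood_ratio[OF mle[OF X'] n G])
           (use pos bracket[OF Gh qf[OF y]] rep(2)[OF y] in \<open>auto simp: y_def\<close>)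
      also have "\<dots> \<le> (\<Sum>y\<in>\<kappa> ` Bad. \<Prod>i<n. r y (X i))"
        by (rule member_le_sum[OF y]) (use r0 finBad in \<open>auto intro: prod_nonneg\<close>)
      finally show ?thesis using kd(3) s by linarith
    qed
    then have "T X \<le> C * (s + (\<Sum>y\<in>\<kappa> ` Bad. \<Prod>i<n. r y (X i)))"
      using T[OF X'] mult_left_mono[OF _ C] by fastforce
    then have "ennreal (T X) \<le> ennreal (C * (s + (\<Sum>y\<in>\<kappa> ` Bad. \<Prod>i<n. r y (X i))))" by (rule ennreal_leI)
    also have "\<dots> = ennreal C * (ennreal s + ennreal (\<Sum>y\<in>\<kappa> ` Bad. \<Prod>i<n. r y (X i)))"
      using C s nn by (simp add: ennreal_mult ennreal_plus)
    also have "ennreal (\<Sum>y\<in>\<kappa> ` Bad. \<Prod>i<n. r y (X i)) = (\<Sum>y\<in>\<kappa> ` Bad. ennreal (\<Prod>i<n. r y (X i)))"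
      using r0 by (intro sum_ennreal[symmetric] prod_nonneg) auto
    finally show ?thesis .
  qed
  have meas: "(\<lambda>X. ennreal (\<Prod>i<n. r y (X i))) \<in> borel_measurable (sample_measure f G n)" if "y \<in> \<kappa> ` Bad" for y
  proof -
    note [measurable] = rm[OF that]
    show ?thesis unfolding sample_measure_def by measurable
  qed
  have prob: "prob_space (sample_measure f G n)"
    unfolding sample_measure_def by (intro prob_space_PiM prob_space_mix_density[OF fam G])
  have int: "(\<integral>\<^sup>+X. ennreal (\<Prod>i<n. r y (X i)) \<partial>sample_measure f G n) \<le> ennreal (exp (1 - real n * s\<^sup>2 / 8))"
    if y: "y \<in> \<kappa> ` Bad" for y
  proof -
    have "s < kolmogorov_dist f (rep y) G" using rep(1)[OF y] by (simp add: Bad_def)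
    then obtain x where x: "s < \<bar>mix_cdf f (rep y) x - mix_cdf f G x\<bar>"
      unfolding kolmogorov_dist_def using cSUP_least[of UNIV "\<lambda>x. \<bar>mix_cdf f (rep y) x - mix_cdf f G x\<bar>" s]
      by (metis UNIV_not_empty not_le)
    note q = mix_density_facts[OF fam qf[OF y]]
    have "(\<integral>\<^sup>+x. ennreal (r y x) \<partial>density lborel (\<lambda>x. ennreal (?p x))) \<le> ennreal (exp (1 / real n - s\<^sup>2 / 8))"
      unfolding r_def
      by (rule nn_integral_sqrt_ratio[OF pf(1,3,2,4) q(1,3,2,4) e lower_orthant_borel[of x] s n])
         (use x in \<open>simp add: pf(5) q(5)\<close>)
    then have "(\<integral>\<^sup>+x. ennreal (r y x) \<partial>density lborel (\<lambda>x. ennreal (?p x))) ^ n \<le> ennreal (exp (1 / real n - s\<^sup>2 / 8)) ^ n"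
      by (rule power_mono) simp
    also have "\<dots> = ennreal (exp (1 - real n * s\<^sup>2 / 8))"
      using n by (simp add: ennreal_power exp_of_nat_mult[symmetric] right_diff_distrib)
    finally show ?thesis using nn_integral_sample_prod[OF fam G rm[OF y] r0[OF y]] by simp
  qed
  have "expect f G n T \<le> (\<integral>\<^sup>+X. ennreal C * (ennreal s + (\<Sum>y\<in>\<kappa> ` Bad. ennreal (\<Prod>i<n. r y (X i)))) \<partial>sample_measure f G n)"
    unfolding expect_def
  proof (rule nn_integral_mono_AE)
    show "AE X in sample_measure f G n. ennreal (T X) \<le> ennreal C * (ennreal s + (\<Sum>y\<in>\<kappa> ` Bad. ennreal (\<Prod>i<n. r y (X i))))"
      using AE_sample_density_pos[OF fam G] AE_space by eventually_elim (rule pointwise)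
  qed
  also have "\<dots> = ennreal C * (ennreal s * emeasure (sample_measure f G n) (space (sample_measure f G n)) +
      (\<Sum>y\<in>\<kappa> ` Bad. \<integral>\<^sup>+X. ennreal (\<Prod>i<n. r y (X i)) \<partial>sample_measure f G n))"
    using meas by (subst nn_integral_cmult; (subst nn_integral_add)?) (auto simp: nn_integral_sum intro!: borel_measurable_sum)
  also have "emeasure (sample_measure f G n) (space (sample_measure f G n)) = 1"
    by (rule prob_space.emeasure_space_1[OF prob])
  also have "ennreal C * (ennreal s * 1 + (\<Sum>y\<in>\<kappa> ` Bad. \<integral>\<^sup>+X. ennreal (\<Prod>i<n. r y (X i)) \<partial>sample_measure f G n))
    \<le> ennreal C * (ennreal s * 1 + (\<Sum>y\<in>\<kappa> ` Bad. ennreal (exp (1 - real n * s\<^sup>2 / 8))))"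
    using int by (intro mult_left_mono add_left_mono sum_mono) auto
  also have "\<dots> = ennreal (C * (s + real (card (\<kappa> ` Bad)) * exp (1 - real n * s\<^sup>2 / 8)))"
    using C s by (simp add: ennreal_mult ennreal_plus ennreal_of_nat_eq_real_of_nat)
  also have "\<dots> \<le> ennreal (C * (s + real N * exp (1 - real n * s\<^sup>2 / 8)))"
    using C cardBad by (intro ennreal_leI mult_left_mono add_left_mono mult_right_mono) auto
  finally show ?thesis .
qed

text \<open>The value of \<open>s\<close> makes \<open>exp (- n s\<^sup>2 / 8)\<close> equal to \<open>n\<close> to the power \<open>- (a + 1)\<close>, which beats the
  number of brackets by a factor \<open>1 / n\<close>.\<close>
lemma rate_choice:
  fixes n a N :: nat
  assumes "n \<ge> 2"
  defines "s \<equiv> sqrt (8 * real (a + 1) * ln (real n) / real n)"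
  shows "0 < s" "s + real (N * n ^ a) * exp (1 - real n * s\<^sup>2 / 8) \<le>
    (sqrt (8 * real (a + 1)) + real N * exp 1) * sqrt (ln (real n) / real n)"
proof -
  have n: "real n > 0" "real n > 1" using assms(1) by auto
  have ln0: "ln (real n) > 0" using n by simp
  have ln_ge: "1 / real n \<le> ln (real n)"
  proof -
    have "ln (1 / real n) \<le> 1 / real n - 1" using n by (intro ln_le_minus_one) simp
    then have "1 - 1 / real n \<le> ln (real n)" using n by (simp add: ln_div)
    moreover have "1 / real n \<le> 1 / 2" using assms(1) by (simp add: field_simps)
    ultimately show ?thesis by linarith
  qed
  show "0 < s" using n ln0 by (simp add: s_def)
  have s2: "s\<^sup>2 = 8 * real (a + 1) * ln (real n) / real n"
    unfolding s_def using n ln0 by (intro real_sqrt_pow2) simp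
  have "exp (1 - real n * s\<^sup>2 / 8) = exp 1 * exp (- (real (a + 1) * ln (real n)))"
  proof -
    have "real n * s\<^sup>2 / 8 = real (a + 1) * ln (real n)" unfolding s2 using n by (simp add: field_simps)
    then show ?thesis by (simp add: mult_exp_exp)
  qed
  also have "exp (- (real (a + 1) * ln (real n))) = 1 / real n ^ (a + 1)"
    using n by (simp only: exp_minus exp_of_nat_mult exp_ln inverse_eq_divide)
  finally have "real (N * n ^ a) * exp (1 - real n * s\<^sup>2 / 8) = real N * exp 1 * (1 / real n)"
    using n by (simp add: field_simps)
  also have "\<dots> \<le> real N * exp 1 * sqrt (ln (real n) / real n)"
  proof (intro mult_left_mono)
    have "(1 / real n)\<^sup>2 \<le> ln (real n) / real n"
      using divide_right_mono[OF ln_ge, of "real n"] n by (simp add: power2_eq_square)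
    then show "1 / real n \<le> sqrt (ln (real n) / real n)" by (rule real_le_rsqrt)
  qed simp
  finally show "s + real (N * n ^ a) * exp (1 - real n * s\<^sup>2 / 8) \<le>
    (sqrt (8 * real (a + 1)) + real N * exp 1) * sqrt (ln (real n) / real n)"
    by (simp add: s_def distrib_right real_sqrt_mult[symmetric] del: of_nat_add of_nat_Suc)
qed

theorem theorem1:
  fixes f :: "real^'b \<Rightarrow> real^'d \<Rightarrow> real"
    and \<Gamma> :: "(real^'d) set"
    and k k0 :: nat and \<delta> :: real
    and G0 :: "(real^'d) measure"
    and Ghat :: "nat \<Rightarrow> (nat \<Rightarrow> real^'b) \<Rightarrow> (real^'d) measure"
  assumes "compact \<Gamma>" and "interior \<Gamma> \<noteq> {}"
    and "density_family f \<Gamma>"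
    and "1 \<le> k0" and "k0 \<le> k" and "\<delta> > 0"
    and "G0 \<in> mixing_eq k0 \<Gamma>"
    and "assumption_A f \<Gamma>" and "assumption_B f \<Gamma>" and "assumption_C (2 * k) f \<Gamma>"
    and "\<And>n. n \<ge> 1 \<Longrightarrow> is_MLE f \<Gamma> k n (Ghat n)"
  shows "(\<exists>\<epsilon>>0. \<exists>C>0. \<forall>n\<ge>2.
            (SUP G\<in>{G\<in>mixing_le k \<Gamma>. wasserstein 1 G G0 < \<epsilon>}.
               expect f G n (\<lambda>X. VPOT \<Gamma> k G0 \<delta> (Ghat n X) G))
              \<le> ennreal (C * sqrt (ln (real n) / real n)))
       \<and> (\<exists>C'>0. \<forall>n\<ge>2.
            (SUP G\<in>mixing_le k \<Gamma>.
               expect f G n (\<lambda>X. VPOT \<Gamma> k G \<delta> (Ghat n X) G))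
              \<le> ennreal (C' * sqrt (ln (real n) / real n)))"
proof -
  note fam = assms(3)
  have k: "1 \<le> k" using assms(4,5) by simp
  have G0: "G0 \<in> mixing_le k \<Gamma>" using assms(4,5,7) by (simp add: mixing_eq_def mixing_le_def)
  obtain C0 where C0: "C0 > 0"
    and VPOT: "\<forall>G\<in>mixing_le k \<Gamma>. \<forall>G'\<in>mixing_le k \<Gamma>. \<forall>H\<in>mixing_le k \<Gamma>.
      VPOT \<Gamma> k H \<delta> G G' \<le> C0 * kolmogorov_dist f G G'"
    using VPOT_le_kolmogorov[OF assms(1,3,10) k assms(6)] by (elim exE conjE) (rule that)
  obtain N a :: nat where bracketing: "\<forall>n\<ge>1. \<exists>(\<kappa> :: (real^'d) measure \<Rightarrow> nat \<Rightarrow> int \<times> ('d \<Rightarrow> int)) e.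
    e \<in> borel_measurable borel \<and> (\<forall>x. 0 \<le> e x) \<and>
    (\<integral>\<^sup>+x. ennreal (e x) \<partial>lborel) \<le> ennreal (1 / (real n)\<^sup>2) \<and>
    finite (\<kappa> ` mixing_le k \<Gamma>) \<and> card (\<kappa> ` mixing_le k \<Gamma>) \<le> N * n ^ a \<and>
    (\<forall>G\<in>mixing_le k \<Gamma>. \<forall>G'\<in>mixing_le k \<Gamma>. \<kappa> G = \<kappa> G' \<longrightarrow>
       (\<forall>x. mix_density f G x \<le> mix_density f G' x + e x))"
    using polynomial_bracketing[where k = k, OF assms(1,3,8,9)] by (elim exE) (rule that)
  define C where "C = C0 * (sqrt (8 * real (a + 1)) + real N * exp 1)"
  have C: "C > 0" using C0 by (auto simp: C_def intro!: mult_pos_pos add_pos_nonneg)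
  have risk: "expect f G n (\<lambda>X. VPOT \<Gamma> k H \<delta> (Ghat n X) G) \<le> ennreal (C * sqrt (ln (real n) / real n))"
    if G: "G \<in> mixing_le k \<Gamma>" and H: "H \<in> mixing_le k \<Gamma>" and n: "n \<ge> 2" for G H n
  proof -
    have n1: "1 \<le> n" using n by simp
    obtain \<kappa> :: "(real^'d) measure \<Rightarrow> nat \<Rightarrow> int \<times> ('d \<Rightarrow> int)" and e
      where e: "e \<in> borel_measurable borel" "\<forall>x. 0 \<le> e x" "(\<integral>\<^sup>+x. ennreal (e x) \<partial>lborel) \<le> ennreal (1 / (real n)\<^sup>2)"
        and \<kappa>: "finite (\<kappa> ` mixing_le k \<Gamma>)" "card (\<kappa> ` mixing_le k \<Gamma>) \<le> N * n ^ a"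
        and br: "\<forall>G\<in>mixing_le k \<Gamma>. \<forall>G'\<in>mixing_le k \<Gamma>. \<kappa> G = \<kappa> G' \<longrightarrow>
          (\<forall>x. mix_density f G x \<le> mix_density f G' x + e x)"
      using bracketing[rule_format, OF n1] by (elim exE conjE) (rule that)
    have mle: "is_arg_max (log_likelihood f n X) (\<lambda>G. G \<in> mixing_le k \<Gamma>) (Ghat n X)"
      if "X \<in> space (PiM {..<n} (\<lambda>_. borel))" for X
      using assms(11)[OF n1] that unfolding is_MLE_def by blast
    define s where "s = sqrt (8 * real (a + 1) * ln (real n) / real n)"
    note rate = rate_choice(1)[OF n, where a = a, folded s_def] rate_choice(2)[OF n, where a = a and N = N, folded s_def]
    have "expect f G n (\<lambda>X. VPOT \<Gamma> k H \<delta> (Ghat n X) G) \<le>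
      ennreal (C0 * (s + real (N * n ^ a) * exp (1 - real n * s\<^sup>2 / 8)))"
    proof (rule MLE_kolmogorov_tail[OF fam G n1 mle e(1) _ e(3) \<kappa> _ rate(1)])
      show "VPOT \<Gamma> k H \<delta> (Ghat n X) G \<le> C0 * kolmogorov_dist f (Ghat n X) G"
        if "X \<in> space (PiM {..<n} (\<lambda>_. borel))" for X
        using VPOT G H mle[OF that] by (simp add: is_arg_max_def)
      show "mix_density f G x \<le> mix_density f G' x + e x"
        if "G \<in> mixing_le k \<Gamma>" "G' \<in> mixing_le k \<Gamma>" "\<kappa> G = \<kappa> G'" for G G' x
        using br that by blast
    qed (use e(2) C0 in auto)
    also have "\<dots> \<le> ennreal (C * sqrt (ln (real n) / real n))"
      using mult_left_mono[OF rate(2) less_imp_le[OF C0]] by (intro ennreal_leI) (simp add: C_def mult.assoc)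
    finally show ?thesis .
  qed
  show ?thesis
  proof
    show "\<exists>\<epsilon>>0. \<exists>C>0. \<forall>n\<ge>2.
            (SUP G\<in>{G\<in>mixing_le k \<Gamma>. wasserstein 1 G G0 < \<epsilon>}.
               expect f G n (\<lambda>X. VPOT \<Gamma> k G0 \<delta> (Ghat n X) G))
              \<le> ennreal (C * sqrt (ln (real n) / real n))"
      using risk G0 C by (intro exI[of _ 1] conjI exI[of _ C] allI impI SUP_least) auto
    show "\<exists>C'>0. \<forall>n\<ge>2.
            (SUP G\<in>mixing_le k \<Gamma>.
               expect f G n (\<lambda>X. VPOT \<Gamma> k G \<delta> (Ghat n X) G))
              \<le> ennreal (C' * sqrt (ln (real n) / real n))"
      using risk C by (intro conjI exI[of _ C] allI impI SUP_least) auto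
  qed
qed

end
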